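(* Let $\mathcal{F}$ be one of the very simple families of increasing trees (recursive trees, $d$-ary increasing trees for some $d\ge2$, or generalized plane-oriented recursive trees with parameter $r>0$), together with a partition, for every $k$, of the trees of size $k$ in $\mathcal{F}$ into a set $\mathcal{I}_k$ of isomorphism classes, such that: (C1) $\limsup_{k\to\infty}\frac{\log|\mathcal{I}_k|}{k}=C_1<\infty$; (C2) there exist subsets $\mathcal{J}_k\subseteq\mathcal{I}_k$ and a constant $C_2>0$ such that (C2a) a random tree of $\mathcal{F}$ with $k$ vertices belongs to a class in $\mathcal{J}_k$ with probability $1-o(1)$ as $k\to\infty$, and (C2b) the probability that a random tree of $\mathcal{F}$ with $k$ vertices lies in any fixed class $I\in\mathcal{J}_k$ is at most $e^{-C_2k+o(k)}$. Let $A_n$ be the number of distinct isomorphism classes represented by the fringe subtrees of a random tree $T_n$ of size $n$ from $\mathcal{F}$. Set $\kappa=\frac{1}{1+\alpha}$, where $\alpha=0$ for recursive trees, $\alpha=1/r$ for generalized plane-oriented recursive trees, and $\alpha=-1/d$ for $d$-ary increasing trees. Then (i) $\frac{\kappa C_2 n}{\log n}(1+o(1))\le\mathbb{E}(A_n)\le\frac{\kappa C_1 n}{\log n}(1+o(1))$; (ii) with probability tending to $1$, $\frac{\kappa C_2 n}{\log n}(1+o(1))\le A_n\le\frac{\kappa C_1 n}{\log n}(1+o(1))$.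
   Context: An increasing tree of size $n$ is a rooted tree with vertices labelled $1,\dots,n$ such that labels increase along every path from the root. Recursive trees are unordered increasing trees (uniformly random); $d$-ary increasing trees are increasing trees in which each vertex has $d$ distinct positions for children (uniformly random); generalized plane-oriented recursive trees (gports) are plane increasing trees weighted by $\prod_v\binom{r+\deg(v)-1}{\deg(v)}$. Equivalently, a random tree of size $n$ is produced by starting with the root labelled $1$ and attaching vertex $j$ ($j=2,\dots,n$) to an existing vertex with probability proportional to $1+\alpha\ell$, where $\ell$ is that vertex's current number of children. A fringe subtree (a vertex and all its descendants), with its labels relabelled in an order-preserving way, is again a tree of the family. Size = number of vertices. *)

theory Defs
  imports "HOL-Probability.Probability" "HOL-Library.FSet" "HOL-Library.Landau_Symbols"
begin

text \<open>
  The three kinds of child structure of a vertex: an unordered collection (recursive trees),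
  a fixed number of positions each of which is empty or carries a child (\<open>d\<close>-ary trees), and a
  left-to-right sequence (plane trees).
\<close>

datatype (children: 't) child_structure =
  Unordered "'t fset" | Slots "'t option list" | Ordered "'t list"

datatype (labels: 'a) labelled_tree = Vertex 'a "'a labelled_tree child_structure"
  for map: map_labels

datatype family = Recursive | Dary nat | Gport real

text \<open>
  The two \<open>distinct\<close> conditions say that no child is listed twice. They only exclude repeated
  labels, since different children of a vertex are required below to have disjoint sets of labels.
\<close>

fun valid_children :: "family \<Rightarrow> 't child_structure \<Rightarrow> bool" where
  "valid_children Recursive (Unordered S) \<longleftrightarrow> True"
| "valid_children (Dary d) (Slots xs) \<longleftrightarrow> length xs = d \<and> distinct (filter (\<lambda>x. x \<noteq> None) xs)"
| "valid_children (Gport r) (Ordered ts) \<longleftrightarrow> distinct ts"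
| "valid_children _ _ \<longleftrightarrow> False"

inductive increasing :: "family \<Rightarrow> nat labelled_tree \<Rightarrow> bool" for F where
  Vertex: "\<lbrakk>valid_children F ks; disjoint_family_on labels (children ks);
    \<And>s. s \<in> children ks \<Longrightarrow> increasing F s;
    \<And>s x. s \<in> children ks \<Longrightarrow> x \<in> labels s \<Longrightarrow> a < x\<rbrakk>
   \<Longrightarrow> increasing F (Vertex a ks)"

definition trees_of_size :: "family \<Rightarrow> nat \<Rightarrow> nat labelled_tree set" where
  "trees_of_size F n = {t. increasing F t \<and> labels t = {1..n}}"

text \<open>
  In a tree without repeated labels the fringe subtrees (with their original labels) correspond
  bijectively to the vertices.
\<close>

inductive_set fringe :: "'a labelled_tree \<Rightarrow> 'a labelled_tree set" for t where
  self: "t \<in> fringe t"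
| child: "Vertex a ks \<in> fringe t \<Longrightarrow> s \<in> children ks \<Longrightarrow> s \<in> fringe t"

fun outdegree :: "'a labelled_tree \<Rightarrow> nat" where
  "outdegree (Vertex a ks) = card (children ks)"

fun vertex_weight :: "family \<Rightarrow> nat \<Rightarrow> real" where
  "vertex_weight (Gport r) m = (r + real m - 1) gchoose m"
| "vertex_weight _ m = 1"

definition weight :: "family \<Rightarrow> nat labelled_tree \<Rightarrow> real" where
  "weight F t = (\<Prod>s\<in>fringe t. vertex_weight F (outdegree s))"

definition random_tree :: "family \<Rightarrow> nat \<Rightarrow> nat labelled_tree pmf" where
  "random_tree F n =
     embed_pmf (\<lambda>t. if t \<in> trees_of_size F n then weight F t / (\<Sum>s\<in>trees_of_size F n. weight F s) else 0)"

text \<open>The order-preserving relabelling by \<open>1, 2, \<dots>\<close>: each label is replaced by its rank.\<close>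

definition relabel :: "nat labelled_tree \<Rightarrow> nat labelled_tree" where
  "relabel s = map_labels (\<lambda>x. card {y \<in> labels s. y \<le> x}) s"

definition num_fringe_classes :: "(nat \<Rightarrow> nat labelled_tree set set) \<Rightarrow> nat labelled_tree \<Rightarrow> nat" where
  "num_fringe_classes I t = card {C. \<exists>s\<in>fringe t. C \<in> I (card (labels s)) \<and> relabel s \<in> C}"

fun attachment :: "family \<Rightarrow> real" where
  "attachment Recursive = 0"
| "attachment (Dary d) = - 1 / real d"
| "attachment (Gport r) = 1 / r"

definition kappa :: "family \<Rightarrow> real" where
  "kappa F = 1 / (1 + attachment F)"

definition very_simple :: "family \<Rightarrow> bool" where
  "very_simple F \<longleftrightarrow> F = Recursive \<or> (\<exists>d\<ge>2. F = Dary d) \<or> (\<exists>r>0. F = Gport r)"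


subsection \<open>The random tree is well defined\<close>

lemma finite_children [simp]: "finite (children ks)"
proof (cases ks)
  case (Slots xs)
  have "finite (set_option x)" for x :: "'a option" by (cases x) auto
  then show ?thesis using Slots by auto
qed auto

lemma finite_valid_children:
  assumes "finite B"
  shows "finite {ks. valid_children F ks \<and> children ks \<subseteq> B}"
proof (cases F)
  case Recursive
  have "{ks. valid_children F ks \<and> children ks \<subseteq> B} \<subseteq> (\<lambda>X. Unordered (Abs_fset X)) ` Pow B"
  proof
    fix ks assume "ks \<in> {ks. valid_children F ks \<and> children ks \<subseteq> B}"
    then obtain S where "ks = Unordered S" "fset S \<subseteq> B" using Recursive by (cases ks) auto
    then show "ks \<in> (\<lambda>X. Unordered (Abs_fset X)) ` Pow B"
      by (intro image_eqI[of _ _ "fset S"]) (auto simp: fset_inverse)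
  qed
  then show ?thesis using assms by (meson finite_Pow_iff finite_imageI finite_subset)
next
  case (Dary d)
  have "{ks. valid_children F ks \<and> children ks \<subseteq> B} \<subseteq>
      Slots ` {xs. set xs \<subseteq> insert None (Some ` B) \<and> length xs = d}"
  proof
    fix ks assume "ks \<in> {ks. valid_children F ks \<and> children ks \<subseteq> B}"
    then obtain xs where xs: "ks = Slots xs" "length xs = d" "(\<Union>x\<in>set xs. set_option x) \<subseteq> B"
      using Dary by (cases ks) auto
    have "set xs \<subseteq> insert None (Some ` B)"
    proof
      fix x assume "x \<in> set xs"
      then have "set_option x \<subseteq> B" using xs(3) by blast
      then show "x \<in> insert None (Some ` B)" by (cases x) auto
    qed
    then show "ks \<in> Slots ` {xs. set xs \<subseteq> insert None (Some ` B) \<and> length xs = d}" using xs by auto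
  qed
  moreover have "finite {xs. set xs \<subseteq> insert None (Some ` B) \<and> length xs = d}"
    using assms by (intro finite_lists_length_eq) auto
  ultimately show ?thesis by (meson finite_imageI finite_subset)
next
  case (Gport r)
  have "{ks. valid_children F ks \<and> children ks \<subseteq> B} \<subseteq> Ordered ` {xs. set xs \<subseteq> B \<and> distinct xs}"
  proof
    fix ks assume "ks \<in> {ks. valid_children F ks \<and> children ks \<subseteq> B}"
    then show "ks \<in> Ordered ` {xs. set xs \<subseteq> B \<and> distinct xs}" using Gport by (cases ks) auto
  qed
  moreover have "finite {xs. set xs \<subseteq> B \<and> distinct xs}"
    using assms by (rule finite_subset_distinct)
  ultimately show ?thesis by (meson finite_imageI finite_subset)
qed

lemma finite_increasing:
  assumes "finite A"
  shows "finite {t. increasing F t \<and> labels t \<subseteq> A}"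
  using assms
proof (induction A rule: finite_psubset_induct)
  case (psubset A)
  define T where "T a = {t. increasing F t \<and> labels t \<subseteq> A - {a}}" for a
  have T: "finite (T a)" if "a \<in> A" for a
    unfolding T_def using that by (intro psubset.IH) auto
  have "{t. increasing F t \<and> labels t \<subseteq> A} \<subseteq>
      (\<Union>a\<in>A. Vertex a ` {ks. valid_children F ks \<and> children ks \<subseteq> T a})"
  proof
    fix t assume "t \<in> {t. increasing F t \<and> labels t \<subseteq> A}"
    then have t: "increasing F t" "labels t \<subseteq> A" by auto
    from t(1) show "t \<in> (\<Union>a\<in>A. Vertex a ` {ks. valid_children F ks \<and> children ks \<subseteq> T a})"
    proof cases
      case (Vertex ks a)
      have "children ks \<subseteq> T a"
        using Vertex t(2) unfolding T_def by fastforce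
      then show ?thesis using Vertex t(2) by auto
    qed
  qed
  moreover have "finite \<dots>"
    using psubset.hyps T by (intro finite_UN_I finite_imageI finite_valid_children) auto
  ultimately show ?case by (rule finite_subset)
qed

lemma finite_trees: "finite (trees_of_size F n)"
  by (rule finite_subset[OF _ finite_increasing[of "{1..n}" F]]) (auto simp: trees_of_size_def)

lemma trees_nonempty:
  assumes "very_simple F" "n \<ge> 1"
  shows "trees_of_size F n \<noteq> {}"
proof -
  obtain leaf :: "nat labelled_tree child_structure" where leaf: "valid_children F leaf" "children leaf = {}"
  proof (cases F)
    case Recursive then show ?thesis by (intro that[of "Unordered {||}"]) auto
  next
    case (Dary d) then show ?thesis by (intro that[of "Slots (replicate d None)"]) auto
  next
    case (Gport r) then show ?thesis by (intro that[of "Ordered []"]) auto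
  qed
  have single: "\<exists>ks. valid_children F ks \<and> children ks = {t}" for t :: "nat labelled_tree"
  proof (cases F)
    case Recursive then show ?thesis by (intro exI[of _ "Unordered {|t|}"]) auto
  next
    case (Dary d)
    then obtain d' where "d = Suc d'" using assms(1) by (cases d) (auto simp: very_simple_def)
    then show ?thesis using Dary by (intro exI[of _ "Slots (Some t # replicate d' None)"]) auto
  next
    case (Gport r) then show ?thesis by (intro exI[of _ "Ordered [t]"]) auto
  qed
  have "\<exists>t. increasing F t \<and> labels t = {a..a + m}" for a m
  proof (induction m arbitrary: a)
    case 0
    show ?case using leaf by (intro exI[of _ "Vertex a leaf"]) (auto intro!: increasing.Vertex simp: disjoint_family_on_def)
  next
    case (Suc m)
    obtain t where t: "increasing F t" "labels t = {Suc a..Suc a + m}" using Suc.IH by blast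
    obtain ks where "valid_children F ks" "children ks = {t}" using single by blast
    then show ?case using t
      by (intro exI[of _ "Vertex a ks"]) (auto intro!: increasing.Vertex simp: disjoint_family_on_def)
  qed
  from this[of 1 "n - 1"] show ?thesis using assms(2) by (auto simp: trees_of_size_def)
qed

lemma vertex_weight_pos:
  assumes "very_simple F"
  shows "vertex_weight F m > 0"
proof (cases F)
  case (Gport r)
  then have "r > 0" using assms by (auto simp: very_simple_def)
  then show ?thesis
    using Gport by (auto simp: gbinomial_pochhammer' intro!: divide_pos_pos pochhammer_pos)
qed auto

lemma weight_pos: "very_simple F \<Longrightarrow> weight F t > 0"
  unfolding weight_def by (intro prod_pos vertex_weight_pos)

lemma pmf_random_tree:
  assumes "very_simple F" "n \<ge> 1"
  shows "pmf (random_tree F n) t =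
    (if t \<in> trees_of_size F n then weight F t / (\<Sum>s\<in>trees_of_size F n. weight F s) else 0)"
proof -
  define W where "W = (\<Sum>s\<in>trees_of_size F n. weight F s)"
  define f where "f t = (if t \<in> trees_of_size F n then weight F t / W else 0)" for t
  have W: "W > 0"
    unfolding W_def using assms by (intro sum_pos finite_trees trees_nonempty weight_pos)
  have nonneg: "f t \<ge> 0" for t
    using W weight_pos[OF assms(1), of t] by (auto simp: f_def)
  have "(\<integral>\<^sup>+t. ennreal (f t) \<partial>count_space UNIV) = (\<Sum>t\<in>trees_of_size F n. ennreal (f t))"
    by (intro nn_integral_count_space'[OF finite_trees]) (auto simp: f_def)
  also have "\<dots> = ennreal (\<Sum>t\<in>trees_of_size F n. f t)"
    using nonneg by (intro sum_ennreal) auto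
  also have "(\<Sum>t\<in>trees_of_size F n. f t) = 1"
    using W by (simp add: f_def W_def flip: sum_divide_distrib)
  finally have "pmf (embed_pmf f) t = f t"
    using nonneg by (intro pmf_embed_pmf) auto
  then show ?thesis unfolding random_tree_def f_def W_def .
qed


subsection \<open>Relabelled fringe subtrees belong to the family\<close>

lemma increasing_fringe: "s \<in> fringe t \<Longrightarrow> increasing F t \<Longrightarrow> increasing F s"
  by (induction rule: fringe.induct) (auto elim: increasing.cases)

lemma finite_labels: "increasing F t \<Longrightarrow> finite (labels t)"
  by (induction rule: increasing.induct) auto

lemma inj_on_map_labels:
  assumes "disjoint_family_on labels X" "inj_on f (\<Union>(labels ` X))"
  shows "inj_on (map_labels f) X"
proof (rule inj_onI, rule ccontr)
  fix s t assume st: "s \<in> X" "t \<in> X" "map_labels f s = map_labels f t" "s \<noteq> t"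
  obtain x where x: "x \<in> labels s" by (cases s) auto
  have "f x \<in> f ` labels t" using st(3) x by (metis imageI labelled_tree.set_map)
  then obtain y where "y \<in> labels t" "f x = f y" by auto
  then have "x \<in> labels t" using assms(2) x st(1,2) by (metis UN_I inj_onD)
  then show False using assms(1) st x by (auto simp: disjoint_family_on_def)
qed

lemma valid_children_map:
  assumes "valid_children F ks" "inj_on g (children ks)"
  shows "valid_children F (map_child_structure g ks)"
proof (cases ks)
  case (Slots xs)
  then obtain d where F: "F = Dary d" using assms by (cases F) auto
  have "inj_on (map_option g) (set (filter (\<lambda>x. x \<noteq> None) xs))"
    using assms(2) Slots by (intro inj_onI) (auto simp: inj_on_def)
  moreover have "filter (\<lambda>x. x \<noteq> None) (map (map_option g) xs) =
      map (map_option g) (filter (\<lambda>x. x \<noteq> None) xs)"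
    by (simp add: filter_map o_def)
  ultimately show ?thesis using assms(1) Slots F by (simp add: distinct_map)
qed (use assms in \<open>cases F; auto simp: distinct_map\<close>)+

lemma increasing_map_labels:
  "increasing F t \<Longrightarrow> strict_mono_on (labels t) f \<Longrightarrow> increasing F (map_labels f t)"
proof (induction rule: increasing.induct)
  case (Vertex ks a)
  have inj: "inj_on f (\<Union>(labels ` children ks))"
    by (rule inj_on_subset[OF strict_mono_on_imp_inj_on[OF Vertex.prems]]) auto
  note inj' = inj_on_map_labels[OF Vertex.hyps(2) inj]
  show ?case unfolding labelled_tree.map
  proof (rule increasing.Vertex)
    show "valid_children F (map_child_structure (map_labels f) ks)"
      using Vertex.hyps(1) inj' by (rule valid_children_map)
    show "disjoint_family_on labels (children (map_child_structure (map_labels f) ks))"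
      unfolding disjoint_family_on_def child_structure.set_map
    proof (intro ballI impI)
      fix s' t' assume *: "s' \<in> map_labels f ` children ks" "t' \<in> map_labels f ` children ks" "s' \<noteq> t'"
      then obtain s t where st: "s \<in> children ks" "t \<in> children ks" "s \<noteq> t"
        "s' = map_labels f s" "t' = map_labels f t" by auto
      then have "labels s \<inter> labels t = {}" using Vertex.hyps(2) by (auto simp: disjoint_family_on_def)
      then show "labels s' \<inter> labels t' = {}"
        using st inj unfolding st(4,5) labelled_tree.set_map by (auto simp: inj_on_def) blast
    qed
  next
    fix s' assume "s' \<in> children (map_child_structure (map_labels f) ks)"
    then obtain s where s: "s \<in> children ks" "s' = map_labels f s"
      by (auto simp: child_structure.set_map)
    show "increasing F s'" unfolding s(2)
      using s(1) Vertex.prems by (intro Vertex.IH) (auto intro: monotone_on_subset)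
    show "f a < x" if x: "x \<in> labels s'" for x
    proof -
      obtain y where y: "y \<in> labels s" "x = f y" using x unfolding s(2) labelled_tree.set_map by auto
      then show ?thesis using Vertex.hyps(4)[OF s(1) y(1)] Vertex.prems s(1)
        by (auto intro!: strict_mono_onD[OF Vertex.prems])
    qed
  qed
qed

lemma relabel_in_trees:
  assumes "increasing F s"
  shows "relabel s \<in> trees_of_size F (card (labels s))"
proof -
  let ?r = "\<lambda>x. card {y \<in> labels s. y \<le> x}"
  have fin: "finite (labels s)" using assms by (rule finite_labels)
  have mono: "strict_mono_on (labels s) ?r"
  proof (intro strict_mono_onI psubset_card_mono psubsetI)
    fix u v assume "u \<in> labels s" "v \<in> labels s" "u < v"
    then have "v \<in> {y \<in> labels s. y \<le> v}" "v \<notin> {y \<in> labels s. y \<le> u}" by auto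
    then show "{y \<in> labels s. y \<le> u} \<noteq> {y \<in> labels s. y \<le> v}" by blast
  qed (use fin in auto)
  have "?r ` labels s \<subseteq> {1..card (labels s)}"
    using fin by (auto intro!: card_mono simp: Suc_le_eq card_gt_0_iff)
  moreover have "card (?r ` labels s) = card {1..card (labels s)}"
    using strict_mono_on_imp_inj_on[OF mono] by (simp add: card_image)
  ultimately have "?r ` labels s = {1..card (labels s)}"
    by (intro card_subset_eq) auto
  then show ?thesis
    using increasing_map_labels[OF assms mono] by (simp add: trees_of_size_def relabel_def labelled_tree.set_map)
qed

end

theory Submission
  imports Defs "HOL-Real_Asymp.Real_Asymp"
begin

text \<open>
  Decomposing a tree at its root turns weighted sums of multiplicative functionals into sums over set
  partitions, in which all three families only differ by the weight \<open>c\<^sup>m (1 + \<alpha>) \<dots> (1 + (m - 1) \<alpha>)\<close>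
  of a vertex with \<open>m\<close> children. This yields two facts. First, given the sizes of the fringe subtrees,
  those of size \<open>k\<close> are independent copies of the random tree of size \<open>k\<close>. Second, the shape of the
  tree grows by attaching the largest label to \<open>v\<close> with probability proportional to \<open>1 + \<alpha> deg v\<close>.
  With \<open>a\<^sub>n = n + \<alpha> (n - 1)\<close>, the second fact gives the exact mean \<open>a\<^sub>n / (a\<^sub>k a\<^sub>k\<^sub>+\<^sub>1)\<close> of the number of
  fringe subtrees of size \<open>k < n\<close> and a bound for disjoint pairs of fringe subtrees. Hence the number of
  fringe subtrees of size at least \<open>\<gamma> log n\<close> is concentrated around \<open>\<kappa> n / (\<gamma> log n)\<close>.

  For \<open>\<gamma> < 1 / C\<^sub>1\<close> there are only \<open>o (n / log n)\<close> classes of size below \<open>\<gamma> log n\<close>, which gives the upper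
  bound. For \<open>\<gamma> > 1 / C\<^sub>2\<close> almost all fringe subtrees of size at least \<open>\<gamma> log n\<close> lie in typical classes,
  and by the first fact the expected number of coincidences among them is at most \<open>n\<^sup>2 e\<^sup>-\<^sup>C\<^sup>k\<close> for each size
  \<open>k\<close> and any \<open>C < C\<^sub>2\<close>, which is negligible.
\<close>

section \<open>Set partitions and forests\<close>

text \<open>Growth is not realised as a map between trees, which would depend on the kind of child
  structure. Only the weighted law of the family of label sets of fringe subtrees is transported.
  This law is determined by sums of products of a function of the label sets, and such products are
  multiplicative at the root. Given a fringe subtree of size k, the next vertex enters it with
  probability \<open>a_k / a_n\<close>, whatever its shape. Therefore the expected counts of sizes
  satisfy closed linear recursions. A second cutoff \<open>(log n)^2\<close> appears because the
  variance bound for sizes below m carries an error of order \<open>m^4\<close>. Concentration is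
  proved below this cutoff, and beyond it the expected number of fringe subtrees is already
  \<open>o (n / log n)\<close>, so Markov's inequality is enough. Classes are treated one at a time:
  the probability that a given class is absent yields the expected number of classes by linearity.
  The choice of \<gamma> for the upper bound needs C1 > 0, which is forced by (C2).\<close>

fun rate :: "family \<Rightarrow> real" where
  "rate Recursive = 1"
| "rate (Dary d) = real d"
| "rate (Gport r) = r"

text \<open>The total weight of all ways to arrange m given children below one vertex: 1, the
  falling factorial \<open>d (d - 1) ... (d - m + 1)\<close>, or the rising factorial
  \<open>r (r + 1) ... (r + m - 1)\<close>.\<close>

definition child_weight :: "family \<Rightarrow> nat \<Rightarrow> real" where
  "child_weight F m = (\<Prod>i<m. rate F * (1 + attachment F * real i))"

definition trees_on :: "family \<Rightarrow> nat set \<Rightarrow> nat labelled_tree set" where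
  "trees_on F A = {t. increasing F t \<and> labels t = A}"

text \<open>The children of a root as a mere set; the ways to arrange them are counted by
  \<open>child_weight\<close>.\<close>

definition forests :: "family \<Rightarrow> nat set \<Rightarrow> nat labelled_tree set set" where
  "forests F B = {X. disjoint_family_on labels X \<and> (\<forall>s\<in>X. increasing F s) \<and> \<Union>(labels ` X) = B}"

text \<open>An unnormalised expectation. General label sets are needed because the subtrees below a
  root do not carry initial segments.\<close>

definition wsum :: "family \<Rightarrow> nat set \<Rightarrow> (nat labelled_tree \<Rightarrow> real) \<Rightarrow> real" where
  "wsum F A h = (\<Sum>t\<in>trees_on F A. weight F t * h t)"

lemma trees_of_size_eq: "trees_of_size F n = trees_on F {1..n}"
  by (simp add: trees_of_size_def trees_on_def)

lemma finite_trees_on: "finite A \<Longrightarrow> finite (trees_on F A)"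
  by (rule finite_subset[OF _ finite_increasing[of A F]]) (auto simp: trees_on_def)

lemma labels_nonempty [simp]: "labels t \<noteq> {}"
  by (cases t) auto

section \<open>Counting the arrangements of a given set of children\<close>

definition slot_lists :: "nat \<Rightarrow> 't set \<Rightarrow> 't option list set" where
  "slot_lists d X = {xs. length xs = d \<and> distinct (filter (\<lambda>x. x \<noteq> None) xs) \<and>
     (\<Union>x\<in>set xs. set_option x) = X}"

lemma slot_lists_Suc:
  "slot_lists (Suc d) X =
     (#) None ` slot_lists d X \<union> (\<Union>t\<in>X. (#) (Some t) ` slot_lists d (X - {t}))"
proof (rule set_eqI)
  fix xs :: "'a option list"
  show "xs \<in> slot_lists (Suc d) X \<longleftrightarrow>
    xs \<in> (#) None ` slot_lists d X \<union> (\<Union>t\<in>X. (#) (Some t) ` slot_lists d (X - {t}))"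
  proof (cases xs)
    case Nil then show ?thesis by (auto simp: slot_lists_def)
  next
    case (Cons x ys)
    show ?thesis
    proof (cases x)
      case None then show ?thesis using Cons by (auto simp: slot_lists_def)
    next
      case (Some t)
      have "Some t \<in> set ys \<longleftrightarrow> t \<in> (\<Union>x\<in>set ys. set_option x)"
        by (auto simp: elem_set)
      then show ?thesis using Cons Some by (auto simp: slot_lists_def)
    qed
  qed
qed

lemma card_slot_lists:
  "finite X \<Longrightarrow> finite (slot_lists d X) \<and> card (slot_lists d X) = (d choose card X) * fact (card X)"
proof (induction d arbitrary: X)
  case 0
  show ?case
  proof (cases "X = {}")
    case True
    then have "slot_lists 0 X = {[]}" by (auto simp: slot_lists_def)
    then show ?thesis using True by simp
  next
    case False
    then have "slot_lists 0 X = {}" by (auto simp: slot_lists_def)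
    moreover have "card X > 0" using False 0 by (simp add: card_gt_0_iff)
    ultimately show ?thesis by simp
  qed
next
  case (Suc d)
  have fin: "finite (slot_lists d X)" "\<And>t. finite (slot_lists d (X - {t}))"
    using Suc by auto
  have card': "card (slot_lists d (X - {t})) = (d choose (card X - 1)) * fact (card X - 1)" if "t \<in> X" for t
    using Suc that by simp
  have "card (slot_lists (Suc d) X) =
      card ((#) None ` slot_lists d X) + card (\<Union>t\<in>X. (#) (Some t) ` slot_lists d (X - {t}))"
    unfolding slot_lists_Suc using fin Suc.prems by (intro card_Un_disjoint) auto
  also have "card ((#) None ` slot_lists d X) = card (slot_lists d X)"
    by (intro card_image) (auto simp: inj_on_def)
  also have "card (\<Union>t\<in>X. (#) (Some t) ` slot_lists d (X - {t})) =
      (\<Sum>t\<in>X. card ((#) (Some t) ` slot_lists d (X - {t})))"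
    using fin Suc.prems by (intro card_UN_disjoint) auto
  also have "\<dots> = (\<Sum>t\<in>X. card (slot_lists d (X - {t})))"
    by (intro sum.cong card_image) (auto simp: inj_on_def)
  also have "\<dots> = card X * ((d choose (card X - 1)) * fact (card X - 1))"
    using card' by simp
  also have "card (slot_lists d X) + \<dots> = (Suc d choose card X) * fact (card X)"
    using Suc.IH[OF Suc.prems] by (cases "card X") (simp_all add: algebra_simps)
  finally show ?case unfolding slot_lists_Suc using fin Suc.prems by simp
qed

text \<open>The only place where the three families are treated separately. The counts are 1, a
  falling factorial of d (zero for more than d children) and m!. In the last case the factor
  \<open>(r + m - 1) gchoose m\<close> turns m! into a rising factorial.\<close>

lemma card_valid_children:
  assumes "very_simple F" "finite X"
  shows "real (card {ks. valid_children F ks \<and> children ks = X}) * vertex_weight F (card X) =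
    child_weight F (card X)"
proof (cases F)
  case Recursive
  have "{ks. valid_children F ks \<and> children ks = X} = {Unordered (Abs_fset X)}"
  proof (rule set_eqI)
    fix ks
    show "ks \<in> {ks. valid_children F ks \<and> children ks = X} \<longleftrightarrow> ks \<in> {Unordered (Abs_fset X)}"
      using assms(2) Recursive by (cases ks) (auto simp: Abs_fset_inverse fset_inverse)
  qed
  then show ?thesis using Recursive by (simp add: child_weight_def)
next
  case (Dary d)
  have d: "d > 0" using assms(1) Dary by (auto simp: very_simple_def)
  have "{ks. valid_children F ks \<and> children ks = X} = Slots ` slot_lists d X"
  proof (rule set_eqI)
    fix ks
    show "ks \<in> {ks. valid_children F ks \<and> children ks = X} \<longleftrightarrow> ks \<in> Slots ` slot_lists d X"
      using Dary by (cases ks) (auto simp: slot_lists_def)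
  qed
  then have "card {ks. valid_children F ks \<and> children ks = X} = (d choose card X) * fact (card X)"
    using card_slot_lists[OF assms(2)] by (simp add: card_image inj_on_def)
  moreover have "real ((d choose card X) * fact (card X)) = (\<Prod>i<card X. real d - real i)"
    by (simp add: binomial_gbinomial gbinomial_prod_rev atLeast0LessThan)
  ultimately show ?thesis
    using Dary d by (auto simp: child_weight_def field_simps intro!: prod.cong)
next
  case (Gport r)
  then have r: "r > 0" using assms(1) by (auto simp: very_simple_def)
  have "{ks. valid_children F ks \<and> children ks = X} = Ordered ` permutations_of_set X"
  proof (rule set_eqI)
    fix ks
    show "ks \<in> {ks. valid_children F ks \<and> children ks = X} \<longleftrightarrow> ks \<in> Ordered ` permutations_of_set X"
      using Gport by (cases ks) (auto simp: permutations_of_set_def)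
  qed
  then have "card {ks. valid_children F ks \<and> children ks = X} = fact (card X)"
    using assms(2) by (simp add: card_image inj_on_def)
  then have "real (card {ks. valid_children F ks \<and> children ks = X}) * vertex_weight F (card X) =
      pochhammer r (card X)"
    using Gport by (simp add: gbinomial_pochhammer')
  also have "\<dots> = child_weight F (card X)"
    using Gport r by (simp add: child_weight_def pochhammer_prod atLeast0LessThan algebra_simps)
  finally show ?thesis .
qed

section \<open>Products over the fringe and the decomposition at the root\<close>

lemma fringe_Vertex:
  "fringe (Vertex a ks) = insert (Vertex a ks) (\<Union>s\<in>children ks. fringe s)"
proof (intro equalityI subsetI)
  fix x assume "x \<in> fringe (Vertex a ks)"
  then show "x \<in> insert (Vertex a ks) (\<Union>s\<in>children ks. fringe s)"
    by induction (auto intro: fringe.intros)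
next
  have *: "x \<in> fringe (Vertex a ks)" if "x \<in> fringe s" "s \<in> children ks" for x s
    using that by induction (auto intro: fringe.intros)
  fix x assume "x \<in> insert (Vertex a ks) (\<Union>s\<in>children ks. fringe s)"
  then show "x \<in> fringe (Vertex a ks)" using * by (auto intro: fringe.self)
qed

lemma finite_fringe [simp]: "finite (fringe t)"
  by (induction t) (auto simp: fringe_Vertex)

lemma labels_fringe_subset: "s \<in> fringe t \<Longrightarrow> labels s \<subseteq> labels t"
  by (induction rule: fringe.induct) auto

lemma increasing_VertexD:
  assumes "increasing F (Vertex a ks)"
  shows "valid_children F ks" "disjoint_family_on labels (children ks)"
    "\<And>s. s \<in> children ks \<Longrightarrow> increasing F s"
    "\<And>s x. s \<in> children ks \<Longrightarrow> x \<in> labels s \<Longrightarrow> a < x"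
  using assms by (auto elim: increasing.cases)

text \<open>Label sets of distinct children are disjoint and never empty, so their fringes cannot
  overlap. Every functional used below is such a product, or is reduced to one.\<close>

lemma prod_fringe_Vertex:
  assumes "increasing F (Vertex a ks)"
  shows "(\<Prod>x\<in>fringe (Vertex a ks). u x) =
    u (Vertex a ks) * (\<Prod>s\<in>children ks. \<Prod>x\<in>fringe s. u x :: real)"
proof -
  note D = increasing_VertexD[OF assms]
  have "Vertex a ks \<notin> (\<Union>s\<in>children ks. fringe s)"
  proof
    assume "Vertex a ks \<in> (\<Union>s\<in>children ks. fringe s)"
    then obtain s where "s \<in> children ks" "a \<in> labels s" using labels_fringe_subset by fastforce
    then show False using D(4) by blast
  qed
  moreover have "fringe s \<inter> fringe s' = {}" if "s \<in> children ks" "s' \<in> children ks" "s \<noteq> s'" for s s'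
  proof -
    have "labels s \<inter> labels s' = {}" using that D(2) by (auto simp: disjoint_family_on_def)
    then show ?thesis using labels_fringe_subset labels_nonempty by (metis disjoint_iff le_inf_iff subset_empty)
  qed
  ultimately show ?thesis
    unfolding fringe_Vertex by (subst prod.insert) (auto simp: prod.UNION_disjoint)
qed

lemma weight_Vertex:
  assumes "increasing F (Vertex a ks)"
  shows "weight F (Vertex a ks) = vertex_weight F (card (children ks)) * (\<Prod>s\<in>children ks. weight F s)"
  unfolding weight_def by (subst prod_fringe_Vertex[OF assms]) simp

text \<open>A forest is a set partition together with a tree on each block. Distinct trees of a
  forest have distinct label sets, so \<open>the_inv_into\<close> recovers the tree from its block,
  and distributivity turns the sum over choices of trees into a product over blocks.\<close>

lemma sum_forests:
  fixes Q :: "nat \<Rightarrow> real"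
  assumes "finite B"
  shows "(\<Sum>X\<in>forests F B. Q (card X) * (\<Prod>s\<in>X. q s)) =
    (\<Sum>P | partition_on B P. Q (card P) * (\<Prod>S\<in>P. \<Sum>s\<in>trees_on F S. q s))"
proof -
  have finP: "finite P" "\<And>S. S \<in> P \<Longrightarrow> finite S" if "partition_on B P" for P
    using that assms by (auto intro: finite_elements dest: partition_onD1 intro!: finite_subset[of _ B])
  have finPP: "finite {P. partition_on B P}"
    using assms by (simp add: finitely_many_partition_on)
  have inj: "inj_on labels X" if "X \<in> forests F B" for X
    using that labels_nonempty unfolding forests_def disjoint_family_on_def inj_on_def
    by (metis (mono_tags, lifting) inf.idem mem_Collect_eq)
  have inj_f: "inj_on f P" if "f \<in> Pi\<^sub>E P (trees_on F)" for f P
    using that by (intro inj_onI) (metis (mono_tags, lifting) PiE_mem mem_Collect_eq trees_on_def)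
  have "(\<Sum>P | partition_on B P. Q (card P) * (\<Prod>S\<in>P. \<Sum>s\<in>trees_on F S. q s)) =
     (\<Sum>P | partition_on B P. \<Sum>f\<in>Pi\<^sub>E P (trees_on F). Q (card P) * (\<Prod>S\<in>P. q (f S)))"
    using finP finite_trees_on by (intro sum.cong refl) (simp add: prod_sum_PiE sum_distrib_left)
  also have "\<dots> = (\<Sum>(P,f)\<in>Sigma {P. partition_on B P} (\<lambda>P. Pi\<^sub>E P (trees_on F)). Q (card P) * (\<Prod>S\<in>P. q (f S)))"
    using finPP finP finite_trees_on by (intro sum.Sigma) (auto intro!: finite_PiE)
  also have "\<dots> = (\<Sum>X\<in>forests F B. Q (card X) * (\<Prod>s\<in>X. q s))"
  proof (rule sum.reindex_bij_witness[where j = "\<lambda>(P,f). f ` P" and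
        i = "\<lambda>X. (labels ` X, restrict (the_inv_into X labels) (labels ` X))"], goal_cases)
    case (1 Pf)
    then obtain P f where Pf: "Pf = (P,f)" "partition_on B P" "f \<in> Pi\<^sub>E P (trees_on F)" by auto
    have lab: "labels (f S) = S" if "S \<in> P" for S
      using PiE_mem[OF Pf(3) that] by (simp add: trees_on_def)
    then have im: "labels ` f ` P = P" by (force simp: image_image)
    have inj: "inj_on labels (f ` P)" by (intro inj_onI) (auto simp: lab)
    have "restrict (the_inv_into (f ` P) labels) P = f"
    proof
      fix S show "restrict (the_inv_into (f ` P) labels) P S = f S"
      proof (cases "S \<in> P")
        case True
        then have "the_inv_into (f ` P) labels (labels (f S)) = f S"
          by (intro the_inv_into_f_f[OF inj]) auto
        then show ?thesis using True lab by simp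
      next
        case False
        then show ?thesis using PiE_arb[OF Pf(3)] by simp
      qed
    qed
    then show ?case using Pf im by simp
  next
    case (2 Pf)
    then obtain P f where Pf: "Pf = (P,f)" "partition_on B P" "f \<in> Pi\<^sub>E P (trees_on F)" by auto
    have lab: "labels (f S) = S" "increasing F (f S)" if "S \<in> P" for S
      using PiE_mem[OF Pf(3) that] by (simp_all add: trees_on_def)
    have "disjoint P" "\<Union>P = B" using Pf(2) by (auto simp: partition_on_def)
    have "disjoint_family_on labels (f ` P)"
      unfolding disjoint_family_on_def
    proof (intro ballI impI)
      fix s s' assume "s \<in> f ` P" "s' \<in> f ` P" "s \<noteq> s'"
      then obtain S S' where "S \<in> P" "S' \<in> P" "S \<noteq> S'" "s = f S" "s' = f S'" by auto
      then show "labels s \<inter> labels s' = {}" using \<open>disjoint P\<close> lab(1) by (metis disjointD)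
    qed
    then show ?case using Pf(1) lab \<open>\<Union>P = B\<close> by (auto simp: forests_def)
  next
    case (3 X)
    have "the_inv_into X labels ` labels ` X = X"
      by (rule the_inv_into_onto[OF inj[OF 3]])
    then show ?case by auto
  next
    case (4 X)
    have "partition_on B (labels ` X)"
    proof (rule partition_onI)
      show "\<Union>(labels ` X) = B" using 4 by (simp add: forests_def)
      show "{} \<notin> labels ` X" using labels_nonempty by (metis imageE)
      fix p q assume "p \<in> labels ` X" "q \<in> labels ` X" "p \<noteq> q"
      then obtain s s' where "s \<in> X" "s' \<in> X" "s \<noteq> s'" "p = labels s" "q = labels s'" by auto
      then show "disjnt p q" using 4 by (simp add: forests_def disjoint_family_on_def disjnt_def)
    qed
    moreover have "the_inv_into X labels (labels s) = s" if "s \<in> X" for s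
      using inj[OF 4] that by (simp add: the_inv_into_f_f)
    ultimately show ?case using 4 by (auto simp: trees_on_def forests_def)
  next
    case (5 Pf)
    then obtain P f where Pf: "Pf = (P,f)" "partition_on B P" "f \<in> Pi\<^sub>E P (trees_on F)" by auto
    show ?case using inj_f[OF Pf(3)] by (simp add: Pf(1) card_image prod.reindex)
  qed
  finally show ?thesis by simp
qed

lemma Vertex_in_trees_on_iff:
  assumes "finite A" "A \<noteq> {}"
  shows "Vertex a ks \<in> trees_on F A \<longleftrightarrow>
    a = Min A \<and> valid_children F ks \<and> children ks \<in> forests F (A - {Min A})"
proof
  assume t: "Vertex a ks \<in> trees_on F A"
  then have inc: "increasing F (Vertex a ks)" and A: "A = insert a (\<Union>s\<in>children ks. labels s)"
    by (auto simp: trees_on_def)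
  note D = increasing_VertexD[OF inc]
  have "a = Min A" unfolding A using assms(1) D(4) unfolding A by (intro Min_eqI[symmetric]) force+
  moreover have "A - {a} = (\<Union>s\<in>children ks. labels s)" unfolding A using D(4) by auto
  ultimately show "a = Min A \<and> valid_children F ks \<and> children ks \<in> forests F (A - {Min A})"
    using D by (auto simp: forests_def)
next
  assume *: "a = Min A \<and> valid_children F ks \<and> children ks \<in> forests F (A - {Min A})"
  then have un: "\<Union>(labels ` children ks) = A - {Min A}" by (auto simp: forests_def)
  have less: "Min A < x" if "s \<in> children ks" "x \<in> labels s" for s x
  proof -
    have "x \<in> A" "x \<noteq> Min A" using that un by auto
    then show ?thesis using assms(1) Min_le[of A x] by linarith
  qed
  have "Min A \<in> A" using assms by simp
  have "labels (Vertex a ks) = A" using un * \<open>Min A \<in> A\<close> by auto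
  moreover have "increasing F (Vertex a ks)"
  proof (rule increasing.Vertex)
    show "valid_children F ks" "disjoint_family_on labels (children ks)" using * by (auto simp: forests_def)
    show "\<And>s. s \<in> children ks \<Longrightarrow> increasing F s" using * by (auto simp: forests_def)
    show "\<And>s x. s \<in> children ks \<Longrightarrow> x \<in> labels s \<Longrightarrow> a < x" using * less by simp
  qed
  ultimately show "Vertex a ks \<in> trees_on F A" by (simp add: trees_on_def)
qed

text \<open>The root label is forced to be the minimum. Grouping the child structures by their set
  of children turns vertex weights into \<open>child_weight\<close>, and what remains is a sum over
  forests. Later inductions on label sets rest on this recursion.\<close>

lemma wsum_decompose:
  assumes "very_simple F" "finite A" "A \<noteq> {}"
    and h: "\<And>ks. Vertex (Min A) ks \<in> trees_on F A \<Longrightarrow>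
      h (Vertex (Min A) ks) = r (card (children ks)) * (\<Prod>s\<in>children ks. h s)"
  shows "wsum F A h = (\<Sum>P | partition_on (A - {Min A}) P.
    child_weight F (card P) * r (card P) * (\<Prod>S\<in>P. wsum F S h))"
proof -
  define a B where "a = Min A" and "B = A - {Min A}"
  define K where "K = {ks. valid_children F ks \<and> children ks \<in> forests F B}"
  have "finite B" using assms by (simp add: B_def)
  have T: "trees_on F A = Vertex a ` K"
  proof (rule set_eqI)
    fix t show "t \<in> trees_on F A \<longleftrightarrow> t \<in> Vertex a ` K"
      using Vertex_in_trees_on_iff[OF assms(2,3)] by (cases t) (auto simp: K_def a_def B_def)
  qed
  have finT: "finite (trees_on F A)" using assms(2) by (rule finite_trees_on)
  have finK: "finite K" using finT unfolding T by (rule finite_imageD) (auto simp: inj_on_def)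
  have finF: "finite (forests F B)"
  proof (rule finite_subset)
    show "forests F B \<subseteq> Pow {t. increasing F t \<and> labels t \<subseteq> B}" by (auto simp: forests_def)
    show "finite (Pow {t. increasing F t \<and> labels t \<subseteq> B})"
      using finite_increasing[OF \<open>finite B\<close>, of F] by simp
  qed
  have finX: "finite X" if "X \<in> forests F B" for X
    using that finite_increasing[OF \<open>finite B\<close>, of F]
    by (elim finite_subset[rotated]) (auto simp: forests_def)
  have "wsum F A h = (\<Sum>ks\<in>K. weight F (Vertex a ks) * h (Vertex a ks))"
    unfolding wsum_def T by (subst sum.reindex) (auto simp: inj_on_def)
  also have "\<dots> = (\<Sum>ks\<in>K. vertex_weight F (card (children ks)) * r (card (children ks)) *
      (\<Prod>s\<in>children ks. weight F s * h s))"
  proof (rule sum.cong[OF refl])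
    fix ks assume "ks \<in> K"
    then have t: "Vertex a ks \<in> trees_on F A" using T by auto
    then have "increasing F (Vertex a ks)" by (simp add: trees_on_def)
    from weight_Vertex[OF this] show "weight F (Vertex a ks) * h (Vertex a ks) =
      vertex_weight F (card (children ks)) * r (card (children ks)) * (\<Prod>s\<in>children ks. weight F s * h s)"
      using h[of ks] t by (simp add: a_def prod.distrib)
  qed
  also have "\<dots> = (\<Sum>X\<in>forests F B. \<Sum>ks | ks \<in> K \<and> children ks = X.
      vertex_weight F (card (children ks)) * r (card (children ks)) * (\<Prod>s\<in>children ks. weight F s * h s))"
    using finK finF by (intro sum.group[symmetric]) (auto simp: K_def)
  also have "\<dots> = (\<Sum>X\<in>forests F B. child_weight F (card X) * r (card X) * (\<Prod>s\<in>X. weight F s * h s))"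
  proof (rule sum.cong[OF refl])
    fix X assume X: "X \<in> forests F B"
    have "{ks. ks \<in> K \<and> children ks = X} = {ks. valid_children F ks \<and> children ks = X}"
      using X by (auto simp: K_def)
    then show "(\<Sum>ks | ks \<in> K \<and> children ks = X.
      vertex_weight F (card (children ks)) * r (card (children ks)) * (\<Prod>s\<in>children ks. weight F s * h s)) =
      child_weight F (card X) * r (card X) * (\<Prod>s\<in>X. weight F s * h s)"
      using card_valid_children[OF assms(1) finX[OF X], symmetric] by simp
  qed
  also have "\<dots> = (\<Sum>P | partition_on B P.
      child_weight F (card P) * r (card P) * (\<Prod>S\<in>P. wsum F S h))"
    unfolding wsum_def using sum_forests[OF \<open>finite B\<close>, of "\<lambda>m. child_weight F m * r m" "\<lambda>s. weight F s * h s" F] .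
  finally show ?thesis unfolding B_def .
qed

section \<open>Fringe subtrees of a given size\<close>

lemma weight_map_labels:
  "increasing F t \<Longrightarrow> strict_mono_on (labels t) f \<Longrightarrow> weight F (map_labels f t) = weight F t"
proof (induction rule: increasing.induct)
  case (Vertex ks a)
  have inc: "increasing F (Vertex a ks)" using Vertex.hyps by (intro increasing.Vertex) auto
  have "increasing F (map_labels f (Vertex a ks))"
    using inc Vertex.prems by (rule increasing_map_labels)
  then have inc': "increasing F (Vertex (f a) (map_child_structure (map_labels f) ks))" by simp
  have inj: "inj_on f (\<Union>(labels ` children ks))"
    by (rule inj_on_subset[OF strict_mono_on_imp_inj_on[OF Vertex.prems]]) auto
  note inj' = inj_on_map_labels[OF Vertex.hyps(2) inj]
  have IH: "weight F (map_labels f s) = weight F s" if "s \<in> children ks" for s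
    using that Vertex.prems by (intro Vertex.IH) (auto intro: monotone_on_subset)
  show ?case
    using inj' IH by (simp add: weight_Vertex[OF inc] weight_Vertex[OF inc'] child_structure.set_map
      card_image prod.reindex)
qed

text \<open>Replacing labels by ranks is a bijection, and it preserves weights because it preserves
  the order.\<close>

lemma wsum_relabel:
  assumes "finite A"
  shows "wsum F A (\<lambda>t. f (relabel t)) = wsum F {1..card A} f"
proof -
  define rk where "rk = (\<lambda>x. card {y \<in> A. y \<le> x})"
  have mono: "strict_mono_on A rk" unfolding rk_def
  proof (intro strict_mono_onI psubset_card_mono psubsetI)
    fix u v assume "u \<in> A" "v \<in> A" "u < v"
    then have "v \<in> {y \<in> A. y \<le> v}" "v \<notin> {y \<in> A. y \<le> u}" by auto
    then show "{y \<in> A. y \<le> u} \<noteq> {y \<in> A. y \<le> v}" by blast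
  qed (use assms in auto)
  note inj = strict_mono_on_imp_inj_on[OF mono]
  have "rk ` A \<subseteq> {1..card A}"
    using assms by (auto intro!: card_mono simp: rk_def Suc_le_eq card_gt_0_iff)
  moreover have "card (rk ` A) = card {1..card A}" using inj by (simp add: card_image)
  ultimately have im: "rk ` A = {1..card A}" by (intro card_subset_eq) auto
  define iv where "iv = the_inv_into A rk"
  have iv: "iv (rk x) = x" if "x \<in> A" for x using that inj by (simp add: iv_def the_inv_into_f_f)
  have rk: "rk (iv y) = y" if "y \<in> {1..card A}" for y
    using that inj im by (simp add: iv_def f_the_inv_into_f)
  have iv_im: "iv ` {1..card A} = A" using im inj by (metis iv_def the_inv_into_onto)
  have iv_mono: "strict_mono_on {1..card A} iv"
  proof (rule strict_mono_onI)
    fix r s assume rs: "r \<in> {1..card A}" "s \<in> {1..card A}" "r < s"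
    then have A: "iv r \<in> A" "iv s \<in> A" using iv_im by auto
    show "iv r < iv s"
    proof (rule ccontr)
      assume "\<not> iv r < iv s"
      then have "rk (iv s) \<le> rk (iv r)"
        using A mono by (metis le_less linorder_not_less strict_mono_onD)
      then show False using rs rk by simp
    qed
  qed
  have relabel: "relabel t = map_labels rk t" if "t \<in> trees_on F A" for t
    using that by (simp add: relabel_def rk_def trees_on_def)
  have inv1: "map_labels iv (map_labels rk t) = t" if "t \<in> trees_on F A" for t
  proof -
    have "map_labels (iv \<circ> rk) t = map_labels id t"
      using that iv by (intro labelled_tree.map_cong refl) (auto simp: trees_on_def)
    then show ?thesis by (simp add: labelled_tree.map_comp labelled_tree.map_id)
  qed
  have inv2: "map_labels rk (map_labels iv t) = t" if "t \<in> trees_on F {1..card A}" for t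
  proof -
    have "map_labels (rk \<circ> iv) t = map_labels id t"
      using that rk by (intro labelled_tree.map_cong refl) (auto simp: trees_on_def)
    then show ?thesis by (simp add: labelled_tree.map_comp labelled_tree.map_id)
  qed
  show ?thesis unfolding wsum_def
  proof (rule sum.reindex_bij_witness[where j = "map_labels rk" and i = "map_labels iv"])
    fix t assume t: "t \<in> trees_on F A"
    show "map_labels rk t \<in> trees_on F {1..card A}"
      using t mono im increasing_map_labels[of F t rk] by (auto simp: trees_on_def labelled_tree.set_map)
    show "weight F (map_labels rk t) * f (map_labels rk t) = weight F t * f (relabel t)"
      using t mono weight_map_labels[of F t rk] by (simp add: relabel trees_on_def)
  next
    fix t assume t: "t \<in> trees_on F {1..card A}"
    show "map_labels iv t \<in> trees_on F A"
      using t iv_mono iv_im increasing_map_labels[of F t iv] by (auto simp: trees_on_def labelled_tree.set_map)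
  qed (use inv1 inv2 in auto)
qed

lemma wsum_one_pos:
  assumes "very_simple F" "n \<ge> 1"
  shows "wsum F {1..n} (\<lambda>_. 1) > 0"
  unfolding wsum_def using assms trees_nonempty[OF assms] weight_pos
  by (auto intro!: sum_pos simp: finite_trees_on trees_of_size_eq)

lemma labels_fringe_psubset:
  assumes "increasing F t" "s \<in> fringe t" "s \<noteq> t"
  shows "labels s \<subset> labels t"
proof (cases t)
  case (Vertex a ks)
  then obtain c where c: "c \<in> children ks" "s \<in> fringe c" using assms by (auto simp: fringe_Vertex)
  have "a \<notin> labels c" using increasing_VertexD(4)[of F a ks c] assms(1) c Vertex by blast
  moreover have "labels s \<subseteq> labels c" using c by (intro labels_fringe_subset)
  moreover have "labels c \<subseteq> labels t" "a \<in> labels t" using Vertex c by auto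
  ultimately show ?thesis by blast
qed

lemma partition_on_psubset:
  assumes "partition_on (A - {a}) P" "a \<in> A" "S \<in> P"
  shows "S \<subset> A" "S \<noteq> {}"
  using assms by (auto simp: partition_on_def)

text \<open>
  Given the sizes of all fringe subtrees, the relabelled fringe subtrees of size \<open>k\<close> are independent
  copies of the random tree of size \<open>k\<close>; this is the generating function form of that fact.
\<close>

lemma wsum_prod_fringe_relabel:
  fixes f :: "nat labelled_tree \<Rightarrow> real" and k :: nat
  assumes "very_simple F" "finite A" "A \<noteq> {}"
  defines "\<theta> \<equiv> wsum F {1..k} f / wsum F {1..k} (\<lambda>_. 1)"
  shows "wsum F A (\<lambda>t. \<Prod>s\<in>fringe t. if card (labels s) = k then f (relabel s) else 1) =
    wsum F A (\<lambda>t. \<Prod>s\<in>fringe t. if card (labels s) = k then \<theta> else 1)"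
  using assms(2,3)
proof (induction A rule: finite_psubset_induct)
  case (psubset A)
  show ?case
  proof (cases "card A = k")
    case True
    have k: "k \<ge> 1" using psubset True by (metis One_nat_def Suc_leI card_gt_0_iff)
    \<comment> \<open>A proper fringe subtree has fewer labels, so only the tree itself has size k
      and the product shrinks to one factor.\<close>
    have *: "(\<Prod>s\<in>fringe t. if card (labels s) = k then g s else 1) = g t"
      if t: "t \<in> trees_on F A" for t and g :: "nat labelled_tree \<Rightarrow> real"
    proof -
      have "card (labels s) \<noteq> k" if "s \<in> fringe t - {t}" for s
        using labels_fringe_psubset[of F t s] t that psubset_card_mono[of A "labels s"] True psubset.hyps
        by (auto simp: trees_on_def)
      then have "(\<Prod>s\<in>fringe t - {t}. if card (labels s) = k then g s else 1) = 1"
        by (intro prod.neutral) auto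
      moreover have "card (labels t) = k" using t True by (simp add: trees_on_def)
      ultimately show ?thesis by (subst prod.remove[of _ t]) (auto intro: fringe.self)
    qed
    have "wsum F A (\<lambda>t. \<Prod>s\<in>fringe t. if card (labels s) = k then f (relabel s) else 1) =
        wsum F A (\<lambda>t. f (relabel t))"
      unfolding wsum_def using * by (intro sum.cong) auto
    also have "\<dots> = wsum F {1..k} f" using psubset.hyps True by (simp add: wsum_relabel)
    also have "\<dots> = \<theta> * wsum F {1..k} (\<lambda>_. 1)"
      using wsum_one_pos[OF assms(1) k] by (simp add: \<theta>_def)
    also have "wsum F {1..k} (\<lambda>_. 1) = wsum F A (\<lambda>t. (\<lambda>_. 1) (relabel t))"
      using psubset.hyps True by (subst wsum_relabel) auto
    also have "\<theta> * \<dots> = wsum F A (\<lambda>t. \<Prod>s\<in>fringe t. if card (labels s) = k then \<theta> else 1)"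
      unfolding wsum_def using *[where g = "\<lambda>_. \<theta>"] by (simp add: sum_distrib_left mult_ac)
    finally show ?thesis .
  next
    case False
    \<comment> \<open>The whole tree does not have size k and contributes the factor 1. Thus both
      functionals satisfy the same recursion and the induction hypothesis applies block by
      block.\<close>
    have dec: "wsum F A (\<lambda>t. \<Prod>s\<in>fringe t. if card (labels s) = k then g s else 1) =
      (\<Sum>P | partition_on (A - {Min A}) P. child_weight F (card P) * 1 *
        (\<Prod>S\<in>P. wsum F S (\<lambda>t. \<Prod>s\<in>fringe t. if card (labels s) = k then g s else 1)))"
      for g :: "nat labelled_tree \<Rightarrow> real"
    proof (rule wsum_decompose[OF assms(1) psubset.hyps psubset.prems])
      fix ks assume t: "Vertex (Min A) ks \<in> trees_on F A"
      then have inc: "increasing F (Vertex (Min A) ks)" and lab: "labels (Vertex (Min A) ks) = A"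
        by (auto simp: trees_on_def)
      show "(\<Prod>s\<in>fringe (Vertex (Min A) ks). if card (labels s) = k then g s else 1) =
        1 * (\<Prod>s\<in>children ks. \<Prod>s\<in>fringe s. if card (labels s) = k then g s else 1)"
        unfolding prod_fringe_Vertex[OF inc] lab using False by simp
    qed
    show ?thesis unfolding dec
    proof (intro sum.cong refl arg_cong2[where f = "(*)"] prod.cong)
      fix P S assume "P \<in> {P. partition_on (A - {Min A}) P}" "S \<in> P"
      then have "S \<subset> A" "S \<noteq> {}"
        using partition_on_psubset[of A "Min A" P S] psubset by auto
      then show "wsum F S (\<lambda>t. \<Prod>s\<in>fringe t. if card (labels s) = k then f (relabel s) else 1) =
        wsum F S (\<lambda>t. \<Prod>s\<in>fringe t. if card (labels s) = k then \<theta> else 1)"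
        by (rule psubset.IH)
    qed
  qed
qed

section \<open>Growth by a vertex with the largest label\<close>

fun root_label :: "'a labelled_tree \<Rightarrow> 'a" where
  "root_label (Vertex a ks) = a"

text \<open>
  If \<open>v\<close> is a vertex of \<open>t\<close>, only the factor of the fringe subtree rooted at \<open>v\<close> differs from 1.
\<close>

definition attach_weight :: "family \<Rightarrow> nat \<Rightarrow> nat labelled_tree \<Rightarrow> real" where
  "attach_weight F v t =
     (\<Prod>s\<in>fringe t. if root_label s = v then 1 + attachment F * real (outdegree s) else 1)"

text \<open>The sum of 1 + \<alpha> deg v over a tree with n vertices and n - 1 edges, called
  \<open>a_n\<close> in the comments.\<close>

definition total_attach :: "family \<Rightarrow> nat \<Rightarrow> real" where
  "total_attach F n = 1 + (1 + attachment F) * (real n - 1)"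

text \<open>The effect on a label set of a fringe subtree when the new vertex m is attached to v:
  exactly the subtrees containing v gain m.\<close>

definition grow :: "nat \<Rightarrow> nat \<Rightarrow> nat set \<Rightarrow> nat set" where
  "grow v m S = (if v \<in> S then insert m S else S)"

section \<open>Attachment weights\<close>

lemma root_label_in_labels: "root_label t \<in> labels t"
  by (cases t) auto

lemma attach_weight_notin:
  assumes "v \<notin> labels t"
  shows "attach_weight F v t = 1"
  unfolding attach_weight_def
proof (intro prod.neutral ballI)
  fix s assume "s \<in> fringe t"
  then have "root_label s \<noteq> v" using labels_fringe_subset root_label_in_labels assms by blast
  then show "(if root_label s = v then 1 + attachment F * real (outdegree s) else 1) = 1" by simp
qed

lemma attach_weight_Vertex:
  assumes "increasing F (Vertex a ks)"
  shows "attach_weight F v (Vertex a ks) =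
    (if a = v then 1 + attachment F * real (card (children ks)) else 1) *
    (\<Prod>s\<in>children ks. attach_weight F v s)"
  unfolding attach_weight_def by (subst prod_fringe_Vertex[OF assms]) simp

lemma attach_weight_child:
  assumes "increasing F (Vertex a ks)" "s \<in> children ks" "v \<in> labels s"
  shows "attach_weight F v (Vertex a ks) = attach_weight F v s"
proof -
  note D = increasing_VertexD[OF assms(1)]
  have "a \<noteq> v" using D(4) assms by blast
  moreover have "v \<notin> labels s'" if "s' \<in> children ks - {s}" for s'
    using D(2) assms that by (auto simp: disjoint_family_on_def)
  ultimately show ?thesis
    using assms by (simp add: attach_weight_Vertex prod.remove[of _ s] attach_weight_notin)
qed

lemma attach_weight_fringe:
  "s \<in> fringe t \<Longrightarrow> increasing F t \<Longrightarrow> v \<in> labels s \<Longrightarrow> attach_weight F v t = attach_weight F v s"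
proof (induction rule: fringe.induct)
  case (child a ks s)
  then have "attach_weight F v t = attach_weight F v (Vertex a ks)" by auto
  also have "increasing F (Vertex a ks)" using child by (auto intro: increasing_fringe)
  then have "attach_weight F v (Vertex a ks) = attach_weight F v s"
    using child by (intro attach_weight_child) auto
  finally show ?case .
qed simp

lemma sum_attach_weight_labels:
  "increasing F t \<Longrightarrow> (\<Sum>v\<in>labels t. attach_weight F v t) = total_attach F (card (labels t))"
proof (induction rule: increasing.induct)
  case (Vertex ks a)
  have inc: "increasing F (Vertex a ks)" using Vertex.hyps by (intro increasing.Vertex) auto
  have fin: "finite (labels s)" if "s \<in> children ks" for s using that Vertex.hyps finite_labels by blast
  have a: "a \<notin> (\<Union>s\<in>children ks. labels s)" using Vertex.hyps(4) by blast
  have dis: "\<forall>i\<in>children ks. \<forall>j\<in>children ks. i \<noteq> j \<longrightarrow> labels i \<inter> labels j = {}"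
    using Vertex.hyps(2) by (auto simp: disjoint_family_on_def)
  have card: "card (labels (Vertex a ks)) = Suc (\<Sum>s\<in>children ks. card (labels s))"
    using a fin dis by (simp add: card_UN_disjoint)
  have "(\<Sum>v\<in>labels (Vertex a ks). attach_weight F v (Vertex a ks)) =
      attach_weight F a (Vertex a ks) +
      (\<Sum>s\<in>children ks. \<Sum>v\<in>labels s. attach_weight F v (Vertex a ks))"
    using a fin dis by (simp add: sum.UNION_disjoint)
  also have "attach_weight F a (Vertex a ks) = 1 + attachment F * real (card (children ks))"
    using a by (simp add: attach_weight_Vertex[OF inc] attach_weight_notin)
  also have "(\<Sum>s\<in>children ks. \<Sum>v\<in>labels s. attach_weight F v (Vertex a ks)) =
      (\<Sum>s\<in>children ks. total_attach F (card (labels s)))"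
    using Vertex.IH by (intro sum.cong) (simp_all add: attach_weight_child[OF inc])
  also have "1 + attachment F * real (card (children ks)) + \<dots> = total_attach F (card (labels (Vertex a ks)))"
    unfolding card by (simp add: total_attach_def sum.distrib sum_subtractf algebra_simps
      flip: sum_distrib_left)
  finally show ?case .
qed

text \<open>The weight with which the next vertex enters a fringe subtree depends on its size alone.
  This closes the recursions for the expected counts of sizes.\<close>

lemma sum_attach_weight_fringe:
  assumes "increasing F t" "s \<in> fringe t"
  shows "(\<Sum>v\<in>labels s. attach_weight F v t) = total_attach F (card (labels s))"
  using sum_attach_weight_labels[OF increasing_fringe[OF assms(2,1)]] attach_weight_fringe[OF assms(2,1)]
  by simp

section \<open>Set partitions with one more element, and growth of trees\<close>

lemma sum_partition_on_insert:
  fixes Q :: "'a set set \<Rightarrow> real"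
  assumes "finite B" "m \<notin> B"
  shows "(\<Sum>P | partition_on (insert m B) P. Q P) =
    (\<Sum>P | partition_on B P. Q (insert {m} P) + (\<Sum>S\<in>P. Q (insert (insert m S) (P - {S}))))"
proof -
  define N where "N = {P. partition_on (insert m B) P}"
  define O' where "O' = {P. partition_on B P}"
  have fin: "finite N" "finite O'"
    unfolding N_def O'_def using assms by (auto simp: finitely_many_partition_on)
  have finP: "finite P" if "P \<in> O'" for P using that assms(1) by (auto simp: O'_def intro: finite_elements)
  have memO: "m \<notin> S" if "P \<in> O'" "S \<in> P" for P S
    using that assms(2) by (auto simp: O'_def partition_on_def)
  have "(\<Sum>P\<in>N. Q P) = (\<Sum>P\<in>{P\<in>N. {m} \<in> P}. Q P) + (\<Sum>P\<in>{P\<in>N. {m} \<notin> P}. Q P)"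
    using fin(1) by (subst sum.union_disjoint[symmetric]) (auto intro!: sum.cong)
  also have "(\<Sum>P\<in>{P\<in>N. {m} \<in> P}. Q P) = (\<Sum>P\<in>O'. Q (insert {m} P))"
  proof (rule sum.reindex_bij_witness[where j = "\<lambda>P. P - {{m}}" and i = "insert {m}"])
    fix P assume P: "P \<in> {P\<in>N. {m} \<in> P}"
    then have part: "partition_on (insert m B) (insert {m} (P - {{m}}))"
      by (auto simp: N_def insert_absorb)
    have "disjnt {m} (\<Union>(P - {{m}}))"
    proof -
      have "{m} \<inter> S = {}" if "S \<in> P" "S \<noteq> {m}" for S
        using P that by (intro disjointD[of P]) (auto simp: N_def partition_on_def)
      then show ?thesis by (auto simp: disjnt_def)
    qed
    from partition_on_insert[OF this, of "insert m B"] part assms(2)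
    show "P - {{m}} \<in> O'" by (simp add: O'_def)
  next
    fix P assume P: "P \<in> O'"
    then have "disjnt {m} (\<Union>P)" using memO by auto
    from partition_on_insert[OF this, of "insert m B"] P assms(2)
    show "insert {m} P \<in> {P\<in>N. {m} \<in> P}" by (simp add: N_def O'_def)
    show "insert {m} P - {{m}} = P" using memO[OF P] by auto
  qed (auto simp: insert_absorb)
  \<comment> \<open>The block M of m differs from {m}, so M - {m} is a nonempty block of a partition
    of B. Recording this block makes the removal of m reversible.\<close>
  also have "(\<Sum>P\<in>{P\<in>N. {m} \<notin> P}. Q P) =
      (\<Sum>(P,S)\<in>Sigma O' (\<lambda>P. P). Q (insert (insert m S) (P - {S})))"
  proof (rule sum.reindex_bij_witness[where
        j = "\<lambda>P. let M = (THE M. M \<in> P \<and> m \<in> M) in (insert (M - {m}) (P - {M}), M - {m})" and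
        i = "\<lambda>(P,S). insert (insert m S) (P - {S})"])
    fix P assume P: "P \<in> {P\<in>N. {m} \<notin> P}"
    then have part: "partition_on (insert m B) P" and nm: "{m} \<notin> P" by (auto simp: N_def)
    then obtain M where M: "M \<in> P" "m \<in> M" by (auto simp: partition_on_def)
    have uniq: "M' = M" if "M' \<in> P" "m \<in> M'" for M'
      using part M that by (auto simp: partition_on_def disjoint_def)
    have the: "(THE M. M \<in> P \<and> m \<in> M) = M" by (rule the_equality) (use M uniq in blast)+
    have ne: "M - {m} \<noteq> {}" using M nm by (metis Diff_eq_empty_iff empty_iff insert_absorb insert_iff subset_singletonD)
    have disj: "M \<inter> S = {}" if "S \<in> P" "S \<noteq> M" for S
      using part M(1) that by (auto simp: partition_on_def disjoint_def)
    have nin: "M - {m} \<notin> P - {M}" using disj ne by blast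
    show "(case let M = (THE M. M \<in> P \<and> m \<in> M) in (insert (M - {m}) (P - {M}), M - {m}) of
        (P, S) \<Rightarrow> insert (insert m S) (P - {S})) = P"
      unfolding the using M nin by (auto simp: insert_absorb)
    have d1: "disjnt M (\<Union>(P - {M}))" using disj by (auto simp: disjnt_def)
    then have "partition_on (insert m B - M) (P - {M})" "M \<subseteq> insert m B"
      using partition_on_insert[OF d1, of "insert m B"] part M(1) by (auto simp: insert_absorb)
    moreover have "insert m B - M = B - (M - {m})" using M assms(2) by auto
    moreover have d2: "disjnt (M - {m}) (\<Union>(P - {M}))" using d1 by (auto simp: disjnt_def)
    ultimately have "partition_on B (insert (M - {m}) (P - {M}))"
      using partition_on_insert[OF d2, of B] ne by auto
    then show "(let M = (THE M. M \<in> P \<and> m \<in> M) in (insert (M - {m}) (P - {M}), M - {m})) \<in> Sigma O' (\<lambda>P. P)"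
      unfolding the by (simp add: O'_def)
    show "(case let M = (THE M. M \<in> P \<and> m \<in> M) in (insert (M - {m}) (P - {M}), M - {m}) of
        (P, S) \<Rightarrow> Q (insert (insert m S) (P - {S}))) = Q P"
      unfolding the using M nin by (auto simp: insert_absorb)
  next
    fix PS assume "PS \<in> Sigma O' (\<lambda>P. P)"
    then obtain P S where PS: "PS = (P,S)" "P \<in> O'" "S \<in> P" by auto
    then have part: "partition_on B P" by (simp add: O'_def)
    have mS: "m \<notin> S'" if "S' \<in> P" for S' using memO PS that by auto
    have ne: "S \<noteq> {}" using part PS by (auto simp: partition_on_def)
    have disj: "S \<inter> S' = {}" if "S' \<in> P" "S' \<noteq> S" for S'
      using part PS(3) that by (auto simp: partition_on_def disjoint_def)
    have the: "(THE M. M \<in> insert (insert m S) (P - {S}) \<and> m \<in> M) = insert m S"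
      using mS by (intro the_equality) auto
    have "insert m S \<notin> P" using mS by auto
    then show "(let M = (THE M. M \<in> (case PS of (P,S) \<Rightarrow> insert (insert m S) (P - {S})) \<and> m \<in> M)
        in (insert (M - {m}) ((case PS of (P,S) \<Rightarrow> insert (insert m S) (P - {S})) - {M}), M - {m})) = PS"
      unfolding PS(1) prod.case the Let_def using mS[OF PS(3)] PS(3) by (auto simp: insert_absorb)
    have d1: "disjnt S (\<Union>(P - {S}))" using disj by (auto simp: disjnt_def)
    then have "partition_on (B - S) (P - {S})" "S \<subseteq> B"
      using partition_on_insert[OF d1, of B] part PS(3) by (auto simp: insert_absorb)
    moreover have "insert m B - insert m S = B - S" using assms(2) by auto
    moreover have d2: "disjnt (insert m S) (\<Union>(P - {S}))" using d1 mS by (auto simp: disjnt_def)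
    ultimately have "partition_on (insert m B) (insert (insert m S) (P - {S}))"
      using partition_on_insert[OF d2, of "insert m B"] by auto
    moreover have "{m} \<notin> insert (insert m S) (P - {S})" using mS ne PS(3) by auto
    ultimately show "(case PS of (P,S) \<Rightarrow> insert (insert m S) (P - {S})) \<in> {P\<in>N. {m} \<notin> P}"
      using PS(1) by (simp add: N_def)
  qed
  also have "\<dots> = (\<Sum>P\<in>O'. \<Sum>S\<in>P. Q (insert (insert m S) (P - {S})))"
    using fin finP by (intro sum.Sigma[symmetric]) auto
  finally show ?thesis by (simp add: N_def O'_def sum.distrib)
qed

lemma child_weight_Suc:
  "child_weight F (Suc m) = child_weight F m * (rate F * (1 + attachment F * real m))"
  by (simp add: child_weight_def)

lemma partition_on_member:
  assumes "partition_on B P" "finite B" "S \<in> P"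
  shows "finite S" "S \<subseteq> B" "S \<noteq> {}" "finite P"
  using assms finite_elements[OF assms(2,1)] by (auto simp: partition_on_def intro: finite_subset)

text \<open>Since m exceeds all labels, the root stays the same when m is added. If m forms a block
  of its own, it is a new child of the root, and the extra factor of \<open>child_weight\<close> is
  the attachment weight of the root. Otherwise m lies in the block of one child subtree, and
  induction on that block supplies the vertices v in it.\<close>

lemma wsum_grow_prod:
  fixes u :: "nat set \<Rightarrow> real"
  assumes vs: "very_simple F" and "finite A" "A \<noteq> {}" "\<And>x. x \<in> A \<Longrightarrow> x < m"
  shows "wsum F (insert m A) (\<lambda>t. \<Prod>s\<in>fringe t. u (labels s)) =
    rate F * u {m} * (\<Sum>v\<in>A. wsum F A (\<lambda>t. attach_weight F v t * (\<Prod>s\<in>fringe t. u (grow v m (labels s)))))"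
proof -
  define G where "G S = wsum F S (\<lambda>t. \<Prod>s\<in>fringe t. u (labels s))" for S
  define H where "H v S = wsum F S (\<lambda>t. attach_weight F v t * (\<Prod>s\<in>fringe t. u (grow v m (labels s))))" for v S
  have decG: "G S = (\<Sum>P | partition_on (S - {Min S}) P. child_weight F (card P) * u S * (\<Prod>S\<in>P. G S))"
    if "finite S" "S \<noteq> {}" for S
    unfolding G_def
  proof (rule wsum_decompose[OF vs that])
    fix ks assume "Vertex (Min S) ks \<in> trees_on F S"
    then have inc: "increasing F (Vertex (Min S) ks)" and lab: "labels (Vertex (Min S) ks) = S"
      by (auto simp: trees_on_def)
    show "(\<Prod>s\<in>fringe (Vertex (Min S) ks). u (labels s)) = u S * (\<Prod>s\<in>children ks. \<Prod>s\<in>fringe s. u (labels s))"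
      unfolding prod_fringe_Vertex[OF inc] lab ..
  qed
  have decH: "H v S = (\<Sum>P | partition_on (S - {Min S}) P. child_weight F (card P) *
      ((if v = Min S then 1 + attachment F * real (card P) else 1) * u (insert m S)) * (\<Prod>S\<in>P. H v S))"
    if "finite S" "v \<in> S" for S v
    unfolding H_def
  proof (rule wsum_decompose[OF vs that(1)])
    show "S \<noteq> {}" using that by auto
    fix ks assume "Vertex (Min S) ks \<in> trees_on F S"
    then have inc: "increasing F (Vertex (Min S) ks)" and lab: "labels (Vertex (Min S) ks) = S"
      by (auto simp: trees_on_def)
    have "grow v m S = insert m S" using that by (simp add: grow_def)
    then show "attach_weight F v (Vertex (Min S) ks) * (\<Prod>s\<in>fringe (Vertex (Min S) ks). u (grow v m (labels s))) =
      ((if v = Min S then 1 + attachment F * real (card (children ks)) else 1) * u (insert m S)) *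
      (\<Prod>s\<in>children ks. attach_weight F v s * (\<Prod>s\<in>fringe s. u (grow v m (labels s))))"
      unfolding prod_fringe_Vertex[OF inc] attach_weight_Vertex[OF inc] lab prod.distrib by auto
  qed
  \<comment> \<open>A block without v is untouched by the attachment at v.\<close>
  have HG: "H v S = G S" if "v \<notin> S" for v S
    unfolding H_def G_def wsum_def
  proof (rule sum.cong[OF refl])
    fix t assume "t \<in> trees_on F S"
    then have lab: "labels t = S" by (simp add: trees_on_def)
    have "grow v m (labels s) = labels s" if "s \<in> fringe t" for s
      using labels_fringe_subset[OF that] \<open>v \<notin> S\<close> lab by (auto simp: grow_def)
    then show "weight F t * (attach_weight F v t * (\<Prod>s\<in>fringe t. u (grow v m (labels s)))) =
      weight F t * (\<Prod>s\<in>fringe t. u (labels s))"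
      using \<open>v \<notin> S\<close> lab by (simp add: attach_weight_notin)
  qed
  have Gm: "G {m} = u {m}"
    using decG[of "{m}"] by (simp add: partition_on_empty child_weight_def)
  have main: "G (insert m A) = rate F * u {m} * (\<Sum>v\<in>A. H v A)"
    if "finite A" "A \<noteq> {}" "\<And>x. x \<in> A \<Longrightarrow> x < m" for A
    using that
  proof (induction A rule: finite_psubset_induct)
    case (psubset A)
    define a B where "a = Min A" and "B = A - {a}"
    have a: "a \<in> A" using psubset by (simp add: a_def)
    then have A: "A = insert a B" "a \<notin> B" by (auto simp: B_def)
    have mA: "m \<notin> A" using psubset.prems by blast
    have mB: "m \<notin> B" using mA by (auto simp: B_def)
    have finB: "finite B" using psubset.hyps by (simp add: B_def)
    have "m > a" using psubset.prems a by blast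
    then have "Min (insert m A) = a"
      using psubset.hyps psubset.prems(1) by (simp add: a_def)
    moreover have "insert m A - {a} = insert m B" using mA a by (auto simp: B_def)
    ultimately have "G (insert m A) =
        (\<Sum>P | partition_on (insert m B) P. child_weight F (card P) * u (insert m A) * (\<Prod>S\<in>P. G S))"
      using decG[of "insert m A"] psubset.hyps by simp
    also have "\<dots> = (\<Sum>P | partition_on B P.
        child_weight F (card (insert {m} P)) * u (insert m A) * (\<Prod>S\<in>insert {m} P. G S) +
        (\<Sum>S\<in>P. child_weight F (card (insert (insert m S) (P - {S}))) * u (insert m A) *
          (\<Prod>S\<in>insert (insert m S) (P - {S}). G S)))"
      by (rule sum_partition_on_insert[OF finB mB])
    also have "\<dots> = (\<Sum>P | partition_on B P.
        rate F * u {m} * (child_weight F (card P) * ((1 + attachment F * real (card P)) * u (insert m A)) * (\<Prod>S\<in>P. H a S)) +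
        rate F * u {m} * (\<Sum>v\<in>B. child_weight F (card P) * u (insert m A) * (\<Prod>S\<in>P. H v S)))"
    proof (rule sum.cong[OF refl], goal_cases)
      case (1 P)
      then have P: "partition_on B P" by simp
      note mem = partition_on_member[OF P finB]
      have finP: "finite P" using finB P by (rule finite_elements)
      have mS: "m \<notin> S" "a \<notin> S" if "S \<in> P" for S using that mem(2) mB A(2) by auto
      have "{m} \<notin> P" using mS by blast
      moreover have "(\<Prod>S\<in>P. H a S) = (\<Prod>S\<in>P. G S)" using mS HG by (intro prod.cong) auto
      \<comment> \<open>The case v = a: the new factor of \<open>child_weight\<close> for card P + 1
        children is rate times 1 + \<alpha> card P.\<close>
      ultimately have 1: "child_weight F (card (insert {m} P)) * u (insert m A) * (\<Prod>S\<in>insert {m} P. G S) =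
        rate F * u {m} * (child_weight F (card P) * ((1 + attachment F * real (card P)) * u (insert m A)) * (\<Prod>S\<in>P. H a S))"
        using finP by (simp add: Gm child_weight_Suc)
      \<comment> \<open>The case of m in the block of S. For v in S all other blocks avoid v, so
        their factors are \<open>G\<close> and can be taken out of the sum over v.\<close>
      have *: "rate F * u {m} * (\<Sum>v\<in>S. \<Prod>S\<in>P. H v S) = (\<Prod>S\<in>insert (insert m S) (P - {S}). G S)"
        if S: "S \<in> P" for S
      proof -
        have nin: "insert m S \<notin> P - {S}" using mS(1)[of "insert m S"] by auto
        have SA: "S \<subset> A" using mem(2)[OF S] A by auto
        then have less: "\<And>x. x \<in> S \<Longrightarrow> x < m" using psubset.prems by blast
        have "(\<Prod>S'\<in>P. H v S') = H v S * (\<Prod>S'\<in>P - {S}. G S')" if "v \<in> S" for v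
        proof -
          have "v \<notin> S'" if "S' \<in> P - {S}" for S'
            using P S that \<open>v \<in> S\<close> by (auto simp: partition_on_def disjoint_def)
          then show ?thesis using finP S HG by (simp add: prod.remove[of _ S])
        qed
        then have "(\<Sum>v\<in>S. \<Prod>S\<in>P. H v S) = (\<Sum>v\<in>S. H v S) * (\<Prod>S'\<in>P - {S}. G S')"
          unfolding sum_distrib_right by (intro sum.cong refl)
        then have "rate F * u {m} * (\<Sum>v\<in>S. \<Prod>S\<in>P. H v S) =
            (rate F * u {m} * (\<Sum>v\<in>S. H v S)) * (\<Prod>S'\<in>P - {S}. G S')"
          by (simp only: mult.assoc)
        also have "rate F * u {m} * (\<Sum>v\<in>S. H v S) = G (insert m S)"
          using psubset.IH[OF SA mem(3)[OF S] less] by simp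
        finally show ?thesis using nin finP by simp
      qed
      have card: "card (insert (insert m S) (P - {S})) = card P" if "S \<in> P" for S
      proof -
        have "insert m S \<notin> P - {S}" using mS(1)[of "insert m S"] by auto
        then have "card (insert (insert m S) (P - {S})) = Suc (card (P - {S}))"
          using finP by (intro card_insert_disjoint) auto
        then show ?thesis using card_Suc_Diff1[OF finP that] by simp
      qed
      have B: "B = \<Union>P" using P by (simp add: partition_on_def)
      have "rate F * u {m} * (\<Sum>v\<in>B. child_weight F (card P) * u (insert m A) * (\<Prod>S\<in>P. H v S)) =
          child_weight F (card P) * u (insert m A) * (rate F * u {m} * (\<Sum>v\<in>\<Union>P. \<Prod>S\<in>P. H v S))"
        unfolding B by (simp add: sum_distrib_left mult_ac)
      also have "(\<Sum>v\<in>\<Union>P. \<Prod>S\<in>P. H v S) = (\<Sum>S\<in>P. \<Sum>v\<in>S. \<Prod>S\<in>P. H v S)"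
      proof -
        have "\<forall>S\<in>P. finite S" using mem(1) by blast
        moreover have "\<forall>S\<in>P. \<forall>S'\<in>P. S \<noteq> S' \<longrightarrow> S \<inter> S' = {}"
          using P by (auto simp: partition_on_def disjoint_def)
        ultimately show ?thesis by (subst sum.Union_disjoint) (auto simp: o_def)
      qed
      also have "child_weight F (card P) * u (insert m A) * (rate F * u {m} * \<dots>) =
          (\<Sum>S\<in>P. child_weight F (card P) * u (insert m A) * (rate F * u {m} * (\<Sum>v\<in>S. \<Prod>S\<in>P. H v S)))"
        by (simp add: sum_distrib_left mult_ac)
      also have "\<dots> = (\<Sum>S\<in>P. child_weight F (card (insert (insert m S) (P - {S}))) * u (insert m A) *
          (\<Prod>S\<in>insert (insert m S) (P - {S}). G S))"
        by (intro sum.cong refl) (simp only: * card)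
      finally show ?case using 1 by simp
    qed
    also have "\<dots> = rate F * u {m} * (\<Sum>P | partition_on B P.
          child_weight F (card P) * ((1 + attachment F * real (card P)) * u (insert m A)) * (\<Prod>S\<in>P. H a S)) +
        rate F * u {m} * (\<Sum>v\<in>B. \<Sum>P | partition_on B P. child_weight F (card P) * u (insert m A) * (\<Prod>S\<in>P. H v S))"
      by (simp add: sum.distrib sum_distrib_left) (rule sum.swap)
    also have "\<dots> = rate F * u {m} * (H a A + (\<Sum>v\<in>B. H v A))"
    proof -
      have "H a A = (\<Sum>P | partition_on B P.
          child_weight F (card P) * ((1 + attachment F * real (card P)) * u (insert m A)) * (\<Prod>S\<in>P. H a S))"
        using decH[OF psubset.hyps a] by (simp add: a_def[symmetric] B_def)
      moreover have "H v A = (\<Sum>P | partition_on B P. child_weight F (card P) * u (insert m A) * (\<Prod>S\<in>P. H v S))"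
        if "v \<in> B" for v
      proof -
        have "v \<in> A" "v \<noteq> a" using that A by auto
        then show ?thesis using decH[OF psubset.hyps, of v] by (simp add: a_def[symmetric] B_def)
      qed
      ultimately show ?thesis by (simp add: distrib_left)
    qed
    also have "H a A + (\<Sum>v\<in>B. H v A) = (\<Sum>v\<in>A. H v A)"
      using A finB by (subst (4) A(1)) simp
    finally show ?case .
  qed
  show ?thesis using main[OF assms(2-4)] by (simp add: G_def H_def)
qed

section \<open>From product functionals to the law of the label sets\<close>

lemma sum_subset_eq_sum_fibres:
  fixes p :: "'x \<Rightarrow> real" and l :: "'x \<Rightarrow> 'c set"
  assumes "finite X" "finite U"
  shows "(\<Sum>x | x \<in> X \<and> l x \<subseteq> U. p x) =
    (\<Sum>x | x \<in> X \<and> l x = U. p x) + (\<Sum>V\<in>Pow U - {U}. \<Sum>x | x \<in> X \<and> l x = V. p x)"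
proof -
  have "(\<Sum>x | x \<in> X \<and> l x \<subseteq> U. p x) =
      (\<Sum>V\<in>Pow U. \<Sum>x | x \<in> {x. x \<in> X \<and> l x \<subseteq> U} \<and> l x = V. p x)"
    using assms by (intro sum.group[symmetric]) auto
  also have "\<dots> = (\<Sum>V\<in>Pow U. \<Sum>x | x \<in> X \<and> l x = V. p x)"
    by (intro sum.cong) auto
  also have "\<dots> = (\<Sum>x | x \<in> X \<and> l x = U. p x) + (\<Sum>V\<in>Pow U - {U}. \<Sum>x | x \<in> X \<and> l x = V. p x)"
    using assms by (subst sum.remove[of _ U]) auto
  finally show ?thesis .
qed

text \<open>The sums over families contained in U determine the weight of each single family, by
  induction on U as in Moebius inversion on the subset lattice. They therefore determine the sum of
  every function of the family.\<close>

lemma sum_eq_sum_if_subset_sums_eq: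
  fixes p :: "'x \<Rightarrow> real" and q :: "'y \<Rightarrow> real" and l :: "'x \<Rightarrow> 'c set" and r :: "'y \<Rightarrow> 'c set"
  assumes fin: "finite X" "finite Y" "\<And>x. x \<in> X \<Longrightarrow> finite (l x)" "\<And>y. y \<in> Y \<Longrightarrow> finite (r y)"
    and eq: "\<And>U. finite U \<Longrightarrow> (\<Sum>x | x \<in> X \<and> l x \<subseteq> U. p x) = (\<Sum>y | y \<in> Y \<and> r y \<subseteq> U. q y)"
  shows "(\<Sum>x\<in>X. p x * g (l x)) = (\<Sum>y\<in>Y. q y * g (r y))"
proof -
  have fibre: "(\<Sum>x | x \<in> X \<and> l x = U. p x) = (\<Sum>y | y \<in> Y \<and> r y = U. q y)" if "finite U" for U
    using that
  proof (induction U rule: finite_psubset_induct)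
    case (psubset U)
    have "(\<Sum>V\<in>Pow U - {U}. \<Sum>x | x \<in> X \<and> l x = V. p x) = (\<Sum>V\<in>Pow U - {U}. \<Sum>y | y \<in> Y \<and> r y = V. q y)"
      by (intro sum.cong refl psubset.IH) auto
    then show ?case
      using eq[OF psubset.hyps] sum_subset_eq_sum_fibres[OF fin(1) psubset.hyps, where l = l and p = p]
        sum_subset_eq_sum_fibres[OF fin(2) psubset.hyps, where l = r and p = q] by linarith
  qed
  define Z where "Z = l ` X \<union> r ` Y"
  have "(\<Sum>x\<in>X. p x * g (l x)) = (\<Sum>V\<in>Z. \<Sum>x | x \<in> X \<and> l x = V. p x * g (l x))"
    using fin by (intro sum.group[symmetric]) (auto simp: Z_def)
  also have "\<dots> = (\<Sum>V\<in>Z. (\<Sum>x | x \<in> X \<and> l x = V. p x) * g V)"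
    by (auto simp: sum_distrib_right intro!: sum.cong)
  also have "\<dots> = (\<Sum>V\<in>Z. (\<Sum>y | y \<in> Y \<and> r y = V. q y) * g V)"
    using fin by (intro sum.cong refl arg_cong2[where f = "(*)"] fibre) (auto simp: Z_def)
  also have "\<dots> = (\<Sum>V\<in>Z. \<Sum>y | y \<in> Y \<and> r y = V. q y * g (r y))"
    by (auto simp: sum_distrib_right intro!: sum.cong)
  also have "\<dots> = (\<Sum>y\<in>Y. q y * g (r y))"
    using fin by (intro sum.group) (auto simp: Z_def)
  finally show ?thesis .
qed

definition fringe_labels :: "nat labelled_tree \<Rightarrow> nat set set" where
  "fringe_labels t = labels ` fringe t"

text \<open>Upgrades \<open>wsum_grow_prod\<close> from products to arbitrary functions of the
  family of label sets, in particular to counts of pairs, which are not products over the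
  fringe.\<close>

lemma wsum_grow:
  fixes g :: "nat set set \<Rightarrow> real"
  assumes vs: "very_simple F" and A: "finite A" "A \<noteq> {}" "\<And>x. x \<in> A \<Longrightarrow> x < m"
  shows "wsum F (insert m A) (\<lambda>t. g (fringe_labels t)) =
    rate F * (\<Sum>v\<in>A. wsum F A (\<lambda>t. attach_weight F v t * g (insert {m} (grow v m ` fringe_labels t))))"
proof -
  let ?X = "trees_on F (insert m A)" and ?Y = "A \<times> trees_on F A"
  have fin: "finite ?X" "finite ?Y" using A(1) by (auto intro: finite_trees_on)
  have "(\<Sum>t\<in>?X. weight F t * g (fringe_labels t)) =
    (\<Sum>y\<in>?Y. (rate F * (weight F (snd y) * attach_weight F (fst y) (snd y))) *
      g (insert {m} (grow (fst y) m ` fringe_labels (snd y))))"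
  proof (rule sum_eq_sum_if_subset_sums_eq[OF fin])
    fix U :: "nat set set" assume "finite U"
    \<comment> \<open>With this indicator the product over the fringe tests whether all label sets
      lie in U. The new vertex contributes the separate condition that {m} lies in U.\<close>
    define u where "u S = (if S \<in> U then 1 else 0 :: real)" for S
    have prod_u: "(\<Prod>s\<in>fringe t. u (f (labels s))) = (if f ` fringe_labels t \<subseteq> U then 1 else 0)" for t f
      by (auto simp: u_def fringe_labels_def image_subset_iff)
    have "(\<Sum>t | t \<in> ?X \<and> fringe_labels t \<subseteq> U. weight F t) =
        wsum F (insert m A) (\<lambda>t. \<Prod>s\<in>fringe t. u (labels s))"
      unfolding wsum_def prod_u[where f = "\<lambda>x. x"] using fin(1)
      by (simp add: if_distrib[of "\<lambda>x. _ * x"] sum.inter_filter[symmetric] cong: if_cong)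
    also have "\<dots> = rate F * u {m} * (\<Sum>v\<in>A. wsum F A (\<lambda>t. attach_weight F v t * (\<Prod>s\<in>fringe t. u (grow v m (labels s)))))"
      by (rule wsum_grow_prod[OF vs A])
    also have "\<dots> = (\<Sum>y\<in>?Y. if insert {m} (grow (fst y) m ` fringe_labels (snd y)) \<subseteq> U
       then rate F * (weight F (snd y) * attach_weight F (fst y) (snd y)) else 0)"
      unfolding wsum_def prod_u sum_distrib_left sum.cartesian_product
      by (intro sum.cong) (auto simp: u_def image_subset_iff split: if_splits)
    also have "\<dots> = (\<Sum>y | y \<in> ?Y \<and> insert {m} (grow (fst y) m ` fringe_labels (snd y)) \<subseteq> U.
       rate F * (weight F (snd y) * attach_weight F (fst y) (snd y)))"
      using fin(2) by (simp only: sum.inter_filter[symmetric])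
    finally show "(\<Sum>t | t \<in> ?X \<and> fringe_labels t \<subseteq> U. weight F t) =
      (\<Sum>y | y \<in> ?Y \<and> insert {m} (grow (fst y) m ` fringe_labels (snd y)) \<subseteq> U.
       rate F * (weight F (snd y) * attach_weight F (fst y) (snd y)))" .
  qed (auto simp: fringe_labels_def)
  also have "\<dots> = rate F * (\<Sum>v\<in>A. wsum F A (\<lambda>t. attach_weight F v t * g (insert {m} (grow v m ` fringe_labels t))))"
    unfolding wsum_def sum_distrib_left sum.cartesian_product
    by (intro sum.cong) auto
  finally show ?thesis by (simp add: wsum_def)
qed

section \<open>Moments of the number of fringe subtrees of given sizes\<close>

text \<open>The expectation under \<open>random_tree F n\<close> for n \<ge> 1, written as a ratio
  of finite sums so that linearity holds without integrability conditions.\<close>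

definition avg :: "family \<Rightarrow> nat \<Rightarrow> (nat labelled_tree \<Rightarrow> real) \<Rightarrow> real" where
  "avg F n h = wsum F {1..n} h / wsum F {1..n} (\<lambda>_. 1)"

lemma expectation_random_tree:
  assumes "very_simple F" "n \<ge> 1"
  shows "measure_pmf.expectation (random_tree F n) h = avg F n h"
proof -
  have fin: "finite (trees_of_size F n)" by (rule finite_trees)
  have "measure_pmf.expectation (random_tree F n) h =
      (\<Sum>t\<in>trees_of_size F n. h t * pmf (random_tree F n) t)"
    by (rule integral_measure_pmf_real[OF fin])
      (use pmf_random_tree[OF assms] in \<open>auto simp: set_pmf_iff split: if_splits\<close>)
  then show ?thesis
    by (simp add: pmf_random_tree[OF assms] avg_def wsum_def trees_of_size_eq sum_divide_distrib mult_ac)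
qed

lemma avg_cong: "(\<And>t. t \<in> trees_on F {1..n} \<Longrightarrow> h t = h' t) \<Longrightarrow> avg F n h = avg F n h'"
  unfolding avg_def wsum_def by (intro arg_cong2[where f = "(/)"] sum.cong) auto

lemma avg_sum: "avg F n (\<lambda>t. \<Sum>i\<in>X. h i t) = (\<Sum>i\<in>X. avg F n (h i))"
  unfolding avg_def wsum_def sum_distrib_left by (subst sum.swap) (simp add: sum_divide_distrib)

lemma avg_add: "avg F n (\<lambda>t. h t + h' t) = avg F n h + avg F n h'"
  by (simp add: avg_def wsum_def distrib_left sum.distrib add_divide_distrib)

lemma avg_diff: "avg F n (\<lambda>t. h t - h' t) = avg F n h - avg F n h'"
  by (simp add: avg_def wsum_def right_diff_distrib sum_subtractf diff_divide_distrib)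

lemma avg_cmult: "avg F n (\<lambda>t. c * h t) = c * avg F n h"
proof -
  have "wsum F {1..n} (\<lambda>t. c * h t) = c * wsum F {1..n} h"
    unfolding wsum_def sum_distrib_left by (intro sum.cong) auto
  then show ?thesis by (simp add: avg_def)
qed

lemma avg_const: "very_simple F \<Longrightarrow> n \<ge> 1 \<Longrightarrow> avg F n (\<lambda>_. c) = c"
  using avg_cmult[of F n c "\<lambda>_. 1"] wsum_one_pos[of F n] by (simp add: avg_def)

lemma avg_mono:
  assumes "very_simple F" "n \<ge> 1" "\<And>t. t \<in> trees_on F {1..n} \<Longrightarrow> h t \<le> h' t"
  shows "avg F n h \<le> avg F n h'"
  unfolding avg_def wsum_def[of F _ h] wsum_def[of F _ h']
  using assms wsum_one_pos[OF assms(1,2)] weight_pos[OF assms(1)]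
  by (intro divide_right_mono sum_mono mult_left_mono) (auto intro: less_imp_le)

text \<open>The second bound expresses d \<ge> 2, with equality for binary trees. It keeps a
  coefficient of the pair recursion nonnegative.\<close>

lemma attachment_bounds:
  assumes "very_simple F"
  shows "1 + attachment F > 0" "1 + 2 * attachment F \<ge> 0"
  using assms by (auto simp: very_simple_def field_simps)

lemma total_attach_Suc: "total_attach F (Suc n) = total_attach F n + (1 + attachment F)"
  by (simp add: total_attach_def algebra_simps)

lemma total_attach_1 [simp]: "total_attach F (Suc 0) = 1"
  by (simp add: total_attach_def)

lemma total_attach_ge_1: "very_simple F \<Longrightarrow> n \<ge> 1 \<Longrightarrow> total_attach F n \<ge> 1"
  using attachment_bounds(1)[of F] by (simp add: total_attach_def)

lemma fringe_labels_in:
  assumes "t \<in> trees_on F A" "S \<in> fringe_labels t"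
  shows "S \<subseteq> A" "S \<noteq> {}" "(\<Sum>v\<in>S. attach_weight F v t) = total_attach F (card S)"
  using assms labels_fringe_subset sum_attach_weight_fringe by (auto simp: trees_on_def fringe_labels_def)

lemma finite_fringe_labels [simp]: "finite (fringe_labels t)"
  by (simp add: fringe_labels_def)

lemma self_in_fringe_labels: "labels t \<in> fringe_labels t"
  by (auto simp: fringe_labels_def intro: fringe.self)

text \<open>The case g = 1 gives the ratio of the normalising sums for n + 1 and n as
  \<open>rate F\<close> times \<open>a_n\<close>. So \<open>rate F\<close> cancels, and the new
  vertex is attached to v with probability \<open>attach_weight F v t / a_n\<close>.\<close>

lemma avg_Suc:
  assumes vs: "very_simple F" and n: "n \<ge> 1"
  shows "avg F (Suc n) (\<lambda>t. g (fringe_labels t)) = avg F n (\<lambda>t. \<Sum>v\<in>{1..n}. attach_weight F v t *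
      g (insert {Suc n} (grow v (Suc n) ` fringe_labels t))) / total_attach F n"
proof -
  have ins: "{1..Suc n} = insert (Suc n) {1..n}" by auto
  have gr: "wsum F {1..Suc n} (\<lambda>t. g (fringe_labels t)) = rate F * wsum F {1..n} (\<lambda>t. \<Sum>v\<in>{1..n}.
      attach_weight F v t * g (insert {Suc n} (grow v (Suc n) ` fringe_labels t)))" for g :: "nat set set \<Rightarrow> real"
  proof -
    have "wsum F {1..Suc n} (\<lambda>t. g (fringe_labels t)) = rate F * (\<Sum>v\<in>{1..n}. wsum F {1..n} (\<lambda>t.
      attach_weight F v t * g (insert {Suc n} (grow v (Suc n) ` fringe_labels t))))"
      unfolding ins using vs n by (intro wsum_grow) auto
    then show ?thesis
      unfolding wsum_def sum_distrib_left by (subst sum.swap) simp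
  qed
  have "wsum F {1..Suc n} (\<lambda>_. 1) = rate F * wsum F {1..n} (\<lambda>t. \<Sum>v\<in>{1..n}. attach_weight F v t)"
    using gr[of "\<lambda>_. 1"] by simp
  also have "wsum F {1..n} (\<lambda>t. \<Sum>v\<in>{1..n}. attach_weight F v t) = wsum F {1..n} (\<lambda>t. 1) * total_attach F n"
    unfolding wsum_def sum_distrib_right
  proof (rule sum.cong[OF refl])
    fix t assume t: "t \<in> trees_on F {1..n}"
    then have "{1..n} \<in> fringe_labels t" using self_in_fringe_labels[of t] by (simp add: trees_on_def)
    from fringe_labels_in(3)[OF t this]
    show "weight F t * (\<Sum>v\<in>{1..n}. attach_weight F v t) = weight F t * 1 * total_attach F n" by simp
  qed
  finally have W: "wsum F {1..Suc n} (\<lambda>_. 1) = rate F * (wsum F {1..n} (\<lambda>t. 1) * total_attach F n)" .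
  have "rate F \<noteq> 0" using wsum_one_pos[OF vs, of "Suc n"] W by auto
  then show ?thesis unfolding avg_def W gr by simp
qed

lemma grow_simps:
  assumes "m \<notin> S" "finite S"
  shows "v \<in> S \<Longrightarrow> card (grow v m S) = Suc (card S)" "v \<notin> S \<Longrightarrow> grow v m S = S"
  using assms by (auto simp: grow_def)

lemma sum_grow:
  fixes w :: "nat \<Rightarrow> real"
  assumes "finite A" "m \<notin> A" "S \<subseteq> A" "(\<Sum>v\<in>S. w v) = a" "(\<Sum>v\<in>A. w v) = b"
  shows "(\<Sum>v\<in>A. w v * q (card (grow v m S))) = (b - a) * q (card S) + a * q (Suc (card S))"
proof -
  have S: "finite S" "m \<notin> S" using assms finite_subset by auto
  have "(\<Sum>v\<in>A. w v * q (card (grow v m S))) =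
      (\<Sum>v\<in>A - S. w v * q (card (grow v m S))) + (\<Sum>v\<in>S. w v * q (card (grow v m S)))"
    using assms by (intro sum.subset_diff) auto
  also have "(\<Sum>v\<in>A - S. w v * q (card (grow v m S))) = (\<Sum>v\<in>A - S. w v) * q (card S)"
    using S by (simp add: grow_simps sum_distrib_right)
  also have "(\<Sum>v\<in>A - S. w v) = b - a" using assms by (simp add: sum_diff)
  also have "(\<Sum>v\<in>S. w v * q (card (grow v m S))) = a * q (Suc (card S))"
    using S assms(4) by (simp add: grow_simps flip: sum_distrib_right)
  finally show ?thesis .
qed

text \<open>By disjointness v lies outside both sets or in exactly one of them, so at most one of
  the two cardinalities changes.\<close>

lemma sum_grow_disjoint:
  fixes w :: "nat \<Rightarrow> real"
  assumes "finite A" "m \<notin> A" "S \<subseteq> A" "S' \<subseteq> A" "S \<inter> S' = {}"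
    "(\<Sum>v\<in>S. w v) = a" "(\<Sum>v\<in>S'. w v) = a'" "(\<Sum>v\<in>A. w v) = b"
  shows "(\<Sum>v\<in>A. w v * (q (card (grow v m S)) * q' (card (grow v m S')))) =
    (b - a - a') * (q (card S) * q' (card S')) + a * (q (Suc (card S)) * q' (card S')) +
    a' * (q (card S) * q' (Suc (card S')))"
proof -
  let ?f = "\<lambda>v. w v * (q (card (grow v m S)) * q' (card (grow v m S')))"
  have S: "finite S" "m \<notin> S" "finite S'" "m \<notin> S'" using assms finite_subset by auto
  have sub: "S \<union> S' \<subseteq> A" using assms by auto
  have "sum ?f A = sum ?f (A - (S \<union> S')) + sum ?f (S \<union> S')"
    using assms sub by (intro sum.subset_diff) auto
  also have "sum ?f (S \<union> S') = sum ?f S + sum ?f S'"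
    using S assms by (intro sum.union_disjoint) auto
  also have "sum ?f (A - (S \<union> S')) = (\<Sum>v\<in>A - (S \<union> S'). w v) * (q (card S) * q' (card S'))"
    using S by (simp add: grow_simps sum_distrib_right)
  also have "(\<Sum>v\<in>A - (S \<union> S'). w v) = b - (a + a')"
    using assms sub S by (simp add: sum_diff sum.union_disjoint)
  also have "sum ?f S = (\<Sum>v\<in>S. w v * (q (Suc (card S)) * q' (card S')))"
  proof (rule sum.cong[OF refl])
    fix v assume "v \<in> S"
    then have "v \<notin> S'" using assms by auto
    then show "?f v = w v * (q (Suc (card S)) * q' (card S'))" using S \<open>v \<in> S\<close> by (simp add: grow_simps)
  qed
  also have "\<dots> = a * (q (Suc (card S)) * q' (card S'))" using assms(6) by (simp flip: sum_distrib_right)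
  also have "sum ?f S' = (\<Sum>v\<in>S'. w v * (q (card S) * q' (Suc (card S'))))"
  proof (rule sum.cong[OF refl])
    fix v assume "v \<in> S'"
    then have "v \<notin> S" using assms by auto
    then show "?f v = w v * (q (card S) * q' (Suc (card S')))" using S \<open>v \<in> S'\<close> by (simp add: grow_simps)
  qed
  also have "\<dots> = a' * (q (card S) * q' (Suc (card S')))" using assms(7) by (simp flip: sum_distrib_right)
  finally show ?thesis by (simp add: algebra_simps)
qed

lemma sum_insert_grow:
  assumes "finite L" "m \<notin> A" "\<And>S. S \<in> L \<Longrightarrow> S \<subseteq> A" "v \<in> A"
  shows "(\<Sum>S\<in>insert {m} (grow v m ` L). q S) = q {m} + (\<Sum>S\<in>L. q (grow v m S) :: real)"
proof -
  have mS: "m \<notin> S" if "S \<in> L" for S using that assms by auto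
  have "{m} \<notin> grow v m ` L" using assms by (auto simp: grow_def split: if_splits)
  moreover have "inj_on (grow v m) L"
  proof (rule inj_onI)
    fix S S' assume "S \<in> L" "S' \<in> L" "grow v m S = grow v m S'"
    moreover have "grow v m S - {m} = S" if "S \<in> L" for S using mS[OF that] by (auto simp: grow_def)
    ultimately show "S = S'" by metis
  qed
  ultimately show ?thesis using assms(1) by (simp add: sum.reindex)
qed

definition mean_size :: "family \<Rightarrow> nat \<Rightarrow> nat \<Rightarrow> real" where
  "mean_size F n k = avg F n (\<lambda>t. \<Sum>S\<in>fringe_labels t. of_bool (card S = k))"

text \<open>Ordered pairs. Label sets are nonempty, so disjointness excludes S = S'; nested pairs,
  including equal ones, are estimated separately.\<close>

definition mean_pairs :: "family \<Rightarrow> nat \<Rightarrow> nat \<Rightarrow> nat \<Rightarrow> real" where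
  "mean_pairs F n j k = avg F n (\<lambda>t. \<Sum>S\<in>fringe_labels t. \<Sum>S'\<in>fringe_labels t.
     of_bool (S \<inter> S' = {}) * (of_bool (card S = j) * of_bool (card S' = k)))"

lemma sum_attach_weight_trees_on:
  assumes "t \<in> trees_on F A"
  shows "(\<Sum>v\<in>A. attach_weight F v t) = total_attach F (card A)"
  using sum_attach_weight_labels[of F t] assms by (simp add: trees_on_def)

text \<open>A subtree of size k + 1 survives unless the new vertex enters it, one of size k is
  entered with probability \<open>a_k / a_n\<close>, and the new leaf counts when k = 0.\<close>

lemma mean_size_Suc:
  assumes vs: "very_simple F" and n: "n \<ge> 1"
  shows "mean_size F (Suc n) (Suc k) = ((total_attach F n - total_attach F (Suc k)) * mean_size F n (Suc k) +
    total_attach F k * mean_size F n k + total_attach F n * of_bool (k = 0)) / total_attach F n"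
proof -
  let ?a = "total_attach F" and ?q = "\<lambda>i::nat. of_bool (i = Suc k) :: real"
  have "mean_size F (Suc n) (Suc k) = avg F n (\<lambda>t. \<Sum>v\<in>{1..n}. attach_weight F v t *
      (\<Sum>S\<in>insert {Suc n} (grow v (Suc n) ` fringe_labels t). ?q (card S))) / ?a n"
    unfolding mean_size_def by (rule avg_Suc[OF vs n])
  also have "avg F n (\<lambda>t. \<Sum>v\<in>{1..n}. attach_weight F v t *
      (\<Sum>S\<in>insert {Suc n} (grow v (Suc n) ` fringe_labels t). ?q (card S))) =
    avg F n (\<lambda>t. ?a n * of_bool (k = 0) + ((?a n - ?a (Suc k)) * (\<Sum>S\<in>fringe_labels t. ?q (card S)) +
      ?a k * (\<Sum>S\<in>fringe_labels t. of_bool (card S = k))))"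
  proof (rule avg_cong)
    fix t assume t: "t \<in> trees_on F {1..n}"
    note sub = fringe_labels_in(1)[OF t] and sumS = fringe_labels_in(3)[OF t]
    have tot: "(\<Sum>v\<in>{1..n}. attach_weight F v t) = ?a n" using sum_attach_weight_trees_on[OF t] by simp
    have "(\<Sum>v\<in>{1..n}. attach_weight F v t *
        (\<Sum>S\<in>insert {Suc n} (grow v (Suc n) ` fringe_labels t). ?q (card S))) =
      (\<Sum>v\<in>{1..n}. attach_weight F v t * ?q 1 +
        (\<Sum>S\<in>fringe_labels t. attach_weight F v t * ?q (card (grow v (Suc n) S))))"
      by (intro sum.cong refl, subst sum_insert_grow[where A = "{1..n}"])
        (use sub in \<open>auto simp: distrib_left sum_distrib_left\<close>)
    also have "\<dots> = ?a n * of_bool (k = 0) +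
        (\<Sum>S\<in>fringe_labels t. \<Sum>v\<in>{1..n}. attach_weight F v t * ?q (card (grow v (Suc n) S)))"
      unfolding sum.distrib by (subst sum.swap) (simp add: tot[unfolded One_nat_def] flip: sum_distrib_right)
    also have "(\<Sum>S\<in>fringe_labels t. \<Sum>v\<in>{1..n}. attach_weight F v t * ?q (card (grow v (Suc n) S))) =
        (\<Sum>S\<in>fringe_labels t. (?a n - ?a (card S)) * ?q (card S) + ?a (card S) * ?q (Suc (card S)))"
      by (intro sum.cong refl sum_grow) (use sub sumS tot in auto)
    also have "\<dots> = (\<Sum>S\<in>fringe_labels t. (?a n - ?a (Suc k)) * ?q (card S) + ?a k * of_bool (card S = k))"
      by (intro sum.cong refl) auto
    finally show "(\<Sum>v\<in>{1..n}. attach_weight F v t *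
        (\<Sum>S\<in>insert {Suc n} (grow v (Suc n) ` fringe_labels t). ?q (card S))) =
      ?a n * of_bool (k = 0) + ((?a n - ?a (Suc k)) * (\<Sum>S\<in>fringe_labels t. ?q (card S)) +
      ?a k * (\<Sum>S\<in>fringe_labels t. of_bool (card S = k)))"
      by (simp only: sum.distrib sum_distrib_left)
  qed
  also have "\<dots> = ?a n * of_bool (k = 0) + ((?a n - ?a (Suc k)) * mean_size F n (Suc k) + ?a k * mean_size F n k)"
    unfolding avg_add avg_cmult avg_const[OF vs n] mean_size_def ..
  finally show ?thesis by (simp add: algebra_simps)
qed

lemma mean_size_0: "mean_size F n 0 = 0"
proof -
  have "mean_size F n 0 = avg F n (\<lambda>t. 0)" unfolding mean_size_def
  proof (rule avg_cong)
    fix t assume t: "t \<in> trees_on F {1..n}"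
    have "card S \<noteq> 0" if "S \<in> fringe_labels t" for S
      using fringe_labels_in(1,2)[OF t that] finite_subset[of S "{1..n}"] by auto
    then show "(\<Sum>S\<in>fringe_labels t. of_bool (card S = 0)) = (0::real)" by (intro sum.neutral) auto
  qed
  then show ?thesis by (simp add: avg_def wsum_def)
qed

lemma mean_size_self:
  assumes "very_simple F" "n \<ge> 1"
  shows "mean_size F n n = 1"
proof -
  have "mean_size F n n = avg F n (\<lambda>t. 1)" unfolding mean_size_def
  proof (rule avg_cong)
    fix t assume t: "t \<in> trees_on F {1..n}"
    have "card S = n \<longleftrightarrow> S = {1..n}" if "S \<in> fringe_labels t" for S
      using fringe_labels_in(1)[OF t that] card_subset_eq[of "{1..n}" S] by auto
    then have "(\<Sum>S\<in>fringe_labels t. of_bool (card S = n)) =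
        (\<Sum>S\<in>fringe_labels t. if S = {1..n} then 1 else 0 :: real)" by (intro sum.cong) auto
    also have "\<dots> = 1" using self_in_fringe_labels[of t] t by (simp add: trees_on_def)
    finally show "(\<Sum>S\<in>fringe_labels t. of_bool (card S = n)) = (1::real)" .
  qed
  then show ?thesis using assms by (simp add: avg_const)
qed

text \<open>Induction with \<open>mean_size_Suc\<close>; the numerators add up to
  \<open>a_n - a_k + a_(k+1)\<close>, which is \<open>a_(n+1)\<close>.\<close>

lemma mean_size_eq:
  assumes vs: "very_simple F" and k: "k \<ge> 1" "k < n"
  shows "mean_size F n k = total_attach F n / (total_attach F k * total_attach F (Suc k))"
  using k
proof (induction n arbitrary: k)
  case (Suc n)
  let ?a = "total_attach F"
  have pos: "?a i > 0" if "i \<ge> 1" for i using total_attach_ge_1[OF vs that] by simp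
  obtain k' where k': "k = Suc k'" using Suc.prems by (cases k) auto
  have n: "n \<ge> 1" using Suc.prems by simp
  note rec = mean_size_Suc[OF vs n, of k']
  \<comment> \<open>For k = 1 the new leaf takes the place of growth from size 0 and supplies the
    same value because \<open>a_1\<close> = 1.\<close>
  have low: "?a k' * mean_size F n k' + ?a n * of_bool (k' = 0) = ?a n / ?a k"
  proof (cases "k' = 0")
    case True then show ?thesis using k' by (simp add: mean_size_0)
  next
    case False
    then have "mean_size F n k' = ?a n / (?a k' * ?a k)"
      using Suc.IH[of k'] Suc.prems k' by simp
    then show ?thesis using pos[of k'] False by simp
  qed
  \<comment> \<open>The closed form fails at k = n, where the mean is 1, but there the coefficient
    vanishes.\<close>
  have high: "(?a n - ?a k) * mean_size F n k = (?a n - ?a k) * (?a n / (?a k * ?a (Suc k)))"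
    using Suc.IH[of k] Suc.prems by (cases "k = n") auto
  have "mean_size F (Suc n) k = ((?a n - ?a k) * (?a n / (?a k * ?a (Suc k))) + ?a n / ?a k) / ?a n"
    using rec high low unfolding k'[symmetric] by simp
  also have "\<dots> = ((?a n - ?a k) + ?a (Suc k)) / (?a k * ?a (Suc k))"
    using pos[of n] pos[of k] pos[of "Suc k"] n Suc.prems by (simp add: field_simps)
  also have "(?a n - ?a k) + ?a (Suc k) = ?a (Suc n)" by (simp add: total_attach_Suc)
  finally show ?case .
qed simp

text \<open>A vertex v lies in at most one of two disjoint sets, which gives the first three terms.
  The new leaf is disjoint from a grown set S precisely if v is outside S, which has weight
  \<open>a_n\<close> minus \<open>a\<close> at the size of S; this gives the terms with
  \<open>mean_size\<close>.\<close>

lemma mean_pairs_Suc: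
  assumes vs: "very_simple F" and n: "n \<ge> 1"
  shows "mean_pairs F (Suc n) (Suc j) (Suc k) =
    ((total_attach F n - total_attach F (Suc j) - total_attach F (Suc k)) * mean_pairs F n (Suc j) (Suc k) +
     total_attach F j * mean_pairs F n j (Suc k) + total_attach F k * mean_pairs F n (Suc j) k +
     of_bool (j = 0) * ((total_attach F n - total_attach F (Suc k)) * mean_size F n (Suc k)) +
     of_bool (k = 0) * ((total_attach F n - total_attach F (Suc j)) * mean_size F n (Suc j))) / total_attach F n"
proof -
  let ?a = "total_attach F" and ?d = "\<lambda>S S'. of_bool (S \<inter> S' = {}) :: real"
    and ?q = "\<lambda>i. of_bool (i = Suc j) :: real" and ?q' = "\<lambda>i. of_bool (i = Suc k) :: real"
  have "mean_pairs F (Suc n) (Suc j) (Suc k) = avg F n (\<lambda>t. \<Sum>v\<in>{1..n}. attach_weight F v t *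
      (\<Sum>S\<in>insert {Suc n} (grow v (Suc n) ` fringe_labels t).
       \<Sum>S'\<in>insert {Suc n} (grow v (Suc n) ` fringe_labels t). ?d S S' * (?q (card S) * ?q' (card S')))) / ?a n"
    unfolding mean_pairs_def by (rule avg_Suc[OF vs n])
  also have "avg F n (\<lambda>t. \<Sum>v\<in>{1..n}. attach_weight F v t *
      (\<Sum>S\<in>insert {Suc n} (grow v (Suc n) ` fringe_labels t).
       \<Sum>S'\<in>insert {Suc n} (grow v (Suc n) ` fringe_labels t). ?d S S' * (?q (card S) * ?q' (card S')))) =
    avg F n (\<lambda>t.
      (?a n - ?a (Suc j) - ?a (Suc k)) * (\<Sum>S\<in>fringe_labels t. \<Sum>S'\<in>fringe_labels t. ?d S S' * (?q (card S) * ?q' (card S'))) +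
      ?a j * (\<Sum>S\<in>fringe_labels t. \<Sum>S'\<in>fringe_labels t. ?d S S' * (of_bool (card S = j) * ?q' (card S'))) +
      ?a k * (\<Sum>S\<in>fringe_labels t. \<Sum>S'\<in>fringe_labels t. ?d S S' * (?q (card S) * of_bool (card S' = k))) +
      of_bool (j = 0) * ((?a n - ?a (Suc k)) * (\<Sum>S\<in>fringe_labels t. ?q' (card S))) +
      of_bool (k = 0) * ((?a n - ?a (Suc j)) * (\<Sum>S\<in>fringe_labels t. ?q (card S))))"
  proof (rule avg_cong)
    fix t assume t: "t \<in> trees_on F {1..n}"
    let ?L = "fringe_labels t" and ?w = "\<lambda>v. attach_weight F v t" and ?m = "Suc n"
    note sub = fringe_labels_in(1)[OF t] and sumS = fringe_labels_in(3)[OF t]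
    have tot: "sum ?w {1..n} = ?a n" using sum_attach_weight_trees_on[OF t] by simp
    have one: "(\<Sum>v\<in>{1..n}. ?w v * (?d {?m} (grow v ?m S) * c (card (grow v ?m S)))) = (?a n - ?a (card S)) * c (card S)"
      if S: "S \<in> ?L" for S and c :: "nat \<Rightarrow> real"
    proof -
      have S': "S \<subseteq> {1..n}" using sub[OF S] .
      have "(\<Sum>v\<in>{1..n}. ?w v * (?d {?m} (grow v ?m S) * c (card (grow v ?m S)))) =
        (\<Sum>v\<in>{1..n} - S. ?w v * c (card S))"
        using S' by (intro sum.mono_neutral_cong_right) (auto simp: grow_def)
      also have "\<dots> = (\<Sum>v\<in>{1..n} - S. ?w v) * c (card S)" by (simp add: sum_distrib_right)
      also have "(\<Sum>v\<in>{1..n} - S. ?w v) = ?a n - ?a (card S)" using S' sumS[OF S] tot by (simp add: sum_diff)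
      finally show ?thesis .
    qed
    have two: "(\<Sum>v\<in>{1..n}. ?w v * (?d (grow v ?m S) (grow v ?m S') * (?q (card (grow v ?m S)) * ?q' (card (grow v ?m S'))))) =
       (?a n - ?a (Suc j) - ?a (Suc k)) * (?d S S' * (?q (card S) * ?q' (card S'))) +
       ?a j * (?d S S' * (of_bool (card S = j) * ?q' (card S'))) +
       ?a k * (?d S S' * (?q (card S) * of_bool (card S' = k)))"
      if S: "S \<in> ?L" "S' \<in> ?L" for S S'
    proof (cases "S \<inter> S' = {}")
      case True
      have "grow v ?m S \<inter> grow v ?m S' = {}" for v using True sub[OF S(1)] sub[OF S(2)] by (auto simp: grow_def)
      then have "(\<Sum>v\<in>{1..n}. ?w v * (?d (grow v ?m S) (grow v ?m S') * (?q (card (grow v ?m S)) * ?q' (card (grow v ?m S'))))) =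
        (\<Sum>v\<in>{1..n}. ?w v * (?q (card (grow v ?m S)) * ?q' (card (grow v ?m S'))))" by simp
      also have "\<dots> = (?a n - ?a (card S) - ?a (card S')) * (?q (card S) * ?q' (card S')) +
          ?a (card S) * (?q (Suc (card S)) * ?q' (card S')) + ?a (card S') * (?q (card S) * ?q' (Suc (card S')))"
        by (rule sum_grow_disjoint) (use True sub sumS tot S in auto)
      also have "\<dots> = (?a n - ?a (Suc j) - ?a (Suc k)) * (?d S S' * (?q (card S) * ?q' (card S'))) +
       ?a j * (?d S S' * (of_bool (card S = j) * ?q' (card S'))) +
       ?a k * (?d S S' * (?q (card S) * of_bool (card S' = k)))"
        using True by auto
      finally show ?thesis .
    next
      \<comment> \<open>Sets that meet still meet after growing, so no disjoint pair is created
        here.\<close>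
      case False
      then have "grow v ?m S \<inter> grow v ?m S' \<noteq> {}" for v by (auto simp: grow_def)
      then show ?thesis using False by simp
    qed
    have "(\<Sum>v\<in>{1..n}. ?w v * (\<Sum>S\<in>insert {?m} (grow v ?m ` ?L). \<Sum>S'\<in>insert {?m} (grow v ?m ` ?L).
         ?d S S' * (?q (card S) * ?q' (card S')))) =
      (\<Sum>v\<in>{1..n}.
        (\<Sum>S'\<in>?L. ?q 1 * (?w v * (?d {?m} (grow v ?m S') * ?q' (card (grow v ?m S'))))) +
        (\<Sum>S\<in>?L. ?q' 1 * (?w v * (?d {?m} (grow v ?m S) * ?q (card (grow v ?m S))))) +
        (\<Sum>S\<in>?L. \<Sum>S'\<in>?L. ?w v * (?d (grow v ?m S) (grow v ?m S') * (?q (card (grow v ?m S)) * ?q' (card (grow v ?m S'))))))"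
    proof (rule sum.cong[OF refl])
      fix v assume v: "v \<in> {1..n}"
      have ins: "(\<Sum>S\<in>insert {?m} (grow v ?m ` ?L). c S) = c {?m} + (\<Sum>S\<in>?L. c (grow v ?m S))"
        for c :: "nat set \<Rightarrow> real"
        by (rule sum_insert_grow[where A = "{1..n}"]) (use sub v in auto)
      have ins2: "?w v * (\<Sum>S\<in>insert {?m} (grow v ?m ` ?L). \<Sum>S'\<in>insert {?m} (grow v ?m ` ?L). D S S') =
          ?w v * D {?m} {?m} + ((\<Sum>S'\<in>?L. ?w v * D {?m} (grow v ?m S')) + (\<Sum>S\<in>?L. ?w v * D (grow v ?m S) {?m}) +
          (\<Sum>S\<in>?L. \<Sum>S'\<in>?L. ?w v * D (grow v ?m S) (grow v ?m S')))" for D :: "nat set \<Rightarrow> nat set \<Rightarrow> real"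
        unfolding ins by (simp add: sum.distrib distrib_left sum_distrib_left)
      show "?w v * (\<Sum>S\<in>insert {?m} (grow v ?m ` ?L). \<Sum>S'\<in>insert {?m} (grow v ?m ` ?L).
         ?d S S' * (?q (card S) * ?q' (card S'))) =
        (\<Sum>S'\<in>?L. ?q 1 * (?w v * (?d {?m} (grow v ?m S') * ?q' (card (grow v ?m S'))))) +
        (\<Sum>S\<in>?L. ?q' 1 * (?w v * (?d {?m} (grow v ?m S) * ?q (card (grow v ?m S))))) +
        (\<Sum>S\<in>?L. \<Sum>S'\<in>?L. ?w v * (?d (grow v ?m S) (grow v ?m S') * (?q (card (grow v ?m S)) * ?q' (card (grow v ?m S')))))"
        \<comment> \<open>The leaf paired with itself is not disjoint; its vanishing term is matched
          with the 0 added in front of the right-hand side.\<close>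
        unfolding ins2
        by (subst add.left_neutral[symmetric], intro arg_cong2[where f = "(+)"] sum.cong refl)
          (simp_all add: Int_commute mult_ac)
    qed
    also have "\<dots> = (\<Sum>S'\<in>?L. ?q 1 * (\<Sum>v\<in>{1..n}. ?w v * (?d {?m} (grow v ?m S') * ?q' (card (grow v ?m S'))))) +
        (\<Sum>S\<in>?L. ?q' 1 * (\<Sum>v\<in>{1..n}. ?w v * (?d {?m} (grow v ?m S) * ?q (card (grow v ?m S))))) +
        (\<Sum>S\<in>?L. \<Sum>S'\<in>?L. \<Sum>v\<in>{1..n}. ?w v * (?d (grow v ?m S) (grow v ?m S') * (?q (card (grow v ?m S)) * ?q' (card (grow v ?m S')))))"
    proof -
      have sw: "(\<Sum>v\<in>{1..n}. \<Sum>S\<in>?L. \<Sum>S'\<in>?L. c v S S') = (\<Sum>S\<in>?L. \<Sum>S'\<in>?L. \<Sum>v\<in>{1..n}. c v S S')"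
        for c :: "nat \<Rightarrow> nat set \<Rightarrow> nat set \<Rightarrow> real"
        by (subst sum.swap) (intro sum.cong refl sum.swap)
      show ?thesis unfolding sum.distrib sw sum_distrib_left
        by (intro arg_cong2[where f = "(+)"] refl sum.swap)
    qed
    also have "\<dots> = (\<Sum>S'\<in>?L. ?q 1 * ((?a n - ?a (card S')) * ?q' (card S'))) +
        (\<Sum>S\<in>?L. ?q' 1 * ((?a n - ?a (card S)) * ?q (card S))) +
        (\<Sum>S\<in>?L. \<Sum>S'\<in>?L. (?a n - ?a (Suc j) - ?a (Suc k)) * (?d S S' * (?q (card S) * ?q' (card S'))) +
       ?a j * (?d S S' * (of_bool (card S = j) * ?q' (card S'))) +
       ?a k * (?d S S' * (?q (card S) * of_bool (card S' = k))))"
      by (intro arg_cong2[where f = "(+)"] sum.cong refl arg_cong2[where f = "(*)"] one two) auto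
    also have "(\<Sum>S'\<in>?L. ?q 1 * ((?a n - ?a (card S')) * ?q' (card S'))) =
        of_bool (j = 0) * ((?a n - ?a (Suc k)) * (\<Sum>S\<in>?L. ?q' (card S)))"
      unfolding sum_distrib_left by (intro sum.cong refl) auto
    also have "(\<Sum>S\<in>?L. ?q' 1 * ((?a n - ?a (card S)) * ?q (card S))) =
        of_bool (k = 0) * ((?a n - ?a (Suc j)) * (\<Sum>S\<in>?L. ?q (card S)))"
      unfolding sum_distrib_left by (intro sum.cong refl) auto
    finally show "(\<Sum>v\<in>{1..n}. ?w v * (\<Sum>S\<in>insert {?m} (grow v ?m ` ?L). \<Sum>S'\<in>insert {?m} (grow v ?m ` ?L).
         ?d S S' * (?q (card S) * ?q' (card S')))) =
      (?a n - ?a (Suc j) - ?a (Suc k)) * (\<Sum>S\<in>?L. \<Sum>S'\<in>?L. ?d S S' * (?q (card S) * ?q' (card S'))) +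
      ?a j * (\<Sum>S\<in>?L. \<Sum>S'\<in>?L. ?d S S' * (of_bool (card S = j) * ?q' (card S'))) +
      ?a k * (\<Sum>S\<in>?L. \<Sum>S'\<in>?L. ?d S S' * (?q (card S) * of_bool (card S' = k))) +
      of_bool (j = 0) * ((?a n - ?a (Suc k)) * (\<Sum>S\<in>?L. ?q' (card S))) +
      of_bool (k = 0) * ((?a n - ?a (Suc j)) * (\<Sum>S\<in>?L. ?q (card S)))"
      by (simp only: sum.distrib sum_distrib_left add_ac)
  qed
  also have "\<dots> = (?a n - ?a (Suc j) - ?a (Suc k)) * mean_pairs F n (Suc j) (Suc k) +
     ?a j * mean_pairs F n j (Suc k) + ?a k * mean_pairs F n (Suc j) k +
     of_bool (j = 0) * ((?a n - ?a (Suc k)) * mean_size F n (Suc k)) +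
     of_bool (k = 0) * ((?a n - ?a (Suc j)) * mean_size F n (Suc j))"
    unfolding avg_add avg_cmult mean_pairs_def mean_size_def ..
  finally show ?thesis .
qed

section \<open>The label sets of fringe subtrees form a laminar family\<close>

lemma inj_on_labels_fringe: "increasing F t \<Longrightarrow> inj_on labels (fringe t)"
proof (induction rule: increasing.induct)
  case (Vertex ks a)
  have inc: "increasing F (Vertex a ks)" using Vertex.hyps by (intro increasing.Vertex) auto
  have "s = s'" if s: "s \<in> fringe (Vertex a ks)" "s' \<in> fringe (Vertex a ks)" "labels s = labels s'" for s s'
  proof (cases "s = Vertex a ks \<or> s' = Vertex a ks")
    case True
    then show ?thesis using labels_fringe_psubset[OF inc] s by (metis psubset_eq)
  next
    case False
    then obtain c c' where c: "c \<in> children ks" "s \<in> fringe c" "c' \<in> children ks" "s' \<in> fringe c'"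
      using s by (auto simp: fringe_Vertex)
    have "labels s \<subseteq> labels c \<inter> labels c'" using labels_fringe_subset c s(3) by (metis le_inf_iff)
    then have "labels c \<inter> labels c' \<noteq> {}" using labels_nonempty[of s] by blast
    then have "c = c'" using Vertex.hyps(2) c by (auto simp: disjoint_family_on_def)
    then show ?thesis using Vertex.IH[OF c(1)] c s(3) by (auto dest: inj_onD)
  qed
  then show ?case by (rule inj_onI)
qed

lemma fringe_labels_laminar:
  "increasing F t \<Longrightarrow> S \<in> fringe_labels t \<Longrightarrow> S' \<in> fringe_labels t \<Longrightarrow> S \<inter> S' = {} \<or> S \<subseteq> S' \<or> S' \<subseteq> S"
proof (induction arbitrary: S S' rule: increasing.induct)
  case (Vertex ks a)
  then obtain s s' where s: "s \<in> fringe (Vertex a ks)" "S = labels s" "s' \<in> fringe (Vertex a ks)" "S' = labels s'"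
    by (auto simp: fringe_labels_def)
  show ?case
  proof (cases "s = Vertex a ks \<or> s' = Vertex a ks")
    case True
    then show ?thesis using labels_fringe_subset s by blast
  next
    case False
    then obtain c c' where c: "c \<in> children ks" "s \<in> fringe c" "c' \<in> children ks" "s' \<in> fringe c'"
      using s by (auto simp: fringe_Vertex)
    show ?thesis
    proof (cases "c = c'")
      case True
      then show ?thesis using Vertex.IH[OF c(1), of S S'] c s by (auto simp: fringe_labels_def)
    next
      case False
      then have "labels c \<inter> labels c' = {}" using Vertex.hyps(2) c by (auto simp: disjoint_family_on_def)
      then show ?thesis using labels_fringe_subset[OF c(2)] labels_fringe_subset[OF c(4)] s by blast
    qed
  qed
qed

lemma card_fringe: "increasing F t \<Longrightarrow> card (fringe t) = card (labels t)"
proof (induction rule: increasing.induct)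
  case (Vertex ks a)
  have inc: "increasing F (Vertex a ks)" using Vertex.hyps by (intro increasing.Vertex) auto
  have fin: "finite (labels s)" if "s \<in> children ks" for s using that Vertex.hyps finite_labels by blast
  have a: "a \<notin> (\<Union>s\<in>children ks. labels s)" using Vertex.hyps(4) by blast
  have "card (\<Union>s\<in>children ks. labels s) = (\<Sum>s\<in>children ks. card (labels s))"
    using fin Vertex.hyps(2) by (intro card_UN_disjoint) (auto simp: disjoint_family_on_def)
  then have "card (labels (Vertex a ks)) = Suc (\<Sum>s\<in>children ks. card (labels s))"
    using a fin by simp
  \<comment> \<open>A product of constants 2 makes counting multiplicative, so that
    \<open>prod_fringe_Vertex\<close> applies; the exponents are compared afterwards.\<close>
  moreover have "(2::real) ^ card (fringe (Vertex a ks)) = 2 * (\<Prod>s\<in>children ks. 2 ^ card (labels s))"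
    using prod_fringe_Vertex[OF inc, of "\<lambda>_. 2"] Vertex.IH by simp
  ultimately have "(2::real) ^ card (fringe (Vertex a ks)) = 2 ^ card (labels (Vertex a ks))"
    by (simp add: power_sum)
  then show ?case by (simp only: power_inject_exp)
qed

lemma card_fringe_labels:
  assumes "t \<in> trees_on F A"
  shows "card (fringe_labels t) = card A"
  using assms card_fringe[of F t] card_image[OF inj_on_labels_fringe[of F t]]
  by (simp add: trees_on_def fringe_labels_def)

lemma mean_pairs_0: "mean_pairs F n 0 k = 0" "mean_pairs F n k 0 = 0"
proof -
  have ne: "card S \<noteq> 0" if "t \<in> trees_on F {1..n}" "S \<in> fringe_labels t" for t S
    using fringe_labels_in(1,2)[OF that] finite_subset[of S "{1..n}"] by auto
  have "mean_pairs F n 0 k = avg F n (\<lambda>t. 0)" unfolding mean_pairs_def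
    by (rule avg_cong) (intro sum.neutral ballI, use ne in simp)
  then show "mean_pairs F n 0 k = 0" by (simp add: avg_def wsum_def)
  have "mean_pairs F n k 0 = avg F n (\<lambda>t. 0)" unfolding mean_pairs_def
    by (rule avg_cong) (intro sum.neutral ballI, use ne in simp)
  then show "mean_pairs F n k 0 = 0" by (simp add: avg_def wsum_def)
qed

lemma mean_pairs_le_square:
  assumes "very_simple F" "n \<ge> 1"
  shows "mean_pairs F n j k \<le> (real n)\<^sup>2"
proof -
  have "mean_pairs F n j k \<le> avg F n (\<lambda>t. (real n)\<^sup>2)"
    unfolding mean_pairs_def
  proof (rule avg_mono[OF assms])
    fix t assume "t \<in> trees_on F {1..n}"
    then have c: "card (fringe_labels t) = n" using card_fringe_labels by fastforce
    have "(\<Sum>S\<in>fringe_labels t. \<Sum>S'\<in>fringe_labels t.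
        of_bool (S \<inter> S' = {}) * (of_bool (card S = j) * of_bool (card S' = k))) \<le>
      (\<Sum>S\<in>fringe_labels t. \<Sum>S'\<in>fringe_labels t. 1 :: real)"
      by (intro sum_mono) auto
    also have "\<dots> = (real n)\<^sup>2" by (simp add: c power2_eq_square)
    finally show "(\<Sum>S\<in>fringe_labels t. \<Sum>S'\<in>fringe_labels t.
        of_bool (S \<inter> S' = {}) * (of_bool (card S = j) * of_bool (card S' = k))) \<le> (real n)\<^sup>2" .
  qed
  then show ?thesis using assms by (simp add: avg_const)
qed

text \<open>The expected number of fringe subtrees of size k < n divided by \<open>a_n\<close>; it
  does not depend on n.\<close>

definition size_density :: "family \<Rightarrow> nat \<Rightarrow> real" where
  "size_density F k = 1 / (total_attach F k * total_attach F (Suc k))"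

lemma size_density_nonneg: "very_simple F \<Longrightarrow> k \<ge> 1 \<Longrightarrow> size_density F k \<ge> 0"
  using total_attach_ge_1[of F k] total_attach_ge_1[of F "Suc k"] by (simp add: size_density_def)

text \<open>
  The first term alone satisfies the recursion up to favourable boundary terms, and the recursion does
  not increase a constant error. The error term pays for starting only at \<open>n = 2 * K + 1\<close>, from where
  on all coefficients are nonnegative.
\<close>

lemma mean_pairs_le:
  assumes vs: "very_simple F" and n: "2 * K + 1 \<le> n" and "1 \<le> j" "j \<le> K" "1 \<le> k" "k \<le> K"
  shows "mean_pairs F n j k \<le> size_density F j * size_density F k *
    (total_attach F n * total_attach F (Suc n)) + (2 * real K + 1)\<^sup>2"
  using n assms(3-6)
proof (induction n arbitrary: j k rule: dec_induct)
  case base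
  have "mean_pairs F (2 * K + 1) j k \<le> (2 * real K + 1)\<^sup>2"
    using mean_pairs_le_square[OF vs, of "2 * K + 1" j k] by (simp add: add_ac)
  moreover have "size_density F j * size_density F k *
      (total_attach F (2 * K + 1) * total_attach F (Suc (2 * K + 1))) \<ge> 0"
    using size_density_nonneg[OF vs] base total_attach_ge_1[OF vs, of "2 * K + 1"]
      total_attach_ge_1[OF vs, of "Suc (2 * K + 1)"] by simp
  ultimately show ?case by linarith
next
  case (step n)
  let ?a = "total_attach F" and ?x = "size_density F"
  define A where "A = ?a n"
  define b where "b = 1 + attachment F"
  define E where "E = (2 * real K + 1)\<^sup>2"
  have b: "b > 0" "b + attachment F \<ge> 0" using attachment_bounds[OF vs] by (auto simp: b_def)
  have n1: "n \<ge> 1" using step.hyps by simp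
  have E: "E \<ge> 0" by (simp add: E_def)
  have aSuc: "?a (Suc i) = ?a i + b" for i by (simp add: total_attach_Suc b_def)
  have A: "A \<ge> 1" using total_attach_ge_1[OF vs n1] by (simp add: A_def)
  have pos: "?a i \<ge> 1" if "i \<ge> 1" for i using total_attach_ge_1[OF vs that] .
  obtain j' k' where jk: "j = Suc j'" "k = Suc k'" using step.prems by (metis Suc_le_D One_nat_def)
  \<comment> \<open>Here j + k \<le> 2 K < n, so the value is at least b + \<alpha> = 1 + 2
    \<alpha>.\<close>
  have coeff: "A - ?a j - ?a k \<ge> 0"
  proof -
    have "A - ?a j - ?a k = b * (real n - real j - real k) + attachment F"
      by (simp add: A_def total_attach_def b_def algebra_simps)
    also have "\<dots> \<ge> b * 1 + attachment F"
      using step b by (intro add_right_mono mult_left_mono) linarith+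
    finally show ?thesis using b by linarith
  qed
  \<comment> \<open>Both sides equal \<open>1 / a_(i+1)\<close>: what leaves size i is what the
    recursion requires at size i + 1.\<close>
  have shift: "?a i * ?x i = ?x (Suc i) * (?a (Suc i) + b)" if "i \<ge> 1" for i
    using pos[OF that] pos[of "Suc i"] pos[of "Suc (Suc i)"] by (simp add: size_density_def aSuc)
  \<comment> \<open>One estimate for the inflow in either coordinate. For i = 0 the new leaf
    replaces growth from size 0, and A - \<open>a_l\<close> is enlarged to A + b, which is the
    favourable boundary term.\<close>
  have bd: "c * D + of_bool (i = 0) * ((A - ?a l) * mean_size F n l) \<le>
      (?a (Suc i) + b) * ?x (Suc i) * ?x l * (A * (A + b)) + ?a (Suc i) * E"
    if D: "c = ?a i" "i \<ge> 1 \<Longrightarrow> D \<le> ?x i * ?x l * (A * (A + b)) + E" "i = 0 \<Longrightarrow> D = 0"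
      and l: "1 \<le> l" "l \<le> K" for i l c D
  proof (cases "i = 0")
    case True
    have "mean_size F n l = A * ?x l"
      using mean_size_eq[OF vs, of l n] l step.hyps by (simp add: A_def size_density_def)
    then have "(A - ?a l) * mean_size F n l \<le> (A + b) * (A * ?x l)"
      using A b pos[OF l(1)] size_density_nonneg[OF vs l(1)] by (auto intro!: mult_right_mono)
    also have "\<dots> = (?a (Suc i) + b) * ?x (Suc i) * ?x l * (A * (A + b))"
      using True b by (simp add: size_density_def aSuc[of "Suc 0"])
    finally show ?thesis using True D(3) E by simp
  next
    case False
    then have "?a i * D \<le> ?a i * (?x i * ?x l * (A * (A + b)) + E)"
      using D(2) pos[of i] by (intro mult_left_mono) auto
    also have "\<dots> = (?a i * ?x i) * ?x l * (A * (A + b)) + ?a i * E" by (simp add: algebra_simps)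
    also have "\<dots> \<le> (?a (Suc i) + b) * ?x (Suc i) * ?x l * (A * (A + b)) + ?a (Suc i) * E"
      using shift[of i] False E b by (auto simp: aSuc mult_ac intro!: mult_left_mono)
    finally show ?thesis using False D(1) by simp
  qed
  have IH: "mean_pairs F n i l \<le> ?x i * ?x l * (A * (A + b)) + E" if "1 \<le> i" "i \<le> K" "1 \<le> l" "l \<le> K" for i l
    using step.IH[OF that] by (simp add: A_def E_def aSuc)
  have t1: "(A - ?a j - ?a k) * mean_pairs F n j k \<le> (A - ?a j - ?a k) * (?x j * ?x k * (A * (A + b)) + E)"
    using IH step.prems coeff by (intro mult_left_mono) auto
  have t2: "?a j' * mean_pairs F n j' k + of_bool (j' = 0) * ((A - ?a k) * mean_size F n k) \<le>
      (?a (Suc j') + b) * ?x (Suc j') * ?x k * (A * (A + b)) + ?a (Suc j') * E"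
    by (rule bd) (use IH step.prems jk in \<open>auto simp: mean_pairs_0\<close>)
  have t3: "?a k' * mean_pairs F n j k' + of_bool (k' = 0) * ((A - ?a j) * mean_size F n j) \<le>
      (?a (Suc k') + b) * ?x (Suc k') * ?x j * (A * (A + b)) + ?a (Suc k') * E"
    by (rule bd) (use IH[of j k'] step.prems jk in \<open>auto simp: mean_pairs_0 mult_ac\<close>)
  have "A * mean_pairs F (Suc n) j k = (A - ?a j - ?a k) * mean_pairs F n j k +
     ?a j' * mean_pairs F n j' k + ?a k' * mean_pairs F n j k' +
     of_bool (j' = 0) * ((A - ?a k) * mean_size F n k) +
     of_bool (k' = 0) * ((A - ?a j) * mean_size F n j)"
    unfolding jk mean_pairs_Suc[OF vs n1] A_def[symmetric] using A by simp
  also have "\<dots> \<le> (A - ?a j - ?a k) * (?x j * ?x k * (A * (A + b)) + E) +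
      ((?a j + b) * ?x j * ?x k * (A * (A + b)) + ?a j * E) +
      ((?a k + b) * ?x k * ?x j * (A * (A + b)) + ?a k * E)"
    using t1 t2 t3 unfolding jk by linarith
  \<comment> \<open>The coefficients of the main term add up to A + 2 b, which gives the product
    \<open>a_n a_(n+1) a_(n+2)\<close>. Those of E add up to exactly A, so the error does not
    grow.\<close>
  also have "\<dots> = A * (?x j * ?x k * ((A + b) * (A + 2 * b)) + E)"
    by (simp add: algebra_simps)
  finally have "mean_pairs F (Suc n) j k \<le> ?x j * ?x k * ((A + b) * (A + 2 * b)) + E"
    using A by simp
  then show ?case by (simp add: A_def E_def aSuc add_ac)
qed

section \<open>Mean and variance of the number of fringe subtrees with sizes in a range\<close>

definition size_count :: "nat set \<Rightarrow> nat labelled_tree \<Rightarrow> real" where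
  "size_count K t = (\<Sum>S\<in>fringe_labels t. of_bool (card S \<in> K))"

lemma size_count_eq_sum:
  assumes "finite K"
  shows "size_count K t = (\<Sum>k\<in>K. \<Sum>S\<in>fringe_labels t. of_bool (card S = k))"
proof -
  have "(\<Sum>k\<in>K. of_bool (card S = k)) = (of_bool (card S \<in> K) :: real)" for S :: "nat set"
    using assms by (simp add: of_bool_def sum.delta')
  then show ?thesis unfolding size_count_def by (subst sum.swap) simp
qed

lemma avg_size_count: "finite K \<Longrightarrow> avg F n (size_count K) = (\<Sum>k\<in>K. mean_size F n k)"
  unfolding mean_size_def avg_sum[symmetric] by (intro avg_cong) (rule size_count_eq_sum)

text \<open>The sum telescopes, since consecutive values of \<open>total_attach\<close> differ by 1
  + \<alpha> = 1 / \<kappa>.\<close>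

lemma sum_size_density:
  assumes vs: "very_simple F" and k: "1 \<le> k" "k \<le> m"
  shows "(\<Sum>i\<in>{k..<m}. size_density F i) = kappa F * (1 / total_attach F k - 1 / total_attach F m)"
  using k(2)
proof (induction m rule: dec_induct)
  case (step m)
  let ?a = "total_attach F"
  have a: "?a m \<ge> 1" "?a (Suc m) \<ge> 1" using total_attach_ge_1[OF vs] step k by auto
  have "size_density F m = kappa F * (1 / ?a m - 1 / ?a (Suc m))"
    using a attachment_bounds(1)[OF vs] by (simp add: size_density_def kappa_def total_attach_Suc field_simps)
  then show ?case using step by (simp add: algebra_simps)
qed simp

lemma avg_size_count_range:
  assumes vs: "very_simple F" and k: "1 \<le> k" "k \<le> m" "m \<le> n"
  shows "avg F n (size_count {k..<m}) = kappa F * total_attach F n * (1 / total_attach F k - 1 / total_attach F m)"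
proof -
  have "avg F n (size_count {k..<m}) = (\<Sum>i\<in>{k..<m}. total_attach F n * size_density F i)"
    unfolding avg_size_count[OF finite_atLeastLessThan]
    using k by (intro sum.cong) (auto simp: mean_size_eq[OF vs] size_density_def)
  then show ?thesis using sum_size_density[OF vs k(1,2)] by (simp flip: sum_distrib_left)
qed

text \<open>The summand 1 is the whole tree, the only fringe subtree of size n, to which the closed
  form does not apply.\<close>

lemma avg_size_count_ge:
  assumes vs: "very_simple F" and k: "1 \<le> k" "k \<le> n"
  shows "avg F n (size_count {k..}) \<le> kappa F * total_attach F n / total_attach F k + 1"
proof -
  have "avg F n (size_count {k..}) = avg F n (\<lambda>t. size_count {k..<n} t + size_count {n} t)"
  proof (rule avg_cong)
    fix t assume t: "t \<in> trees_on F {1..n}"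
    have "card S \<le> n" if "S \<in> fringe_labels t" for S
      using card_mono[OF _ fringe_labels_in(1)[OF t that]] by simp
    then show "size_count {k..} t = size_count {k..<n} t + size_count {n} t"
      unfolding size_count_def sum.distrib[symmetric] using k(2)
      by (intro sum.cong) (fastforce simp: of_bool_def)+
  qed
  also have "\<dots> = kappa F * total_attach F n * (1 / total_attach F k - 1 / total_attach F n) + 1"
    unfolding avg_add using avg_size_count_range[OF vs k(1,2)] avg_size_count[of "{n}" F n] mean_size_self[OF vs] k
    by simp
  also have "\<dots> \<le> kappa F * total_attach F n / total_attach F k + 1"
  proof -
    have "kappa F * total_attach F n / total_attach F n \<ge> 0"
      using total_attach_ge_1[OF vs, of n] k attachment_bounds(1)[OF vs] by (simp add: kappa_def)
    then show ?thesis by (simp add: right_diff_distrib)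
  qed
  finally show ?thesis .
qed

text \<open>Two label sets are disjoint or nested. The sets above a fixed one form a chain, so their
  cardinalities are distinct and below m, and there are at most m of them. Counting nested pairs in
  both orders gives the factor 2.\<close>

lemma size_count_square_le:
  assumes t: "t \<in> trees_on F {1..n}"
  shows "(size_count {k..<m} t)\<^sup>2 \<le> (\<Sum>i\<in>{k..<m}. \<Sum>l\<in>{k..<m}. \<Sum>S\<in>fringe_labels t. \<Sum>S'\<in>fringe_labels t.
     of_bool (S \<inter> S' = {}) * (of_bool (card S = i) * of_bool (card S' = l))) + 2 * real m * size_count {k..<m} t"
proof -
  let ?L = "fringe_labels t"
  define K where "K = {k..<m}"
  define M where "M = {S \<in> ?L. card S \<in> K}"
  have fin: "finite ?L" "finite M" "finite K" by (auto simp: M_def K_def)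
  have Z: "size_count K t = real (card M)"
    using fin by (simp add: size_count_def M_def of_bool_def sum.If_cases Int_def)
  have inc: "increasing F t" using t by (simp add: trees_on_def)
  have chain: "(\<Sum>S'\<in>M. of_bool (S \<subseteq> S')) \<le> real m" if S: "S \<in> M" for S
  proof -
    have finS: "finite S'" if "S' \<in> M" for S'
      using fringe_labels_in(1)[OF t, of S'] that finite_subset[of S' "{1..n}"] by (auto simp: M_def)
    have "S \<noteq> {}" using fringe_labels_in(2)[OF t] S by (auto simp: M_def)
    then have "S1 \<subseteq> S2 \<or> S2 \<subseteq> S1" if "S1 \<in> M" "S2 \<in> M" "S \<subseteq> S1" "S \<subseteq> S2" for S1 S2
      using fringe_labels_laminar[OF inc, of S1 S2] that by (auto simp: M_def)
    then have "inj_on card {S'\<in>M. S \<subseteq> S'}"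
      using finS by (intro inj_onI) (metis (mono_tags, lifting) card_subset_eq mem_Collect_eq)
    moreover have "card ` {S'\<in>M. S \<subseteq> S'} \<subseteq> {..<m}" by (auto simp: M_def K_def)
    ultimately have "card {S'\<in>M. S \<subseteq> S'} \<le> m" by (metis card_inj_on_le card_lessThan finite_lessThan)
    then show ?thesis using fin by (simp add: of_bool_def sum.If_cases Int_def)
  qed
  have "(real (card M))\<^sup>2 = (\<Sum>S\<in>M. \<Sum>S'\<in>M. 1 :: real)" by (simp add: power2_eq_square)
  also have "\<dots> \<le> (\<Sum>S\<in>M. \<Sum>S'\<in>M. of_bool (S \<inter> S' = {}) + of_bool (S \<subseteq> S') + of_bool (S' \<subseteq> S))"
    using fringe_labels_laminar[OF inc] by (intro sum_mono) (fastforce simp: M_def of_bool_def)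
  also have "\<dots> = (\<Sum>S\<in>M. \<Sum>S'\<in>M. of_bool (S \<inter> S' = {})) + (\<Sum>S\<in>M. \<Sum>S'\<in>M. of_bool (S \<subseteq> S')) +
      (\<Sum>S\<in>M. \<Sum>S'\<in>M. of_bool (S' \<subseteq> S))"
    by (simp only: sum.distrib)
  also have "(\<Sum>S\<in>M. \<Sum>S'\<in>M. of_bool (S' \<subseteq> S)) = (\<Sum>S\<in>M. \<Sum>S'\<in>M. of_bool (S \<subseteq> S') :: real)"
    by (rule sum.swap)
  also have "(\<Sum>S\<in>M. \<Sum>S'\<in>M. of_bool (S \<subseteq> S')) \<le> (\<Sum>S\<in>M. real m)"
    by (intro sum_mono chain)
  also have "(\<Sum>S\<in>M. \<Sum>S'\<in>M. of_bool (S \<inter> S' = {})) =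
      (\<Sum>S\<in>?L. \<Sum>S'\<in>?L. of_bool (S \<inter> S' = {}) * (of_bool (card S \<in> K) * of_bool (card S' \<in> K)) :: real)"
  proof -
    have filter: "(\<Sum>S\<in>M. c S) = (\<Sum>S\<in>?L. of_bool (card S \<in> K) * c S)" for c :: "nat set \<Rightarrow> real"
      unfolding M_def by (intro sum.mono_neutral_cong_left) auto
    show ?thesis unfolding filter sum_distrib_left by (intro sum.cong refl) (simp only: mult_ac)
  qed
  also have "\<dots> = (\<Sum>S\<in>?L. \<Sum>S'\<in>?L. \<Sum>i\<in>K. \<Sum>l\<in>K. of_bool (S \<inter> S' = {}) * (of_bool (card S = i) * of_bool (card S' = l)))"
  proof (intro sum.cong refl)
    fix S S' :: "nat set"
    have mem: "of_bool (card S \<in> K) = (\<Sum>i\<in>K. of_bool (card S = i) :: real)" for S :: "nat set"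
      using fin by (simp add: of_bool_def sum.delta')
    show "of_bool (S \<inter> S' = {}) * (of_bool (card S \<in> K) * of_bool (card S' \<in> K)) =
      (\<Sum>i\<in>K. \<Sum>l\<in>K. of_bool (S \<inter> S' = {}) * (of_bool (card S = i) * of_bool (card S' = l)) :: real)"
      by (simp only: mem sum_distrib_left[symmetric] sum_distrib_right[symmetric])
  qed
  also have "\<dots> = (\<Sum>i\<in>K. \<Sum>l\<in>K. \<Sum>S\<in>?L. \<Sum>S'\<in>?L. of_bool (S \<inter> S' = {}) * (of_bool (card S = i) * of_bool (card S' = l)))"
  proof -
    have "(\<Sum>S\<in>?L. \<Sum>S'\<in>?L. \<Sum>i\<in>K. \<Sum>l\<in>K. f S S' i l) = (\<Sum>i\<in>K. \<Sum>l\<in>K. \<Sum>S\<in>?L. \<Sum>S'\<in>?L. f S S' i l)"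
      for f :: "nat set \<Rightarrow> nat set \<Rightarrow> nat \<Rightarrow> nat \<Rightarrow> real"
      unfolding sum.cartesian_product
      by (rule sum.reindex_bij_witness[where i = "\<lambda>(i, l, S, S'). (S, S', i, l)"
            and j = "\<lambda>(S, S', i, l). (i, l, S, S')"]) auto
    then show ?thesis .
  qed
  finally show ?thesis using Z unfolding K_def by (simp add: mult_ac)
qed

text \<open>The main term of the pair bound is \<open>a_n a_(n+1)\<close> instead of the square of
  \<open>a_n\<close>, which exceeds \<mu> squared by a relative error of order 1 / n. The term of
  order \<open>m^4\<close> collects the constant errors of at most \<open>m^2\<close> pairs of
  sizes, and the last one comes from nested pairs.\<close>

lemma variance_size_count:
  assumes vs: "very_simple F" and k: "1 \<le> k" and n: "2 * m + 1 \<le> n"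
  defines "\<mu> \<equiv> avg F n (size_count {k..<m})"
  shows "avg F n (\<lambda>t. (size_count {k..<m} t - \<mu>)\<^sup>2) \<le>
    \<mu>\<^sup>2 * (1 + attachment F) / total_attach F n + (real m)\<^sup>2 * (2 * real m + 1)\<^sup>2 + 2 * real m * \<mu>"
proof -
  let ?Z = "size_count {k..<m}" and ?a = "total_attach F" and ?x = "size_density F"
  have n1: "n \<ge> 1" using n by simp
  have a: "?a n \<ge> 1" using total_attach_ge_1[OF vs n1] .
  have mu: "\<mu> = ?a n * (\<Sum>i\<in>{k..<m}. ?x i)"
    unfolding \<mu>_def avg_size_count[OF finite_atLeastLessThan] sum_distrib_left
    using k n by (intro sum.cong) (auto simp: mean_size_eq[OF vs] size_density_def)
  have "avg F n (\<lambda>t. (?Z t)\<^sup>2) \<le> avg F n (\<lambda>t. (\<Sum>i\<in>{k..<m}. \<Sum>l\<in>{k..<m}. \<Sum>S\<in>fringe_labels t. \<Sum>S'\<in>fringe_labels t.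
     of_bool (S \<inter> S' = {}) * (of_bool (card S = i) * of_bool (card S' = l))) + 2 * real m * ?Z t)"
    by (intro avg_mono[OF vs n1] size_count_square_le)
  also have "\<dots> = (\<Sum>i\<in>{k..<m}. \<Sum>l\<in>{k..<m}. mean_pairs F n i l) + 2 * real m * \<mu>"
    unfolding avg_add avg_cmult \<mu>_def avg_sum[of F n _ "{k..<m}"] mean_pairs_def ..
  also have "(\<Sum>i\<in>{k..<m}. \<Sum>l\<in>{k..<m}. mean_pairs F n i l) \<le>
      (\<Sum>i\<in>{k..<m}. \<Sum>l\<in>{k..<m}. ?x i * ?x l * (?a n * ?a (Suc n)) + (2 * real m + 1)\<^sup>2)"
    using k n by (intro sum_mono mean_pairs_le[OF vs]) auto
  also have "\<dots> = (\<Sum>i\<in>{k..<m}. ?x i)\<^sup>2 * (?a n * ?a (Suc n)) + (real (m - k))\<^sup>2 * (2 * real m + 1)\<^sup>2"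
    by (cases "k \<le> m") (simp_all add: sum.distrib power2_eq_square sum_product of_nat_diff flip: sum_distrib_right)
  also have "(\<Sum>i\<in>{k..<m}. ?x i)\<^sup>2 * (?a n * ?a (Suc n)) = \<mu>\<^sup>2 + \<mu>\<^sup>2 * (1 + attachment F) / ?a n"
    unfolding mu total_attach_Suc using a by (simp add: power2_eq_square field_simps)
  also have "(real (m - k))\<^sup>2 * (2 * real m + 1)\<^sup>2 \<le> (real m)\<^sup>2 * (2 * real m + 1)\<^sup>2"
    by (intro mult_right_mono power_mono) auto
  finally have "avg F n (\<lambda>t. (?Z t)\<^sup>2) \<le> \<mu>\<^sup>2 + \<mu>\<^sup>2 * (1 + attachment F) / ?a n +
      (real m)\<^sup>2 * (2 * real m + 1)\<^sup>2 + 2 * real m * \<mu>" by simp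
  moreover have "avg F n (\<lambda>t. (?Z t - \<mu>)\<^sup>2) = avg F n (\<lambda>t. (?Z t)\<^sup>2 + (- 2 * \<mu>) * ?Z t + \<mu>\<^sup>2)"
    by (intro avg_cong) (simp add: power2_eq_square algebra_simps)
  moreover have "\<dots> = avg F n (\<lambda>t. (?Z t)\<^sup>2) - \<mu>\<^sup>2"
    unfolding avg_add avg_cmult avg_const[OF vs n1] \<mu>_def[symmetric] by (simp add: power2_eq_square)
  ultimately show ?thesis by linarith
qed

section \<open>Isomorphism classes of fringe subtrees\<close>

lemma prob_random_tree:
  assumes "very_simple F" "n \<ge> 1"
  shows "measure_pmf.prob (random_tree F n) E = avg F n (indicator E)"
  using expectation_random_tree[OF assms, of "indicator E"] by simp

lemma relabel_fringe:
  assumes "t \<in> trees_on F A" "s \<in> fringe t"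
  shows "relabel s \<in> trees_of_size F (card (labels s))"
  using assms by (auto simp: trees_on_def intro: relabel_in_trees increasing_fringe)

text \<open>For f = 1 - indicator C the product over the fringe is the indicator that C is absent,
  and \<theta> is the probability that a random tree of size k avoids C.\<close>

lemma avg_class_absent:
  assumes vs: "very_simple F" and "n \<ge> 1" "k \<ge> 1"
  shows "avg F n (\<lambda>t. of_bool (\<forall>s\<in>fringe t. card (labels s) = k \<longrightarrow> relabel s \<notin> C)) =
    avg F n (\<lambda>t. (1 - avg F k (indicator C)) ^ card {s \<in> fringe t. card (labels s) = k})"
proof -
  let ?f = "\<lambda>t. 1 - indicator C t :: real"
  have \<theta>: "wsum F {1..k} ?f / wsum F {1..k} (\<lambda>_. 1) = 1 - avg F k (indicator C)"
    using avg_diff[of F k "\<lambda>_. 1" "indicator C"] avg_const[OF vs assms(3), of 1] by (simp add: avg_def)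
  have "(\<Prod>s\<in>fringe t. if card (labels s) = k then ?f (relabel s) else 1) =
      (of_bool (\<forall>s\<in>fringe t. card (labels s) = k \<longrightarrow> relabel s \<notin> C) :: real)" for t
  proof (cases "\<forall>s\<in>fringe t. card (labels s) = k \<longrightarrow> relabel s \<notin> C")
    case True
    then show ?thesis by (auto intro!: prod.neutral)
  next
    case False
    then obtain s where "s \<in> fringe t" "card (labels s) = k" "relabel s \<in> C" by auto
    then have "(\<Prod>s\<in>fringe t. if card (labels s) = k then ?f (relabel s) else 1) = 0"
      by (intro prod_zero finite_fringe bexI[of _ s]) auto
    then show ?thesis unfolding of_bool_def if_not_P[OF False] .
  qed
  moreover have "(\<Prod>s\<in>fringe t. if card (labels s) = k then c else 1) =
      c ^ card {s \<in> fringe t. card (labels s) = k}" for c :: real and t :: "nat labelled_tree"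
    by (simp add: prod.If_cases Int_def)
  ultimately show ?thesis
    using wsum_prod_fringe_relabel[OF vs, of "{1..n}" k ?f] assms(2)
    unfolding \<theta> avg_def by simp
qed

text \<open>The second Bonferroni bound, with the square of n in place of the binomial
  coefficient.\<close>

lemma one_minus_power_le:
  assumes "0 \<le> p" "p \<le> (1::real)"
  shows "(1 - p) ^ n \<le> 1 - p * real n + p\<^sup>2 * (real n)\<^sup>2"
proof (induction n)
  case (Suc n)
  have "(1 - p) ^ Suc n \<le> (1 - p) * (1 - p * real n + p\<^sup>2 * (real n)\<^sup>2)"
    using Suc assms by (simp add: mult_left_mono)
  also have "\<dots> = 1 - p * real (Suc n) + p\<^sup>2 * ((real n)\<^sup>2 + real n) - p * (p\<^sup>2 * (real n)\<^sup>2)"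
    by (simp add: algebra_simps power2_eq_square)
  also have "\<dots> \<le> 1 - p * real (Suc n) + p\<^sup>2 * (real (Suc n))\<^sup>2"
  proof -
    have "p\<^sup>2 * ((real n)\<^sup>2 + real n) \<le> p\<^sup>2 * (real (Suc n))\<^sup>2"
      by (intro mult_left_mono) (auto simp: power2_eq_square algebra_simps)
    moreover have "p * (p\<^sup>2 * (real n)\<^sup>2) \<ge> 0" using assms by simp
    ultimately show ?thesis by linarith
  qed
  finally show ?case .
qed simp

lemma card_fringe_size:
  assumes "t \<in> trees_on F {1..n}"
  shows "real (card {s \<in> fringe t. card (labels s) \<in> K}) = size_count K t"
proof -
  have inj: "inj_on labels (fringe t)" using assms inj_on_labels_fringe by (auto simp: trees_on_def)
  have "size_count K t = (\<Sum>s\<in>fringe t. of_bool (card (labels s) \<in> K))"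
    unfolding size_count_def fringe_labels_def by (simp only: sum.reindex[OF inj] o_def)
  also have "\<dots> = real (card {s \<in> fringe t. card (labels s) \<in> K})"
    by (simp add: of_bool_def sum.If_cases Int_def)
  finally show ?thesis ..
qed

lemma size_count_le:
  assumes "t \<in> trees_on F {1..n}"
  shows "size_count K t \<le> real n"
proof -
  have "size_count K t \<le> (\<Sum>S\<in>fringe_labels t. 1)" unfolding size_count_def by (intro sum_mono) auto
  then show ?thesis using card_fringe_labels[OF assms] by simp
qed

definition classes_of_size :: "nat labelled_tree set set \<Rightarrow> nat \<Rightarrow> nat labelled_tree \<Rightarrow> nat labelled_tree set set" where
  "classes_of_size X k t = {C \<in> X. \<exists>s\<in>fringe t. card (labels s) = k \<and> relabel s \<in> C}"

text \<open>With N the number of fringe subtrees of size k and p the probability of C, the class C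
  occurs with probability at least p E(N) - p^2 n^2. Summed over X, the first part counts subtrees
  in X with multiplicity, and in the second part the sum of p^2 is at most \<epsilon>.\<close>

lemma avg_classes_of_size:
  assumes vs: "very_simple F" and n: "n \<ge> 1" and k: "k \<ge> 1"
    and fin: "finite X" and disj: "disjoint X" and "\<epsilon> \<ge> 0"
    and pmax: "\<And>C. C \<in> X \<Longrightarrow> measure_pmf.prob (random_tree F k) C \<le> \<epsilon>"
  shows "avg F n (\<lambda>t. real (card (classes_of_size X k t))) \<ge>
    mean_size F n k * measure_pmf.prob (random_tree F k) (\<Union>X) - (real n)\<^sup>2 * \<epsilon>"
proof -
  let ?p = "\<lambda>C. measure_pmf.prob (random_tree F k) C"
  have mean: "mean_size F n k = avg F n (size_count {k})" by (simp add: avg_size_count)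
  have single: "avg F n (\<lambda>t. of_bool (\<exists>s\<in>fringe t. card (labels s) = k \<and> relabel s \<in> C)) \<ge>
      ?p C * mean_size F n k - \<epsilon> * ?p C * (real n)\<^sup>2" if C: "C \<in> X" for C
  proof -
    have "avg F n (\<lambda>t. of_bool (\<exists>s\<in>fringe t. card (labels s) = k \<and> relabel s \<in> C)) =
        avg F n (\<lambda>t. 1 - of_bool (\<forall>s\<in>fringe t. card (labels s) = k \<longrightarrow> relabel s \<notin> C))"
      by (intro avg_cong) (simp flip: of_bool_not_iff)
    also have "\<dots> = avg F n (\<lambda>t. 1 - (1 - ?p C) ^ card {s \<in> fringe t. card (labels s) = k})"
      unfolding avg_diff avg_class_absent[OF vs n k] prob_random_tree[OF vs k] ..
    also have "\<dots> \<ge> avg F n (\<lambda>t. ?p C * size_count {k} t - \<epsilon> * ?p C * (real n)\<^sup>2)"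
    proof (rule avg_mono[OF vs n])
      fix t assume t: "t \<in> trees_on F {1..n}"
      let ?m = "card {s \<in> fringe t. card (labels s) = k}"
      have m: "real ?m = size_count {k} t" using card_fringe_size[OF t, of "{k}"] by simp
      then have "(real ?m)\<^sup>2 \<le> (real n)\<^sup>2" using size_count_le[OF t, of "{k}"] by (intro power_mono) auto
      moreover have "(?p C)\<^sup>2 \<le> \<epsilon> * ?p C" using pmax[OF C] by (simp add: power2_eq_square mult_right_mono)
      ultimately have "(?p C)\<^sup>2 * (real ?m)\<^sup>2 \<le> \<epsilon> * ?p C * (real n)\<^sup>2"
        using \<open>\<epsilon> \<ge> 0\<close> by (intro mult_mono) auto
      then show "?p C * size_count {k} t - \<epsilon> * ?p C * (real n)\<^sup>2 \<le> 1 - (1 - ?p C) ^ ?m"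
        using one_minus_power_le[of "?p C" ?m] unfolding m[symmetric] by simp
    qed
    finally show ?thesis unfolding avg_diff avg_cmult avg_const[OF vs n] mean .
  qed
  have union: "?p (\<Union>X) = (\<Sum>C\<in>X. ?p C)"
    using measure_pmf.finite_measure_finite_Union[of X "\<lambda>C. C" "random_tree F k"] fin disj
    by (simp add: disjoint_family_on_def disjoint_def)
  have "(\<Sum>C\<in>X. ?p C * mean_size F n k - \<epsilon> * ?p C * (real n)\<^sup>2) \<le>
      (\<Sum>C\<in>X. avg F n (\<lambda>t. of_bool (\<exists>s\<in>fringe t. card (labels s) = k \<and> relabel s \<in> C)))"
    by (intro sum_mono single)
  also have "\<dots> = avg F n (\<lambda>t. real (card (classes_of_size X k t)))"
    unfolding avg_sum[symmetric] classes_of_size_def using fin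
    by (intro avg_cong) (simp add: of_bool_def sum.If_cases Int_def)
  also have "(\<Sum>C\<in>X. ?p C * mean_size F n k - \<epsilon> * ?p C * (real n)\<^sup>2) =
      mean_size F n k * ?p (\<Union>X) - (\<epsilon> * (real n)\<^sup>2) * ?p (\<Union>X)"
    unfolding union sum_subtractf by (simp add: sum_distrib_left mult_ac)
  finally have "mean_size F n k * ?p (\<Union>X) - (\<epsilon> * (real n)\<^sup>2) * ?p (\<Union>X) \<le>
      avg F n (\<lambda>t. real (card (classes_of_size X k t)))" .
  moreover have "(\<epsilon> * (real n)\<^sup>2) * ?p (\<Union>X) \<le> (\<epsilon> * (real n)\<^sup>2) * 1"
    using \<open>\<epsilon> \<ge> 0\<close> by (intro mult_left_mono) auto
  ultimately show ?thesis by (simp add: mult_ac)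
qed

section \<open>Counting classes over several sizes\<close>

lemma finite_classes: "partition_on (trees_of_size F k) X \<Longrightarrow> finite X"
  using finite_elements finite_trees by blast

text \<open>A tree determines its number of labels, so a member of a class also determines the size
  k. Classes counted for different k are therefore different sets, and the counts may be
  added.\<close>

lemma fringe_class_unique:
  assumes part: "\<And>k. partition_on (trees_of_size F k) (I k)"
    and t: "t \<in> trees_on F A" "s \<in> fringe t"
  obtains C where "C \<in> I (card (labels s))" "relabel s \<in> C"
    "\<And>k D. D \<in> I k \<Longrightarrow> relabel s \<in> D \<Longrightarrow> k = card (labels s) \<and> D = C"
proof -
  let ?k = "card (labels s)"
  have r: "relabel s \<in> trees_of_size F ?k" using relabel_fringe[OF t] .
  then obtain C where C: "C \<in> I ?k" "relabel s \<in> C" using part[of ?k] by (auto simp: partition_on_def)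
  show thesis
  proof (rule that[OF C])
    fix k D assume D: "D \<in> I k" "relabel s \<in> D"
    then have "relabel s \<in> trees_of_size F k" using part[of k] by (auto simp: partition_on_def)
    then have "card (labels (relabel s)) = k" by (simp add: trees_of_size_def)
    moreover have "card (labels (relabel s)) = ?k" using r by (simp add: trees_of_size_def)
    ultimately have k: "k = ?k" by simp
    then show "k = ?k \<and> D = C"
      using part[of ?k] C D by (auto simp: partition_on_def disjoint_def)
  qed
qed

lemma num_fringe_classes_le:
  assumes part: "\<And>k. partition_on (trees_of_size F k) (I k)" and t: "t \<in> trees_on F {1..n}"
  shows "real (num_fringe_classes I t) \<le> (\<Sum>k\<in>{1..<m}. real (card (I k))) + size_count {m..} t"
proof -
  define cls where "cls s = (THE C. C \<in> I (card (labels s)) \<and> relabel s \<in> C)" for s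
  have cls: "cls s = C" if "s \<in> fringe t" "C \<in> I (card (labels s))" "relabel s \<in> C" for s C
    using fringe_class_unique[of F I, OF part t that(1)] that unfolding cls_def by (intro the_equality) metis+
  let ?U = "(\<Union>k\<in>{1..<m}. I k)" and ?V = "cls ` {s \<in> fringe t. card (labels s) \<in> {m..}}"
  have "{C. \<exists>s\<in>fringe t. C \<in> I (card (labels s)) \<and> relabel s \<in> C} \<subseteq> ?U \<union> ?V"
  proof
    fix C assume "C \<in> {C. \<exists>s\<in>fringe t. C \<in> I (card (labels s)) \<and> relabel s \<in> C}"
    then obtain s where s: "s \<in> fringe t" "C \<in> I (card (labels s))" "relabel s \<in> C" by auto
    have "labels s \<in> fringe_labels t" using s(1) by (simp add: fringe_labels_def)
    then have "finite (labels s)" using fringe_labels_in(1)[OF t] finite_subset by blast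
    then have "card (labels s) \<ge> 1" by (simp add: Suc_le_eq card_gt_0_iff)
    then show "C \<in> ?U \<union> ?V" using s cls[OF s] by (cases "card (labels s) < m") auto
  qed
  then have "num_fringe_classes I t \<le> card (?U \<union> ?V)"
    unfolding num_fringe_classes_def using finite_classes[OF part] by (intro card_mono) auto
  also have "\<dots> \<le> card ?U + card ?V" by (rule card_Un_le)
  also have "card ?U \<le> (\<Sum>k\<in>{1..<m}. card (I k))" by (intro card_UN_le) simp
  also have "card ?V \<le> card {s \<in> fringe t. card (labels s) \<in> {m..}}" by (intro card_image_le) simp
  finally have "real (num_fringe_classes I t) \<le>
      real ((\<Sum>k\<in>{1..<m}. card (I k)) + card {s \<in> fringe t. card (labels s) \<in> {m..}})"
    by (simp only: of_nat_le_iff)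
  then show ?thesis using card_fringe_size[OF t, of "{m..}"] by simp
qed

lemma card_classes_of_size_le:
  assumes part: "\<And>k. partition_on (trees_of_size F k) (I k)" and t: "t \<in> trees_on F {1..n}"
    and X: "X \<subseteq> I k"
  shows "real (card (classes_of_size X k t)) \<le> size_count {k} t"
proof -
  define cls where "cls s = (THE C. C \<in> I (card (labels s)) \<and> relabel s \<in> C)" for s
  have cls: "cls s = C" if "s \<in> fringe t" "C \<in> I (card (labels s))" "relabel s \<in> C" for s C
    using fringe_class_unique[of F I, OF part t that(1)] that unfolding cls_def by (intro the_equality) metis+
  have "classes_of_size X k t \<subseteq> cls ` {s \<in> fringe t. card (labels s) \<in> {k}}"
  proof
    fix C assume "C \<in> classes_of_size X k t"
    then obtain s where s: "s \<in> fringe t" "C \<in> I (card (labels s))" "relabel s \<in> C" "card (labels s) = k"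
      using X by (auto simp: classes_of_size_def)
    then show "C \<in> cls ` {s \<in> fringe t. card (labels s) \<in> {k}}" using cls[OF s(1-3)] by auto
  qed
  then have "card (classes_of_size X k t) \<le> card {s \<in> fringe t. card (labels s) \<in> {k}}"
    by (intro surj_card_le) auto
  then show ?thesis using card_fringe_size[OF t, of "{k}"] by simp
qed

lemma sum_card_classes_of_size_le:
  assumes part: "\<And>k. partition_on (trees_of_size F k) (I k)" and t: "t \<in> trees_on F {1..n}"
    and X: "\<And>k. X k \<subseteq> I k" and K: "finite K"
  shows "(\<Sum>k\<in>K. card (classes_of_size (X k) k t)) \<le> num_fringe_classes I t"
proof -
  have fin: "finite (classes_of_size (X k) k t)" for k
    using finite_subset[OF X finite_classes[OF part]] by (simp add: classes_of_size_def)
  have "classes_of_size (X k) k t \<inter> classes_of_size (X l) l t = {}" if "k \<noteq> l" for k l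
  proof (rule ccontr)
    assume "classes_of_size (X k) k t \<inter> classes_of_size (X l) l t \<noteq> {}"
    then obtain C s where C: "C \<in> I k" "C \<in> I l" "s \<in> fringe t" "relabel s \<in> C" "card (labels s) = k"
      using X by (force simp: classes_of_size_def)
    then show False using fringe_class_unique[of F I, OF part t C(3)] that by metis
  qed
  then have "(\<Sum>k\<in>K. card (classes_of_size (X k) k t)) = card (\<Union>k\<in>K. classes_of_size (X k) k t)"
    using K fin by (subst card_UN_disjoint) auto
  also have "\<dots> \<le> num_fringe_classes I t"
    unfolding num_fringe_classes_def
  proof (rule card_mono)
    have "{C. \<exists>s\<in>fringe t. C \<in> I (card (labels s)) \<and> relabel s \<in> C} \<subseteq> (\<Union>s\<in>fringe t. I (card (labels s)))"
      by auto
    then show "finite {C. \<exists>s\<in>fringe t. C \<in> I (card (labels s)) \<and> relabel s \<in> C}"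
      by (rule finite_subset) (use finite_classes[OF part] in auto)
    show "(\<Union>k\<in>K. classes_of_size (X k) k t) \<subseteq> {C. \<exists>s\<in>fringe t. C \<in> I (card (labels s)) \<and> relabel s \<in> C}"
      using X by (auto simp: classes_of_size_def)
  qed
  finally show ?thesis .
qed

section \<open>Concentration of the number of large fringe subtrees\<close>

definition lower_size :: "real \<Rightarrow> nat \<Rightarrow> nat" where
  "lower_size \<gamma> n = nat \<lceil>\<gamma> * ln (real n)\<rceil>"

text \<open>Large compared with log n, so that few fringe subtrees are bigger, yet so small that its
  fourth power is negligible against the square of n / log n in Chebyshev's inequality.\<close>

definition upper_size :: "nat \<Rightarrow> nat" where
  "upper_size n = nat \<lfloor>(ln (real n))\<^sup>2\<rfloor>"

lemma lower_size_bounds: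
  assumes "\<gamma> > 0" "n \<ge> 2"
  shows "\<gamma> * ln (real n) \<le> real (lower_size \<gamma> n)" "real (lower_size \<gamma> n) \<le> \<gamma> * ln (real n) + 1"
    "lower_size \<gamma> n \<ge> 1"
proof -
  have pos: "\<gamma> * ln (real n) > 0" using assms by simp
  then show "\<gamma> * ln (real n) \<le> real (lower_size \<gamma> n)" by (simp add: lower_size_def)
  with pos show "lower_size \<gamma> n \<ge> 1" by linarith
  show "real (lower_size \<gamma> n) \<le> \<gamma> * ln (real n) + 1" using pos by (simp add: lower_size_def)
qed

lemma upper_size_bounds:
  "(ln (real n))\<^sup>2 - 1 \<le> real (upper_size n)" "real (upper_size n) \<le> (ln (real n))\<^sup>2"
  by (simp_all add: upper_size_def)

lemma size_range_eventually:
  assumes "\<gamma> > 0"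
  shows "\<forall>\<^sub>F n in sequentially. n \<ge> 3 \<and> 1 \<le> lower_size \<gamma> n \<and> lower_size \<gamma> n \<le> upper_size n \<and>
    2 * upper_size n + 1 \<le> n"
proof -
  have "\<forall>\<^sub>F n in sequentially. \<gamma> * ln (real n) + 1 \<le> (ln (real n))\<^sup>2 - 1" by real_asymp
  moreover have "\<forall>\<^sub>F n in sequentially. 2 * (ln (real n))\<^sup>2 + 1 \<le> real n" by real_asymp
  moreover have "\<forall>\<^sub>F n in sequentially. n \<ge> (3::nat)" by (rule eventually_ge_at_top)
  ultimately show ?thesis
  proof eventually_elim
    case (elim n)
    have "real (lower_size \<gamma> n) \<le> real (upper_size n)"
      using lower_size_bounds(2)[OF assms, of n] upper_size_bounds(1)[of n] elim by linarith
    moreover have "real (2 * upper_size n + 1) \<le> real n" using upper_size_bounds(2)[of n] elim by simp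
    ultimately show ?case using lower_size_bounds(3)[OF assms, of n] elim by simp
  qed
qed

lemma total_attach_eq: "total_attach F n = (1 + attachment F) * real n - attachment F"
  by (simp add: total_attach_def algebra_simps)

lemma lower_size_limit:
  assumes "\<gamma> > 0"
  shows "(\<lambda>n. real (lower_size \<gamma> n) / ln (real n)) \<longlonglongrightarrow> \<gamma>"
proof (rule tendsto_sandwich)
  show "\<forall>\<^sub>F n in sequentially. \<gamma> \<le> real (lower_size \<gamma> n) / ln (real n)"
    using eventually_ge_at_top[of 2]
    by eventually_elim (use lower_size_bounds(1)[OF assms] in \<open>simp add: field_simps\<close>)
  show "\<forall>\<^sub>F n in sequentially. real (lower_size \<gamma> n) / ln (real n) \<le> \<gamma> + 1 / ln (real n)"
    using eventually_ge_at_top[of 2]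
    by eventually_elim (use lower_size_bounds(2)[OF assms] in \<open>simp add: field_simps\<close>)
  show "(\<lambda>n. \<gamma>) \<longlonglongrightarrow> \<gamma>" by simp
  show "(\<lambda>n. \<gamma> + 1 / ln (real n)) \<longlonglongrightarrow> \<gamma>" by real_asymp
qed

lemma total_attach_limit: "(\<lambda>n. total_attach F n / real n) \<longlonglongrightarrow> 1 + attachment F"
  unfolding total_attach_eq by real_asymp

lemma lower_total_attach_limit:
  assumes "very_simple F" "\<gamma> > 0"
  shows "(\<lambda>n. ln (real n) / total_attach F (lower_size \<gamma> n)) \<longlonglongrightarrow> 1 / ((1 + attachment F) * \<gamma>)"
proof -
  have "(\<lambda>n. attachment F / ln (real n)) \<longlonglongrightarrow> 0" by real_asymp
  from tendsto_diff[OF tendsto_mult[OF tendsto_const lower_size_limit[OF assms(2)]] this]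
  have "(\<lambda>n. (1 + attachment F) * (real (lower_size \<gamma> n) / ln (real n)) - attachment F / ln (real n))
      \<longlonglongrightarrow> (1 + attachment F) * \<gamma>" by simp
  then have "(\<lambda>n. 1 / ((1 + attachment F) * (real (lower_size \<gamma> n) / ln (real n)) - attachment F / ln (real n)))
      \<longlonglongrightarrow> 1 / ((1 + attachment F) * \<gamma>)"
    using attachment_bounds(1)[OF assms(1)] assms(2) by (intro tendsto_divide) auto
  then show ?thesis
    by (rule Lim_transform_eventually)
      (use eventually_ge_at_top[of 2] in eventually_elim, simp add: total_attach_eq diff_divide_distrib flip: diff_divide_distrib)
qed

lemma upper_total_attach_limit:
  assumes "very_simple F"
  shows "(\<lambda>n. ln (real n) / total_attach F (upper_size n)) \<longlonglongrightarrow> 0"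
proof (rule tendsto_sandwich)
  have b: "1 + attachment F > 0" using attachment_bounds(1)[OF assms] .
  let ?lb = "\<lambda>n. (1 + attachment F) * ((ln (real n))\<^sup>2 - 1) - attachment F"
  have ev: "\<forall>\<^sub>F n in sequentially. ?lb n > 0" using b by real_asymp
  have le: "?lb n \<le> total_attach F (upper_size n)" for n
    unfolding total_attach_eq using upper_size_bounds(1)[of n] b by simp
  show "\<forall>\<^sub>F n in sequentially. 0 \<le> ln (real n) / total_attach F (upper_size n)"
    using ev eventually_ge_at_top[of 2]
  proof eventually_elim
    case (elim n)
    then have "total_attach F (upper_size n) > 0" using le[of n] by linarith
    then show ?case using elim by simp
  qed
  show "\<forall>\<^sub>F n in sequentially. ln (real n) / total_attach F (upper_size n) \<le> ln (real n) / ?lb n"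
    using ev eventually_ge_at_top[of 2]
  proof eventually_elim
    case (elim n)
    then have "total_attach F (upper_size n) > 0" using le[of n] by linarith
    then show ?case using elim le[of n] by (intro divide_left_mono mult_pos_pos) auto
  qed
  show "(\<lambda>n. ln (real n) / ?lb n) \<longlonglongrightarrow> 0" using b by real_asymp
qed simp

lemma avg_markov:
  assumes "very_simple F" "n \<ge> 1" "c > 0" "\<And>t. t \<in> trees_on F {1..n} \<Longrightarrow> 0 \<le> h t"
  shows "avg F n (\<lambda>t. of_bool (c \<le> h t)) \<le> avg F n h / c"
proof -
  have "avg F n (\<lambda>t. of_bool (c \<le> h t)) \<le> avg F n (\<lambda>t. (1 / c) * h t)"
    using assms by (intro avg_mono) (auto simp: of_bool_def)
  then show ?thesis unfolding avg_cmult by simp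
qed

definition small_count :: "real \<Rightarrow> nat \<Rightarrow> nat labelled_tree \<Rightarrow> real" where
  "small_count \<gamma> n = size_count {lower_size \<gamma> n..<upper_size n}"

definition large_count :: "nat \<Rightarrow> nat labelled_tree \<Rightarrow> real" where
  "large_count n = size_count {upper_size n..}"

text \<open>In the telescoped mean only the lower end contributes in the limit:
  \<open>a_n / n\<close> tends to 1 + \<alpha>, which cancels against the growth of
  \<open>total_attach\<close> at the cutoff.\<close>

lemma avg_small_count_limit:
  assumes vs: "very_simple F" and \<gamma>: "\<gamma> > 0"
  shows "(\<lambda>n. avg F n (small_count \<gamma> n) / (real n / ln (real n))) \<longlonglongrightarrow> kappa F / \<gamma>"
proof -
  have b: "1 + attachment F > 0" using attachment_bounds(1)[OF vs] .
  have "(\<lambda>n. kappa F * (total_attach F n / real n) * (ln (real n) / total_attach F (lower_size \<gamma> n) -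
      ln (real n) / total_attach F (upper_size n))) \<longlonglongrightarrow>
      kappa F * (1 + attachment F) * (1 / ((1 + attachment F) * \<gamma>) - 0)"
    by (intro tendsto_intros total_attach_limit lower_total_attach_limit upper_total_attach_limit assms)
  also have "kappa F * (1 + attachment F) * (1 / ((1 + attachment F) * \<gamma>) - 0) = kappa F / \<gamma>"
    using b by simp
  finally show ?thesis
  proof (rule Lim_transform_eventually)
    show "\<forall>\<^sub>F n in sequentially. kappa F * (total_attach F n / real n) *
        (ln (real n) / total_attach F (lower_size \<gamma> n) - ln (real n) / total_attach F (upper_size n)) =
      avg F n (small_count \<gamma> n) / (real n / ln (real n))"
      using size_range_eventually[OF \<gamma>]
    proof eventually_elim
      case (elim n)
      then show ?case
        unfolding small_count_def by (subst avg_size_count_range[OF vs]) (auto simp: field_simps)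
    qed
  qed
qed

lemma avg_large_count_limit:
  assumes vs: "very_simple F"
  shows "\<eta> > 0 \<Longrightarrow> \<forall>\<^sub>F n in sequentially. avg F n (large_count n) \<le> \<eta> * (real n / ln (real n))"
proof -
  assume \<eta>: "\<eta> > 0"
  have "(\<lambda>n. kappa F * (total_attach F n / real n) * (ln (real n) / total_attach F (upper_size n)) + ln (real n) / real n)
      \<longlonglongrightarrow> kappa F * (1 + attachment F) * 0 + 0"
  proof (intro tendsto_add tendsto_mult tendsto_const total_attach_limit upper_total_attach_limit assms)
    show "(\<lambda>n. ln (real n) / real n) \<longlonglongrightarrow> 0" by real_asymp
  qed
  then have "\<forall>\<^sub>F n in sequentially. kappa F * (total_attach F n / real n) * (ln (real n) / total_attach F (upper_size n)) +
      ln (real n) / real n < \<eta>"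
    using \<eta> by (intro order_tendstoD) auto
  then show ?thesis using size_range_eventually[of 1, simplified]
  proof eventually_elim
    case (elim n)
    have "avg F n (large_count n) \<le> kappa F * total_attach F n / total_attach F (upper_size n) + 1"
      unfolding large_count_def using elim by (intro avg_size_count_ge[OF vs]) auto
    also have "\<dots> = (kappa F * (total_attach F n / real n) * (ln (real n) / total_attach F (upper_size n)) +
      ln (real n) / real n) * (real n / ln (real n))"
      using elim by (simp add: field_simps)
    also have "\<dots> \<le> \<eta> * (real n / ln (real n))" using elim by (intro mult_right_mono) auto
    finally show ?case .
  qed
qed

lemma large_count_tail:
  assumes vs: "very_simple F" and "\<eta> > 0" "\<epsilon> > 0"
  shows "\<forall>\<^sub>F n in sequentially. avg F n (\<lambda>t. of_bool (\<eta> * (real n / ln (real n)) \<le> large_count n t)) \<le> \<epsilon>"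
  \<comment> \<open>The mean is asked to be below \<epsilon> \<eta> n / log n, so Markov's
    inequality leaves exactly \<epsilon>.\<close>
  using avg_large_count_limit[OF vs mult_pos_pos[OF assms(3,2)]] eventually_ge_at_top[of 2]
proof eventually_elim
  case (elim n)
  let ?c = "\<eta> * (real n / ln (real n))"
  have c: "?c > 0" using elim assms by simp
  have "avg F n (\<lambda>t. of_bool (?c \<le> large_count n t)) \<le> avg F n (large_count n) / ?c"
    using elim c by (intro avg_markov[OF vs]) (auto simp: large_count_def size_count_def intro!: sum_nonneg)
  also have "\<dots> \<le> \<epsilon>"
    unfolding pos_divide_le_eq[OF c] using elim(1) by (simp only: mult.assoc)
  finally show ?case .
qed

lemma small_count_tail:
  assumes vs: "very_simple F" and \<gamma>: "\<gamma> > 0" and "\<eta> > 0" "\<epsilon> > 0"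
  shows "\<forall>\<^sub>F n in sequentially.
    avg F n (\<lambda>t. of_bool (\<eta> * (real n / ln (real n)) \<le> \<bar>small_count \<gamma> n t - avg F n (small_count \<gamma> n)\<bar>)) \<le> \<epsilon>"
proof -
  define N where "N n = real n / ln (real n)" for n :: nat
  define \<mu> where "\<mu> n = avg F n (small_count \<gamma> n)" for n
  have lim: "(\<lambda>n. \<mu> n / N n) \<longlonglongrightarrow> kappa F / \<gamma>"
    unfolding \<mu>_def N_def by (rule avg_small_count_limit[OF vs \<gamma>])
  have l1: "(\<lambda>n. (1 + attachment F) * (1 / real n) * (real n / total_attach F n)) \<longlonglongrightarrow>
      (1 + attachment F) * 0 * (1 / (1 + attachment F))"
  proof (intro tendsto_mult tendsto_const)
    have "(\<lambda>n. 1 / (total_attach F n / real n)) \<longlonglongrightarrow> 1 / (1 + attachment F)"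
      using attachment_bounds(1)[OF vs] by (intro tendsto_intros total_attach_limit) auto
    then show "(\<lambda>n. real n / total_attach F n) \<longlonglongrightarrow> 1 / (1 + attachment F)" by simp
    show "(\<lambda>n. 1 / real n) \<longlonglongrightarrow> 0" by real_asymp
  qed
  have l2: "(\<lambda>n. (((ln (real n))\<^sup>2)\<^sup>2 * (2 * (ln (real n))\<^sup>2 + 1)\<^sup>2) / (N n)\<^sup>2) \<longlonglongrightarrow> 0"
    unfolding N_def by real_asymp
  have l3: "(\<lambda>n. 2 * (ln (real n))\<^sup>2 / N n) \<longlonglongrightarrow> 0"
    unfolding N_def by real_asymp
  \<comment> \<open>The variance bound divided by the square of n / log n, with
    \<open>upper_size n\<close> replaced by the square of log n. It tends to 0, and Chebyshev's
    inequality finishes.\<close>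
  define V where "V n = (\<mu> n / N n)\<^sup>2 * ((1 + attachment F) * (1 / real n) * (real n / total_attach F n)) +
     (((ln (real n))\<^sup>2)\<^sup>2 * (2 * (ln (real n))\<^sup>2 + 1)\<^sup>2) / (N n)\<^sup>2 + 2 * (ln (real n))\<^sup>2 / N n * (\<mu> n / N n)" for n
  have "V \<longlonglongrightarrow> (kappa F / \<gamma>)\<^sup>2 * ((1 + attachment F) * 0 * (1 / (1 + attachment F))) + 0 + 0 * (kappa F / \<gamma>)"
    unfolding V_def by (intro tendsto_add tendsto_mult[OF l3 lim] l2 tendsto_mult[OF tendsto_power[OF lim] l1])
  then have "\<forall>\<^sub>F n in sequentially. V n < \<epsilon> * \<eta>\<^sup>2"
    using assms by (intro order_tendstoD) auto
  then show ?thesis using size_range_eventually[OF \<gamma>]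
  proof eventually_elim
    case (elim n)
    let ?Z = "small_count \<gamma> n" and ?m = "upper_size n"
    have N: "N n > 0" using elim by (simp add: N_def)
    have mu: "\<mu> n \<ge> 0"
    proof -
      have "avg F n (\<lambda>_. 0) \<le> \<mu> n" unfolding \<mu>_def
        using elim by (intro avg_mono[OF vs]) (auto simp: small_count_def size_count_def intro!: sum_nonneg)
      then show ?thesis using elim by (simp add: avg_const[OF vs])
    qed
    have m: "real ?m \<le> (ln (real n))\<^sup>2" by (rule upper_size_bounds(2))
    have "avg F n (\<lambda>t. (?Z t - \<mu> n)\<^sup>2) \<le>
        (\<mu> n)\<^sup>2 * (1 + attachment F) / total_attach F n + (real ?m)\<^sup>2 * (2 * real ?m + 1)\<^sup>2 + 2 * real ?m * \<mu> n"
      unfolding \<mu>_def small_count_def using elim by (intro variance_size_count[OF vs]) auto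
    also have "\<dots> \<le> (\<mu> n)\<^sup>2 * (1 + attachment F) / total_attach F n +
        ((ln (real n))\<^sup>2)\<^sup>2 * (2 * (ln (real n))\<^sup>2 + 1)\<^sup>2 + 2 * (ln (real n))\<^sup>2 * \<mu> n"
      using m mu by (intro add_mono mult_mono power_mono order_refl) auto
    also have "\<dots> = V n * (N n)\<^sup>2"
      using N elim total_attach_ge_1[OF vs, of n] by (simp add: V_def field_simps power2_eq_square)
    finally have var: "avg F n (\<lambda>t. (?Z t - \<mu> n)\<^sup>2) \<le> V n * (N n)\<^sup>2" .
    have c: "(\<eta> * N n)\<^sup>2 > 0" using N assms by simp
    have "avg F n (\<lambda>t. of_bool (\<eta> * N n \<le> \<bar>?Z t - \<mu> n\<bar>)) =
        avg F n (\<lambda>t. of_bool ((\<eta> * N n)\<^sup>2 \<le> (?Z t - \<mu> n)\<^sup>2))"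
      using N assms by (intro avg_cong) (simp add: abs_le_square_iff[symmetric])
    also have "\<dots> \<le> avg F n (\<lambda>t. (?Z t - \<mu> n)\<^sup>2) / (\<eta> * N n)\<^sup>2"
      using elim c by (intro avg_markov[OF vs]) auto
    also have "\<dots> \<le> V n * (N n)\<^sup>2 / (\<eta> * N n)\<^sup>2" using var c by (intro divide_right_mono) auto
    also have "\<dots> = V n / \<eta>\<^sup>2" using N by (simp add: power_mult_distrib)
    also have "\<dots> \<le> \<epsilon>" using elim assms by (simp add: field_simps)
    finally show ?case by (simp add: N_def \<mu>_def)
  qed
qed

section \<open>The number of classes\<close>

text \<open>Turns statements valid eventually for each fixed accuracy j into a single one whose
  accuracy improves with n; this produces the error sequences of the theorem.\<close>

lemma eventually_diagonal:
  assumes "\<And>j. \<forall>\<^sub>F n in sequentially. P n (j::nat)"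
  obtains J :: "nat \<Rightarrow> nat" where "filterlim J at_top sequentially" "\<forall>\<^sub>F n in sequentially. P n (J n)"
proof -
  \<comment> \<open>The largest accuracy up to n that is valid at n. The default 0 is itself valid
    for all large n.\<close>
  define J where "J n = Max (insert 0 {j. j \<le> n \<and> P n j})" for n
  have fin: "finite (insert 0 {j. j \<le> n \<and> P n j})" for n by simp
  have "\<forall>\<^sub>F n in sequentially. j \<le> J n" for j
    using assms[of j] eventually_ge_at_top[of j]
    by eventually_elim (auto simp: J_def intro!: Max_ge)
  moreover have "\<forall>\<^sub>F n in sequentially. P n (J n)"
    using assms[of 0]
  proof eventually_elim
    case (elim n)
    have "J n \<in> insert 0 {j. j \<le> n \<and> P n j}" unfolding J_def using fin by (intro Max_in) auto
    then show ?case using elim by auto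
  qed
  ultimately show thesis using that by (auto simp: filterlim_at_top)
qed

lemma avg_of_bool_union:
  assumes "very_simple F" "n \<ge> 1" "\<And>t. t \<in> trees_on F {1..n} \<Longrightarrow> E t \<Longrightarrow> E1 t \<or> E2 t"
  shows "avg F n (\<lambda>t. of_bool (E t)) \<le> avg F n (\<lambda>t. of_bool (E1 t)) + avg F n (\<lambda>t. of_bool (E2 t))"
  unfolding avg_add[symmetric] using assms by (intro avg_mono) (auto simp: of_bool_def)

locale fringe_classes =
  fixes F :: family and I J :: "nat \<Rightarrow> nat labelled_tree set set" and C1 C2 :: real
  assumes vs: "very_simple F"
    and part: "\<And>k. partition_on (trees_of_size F k) (I k)"
    and C1: "limsup (\<lambda>k. ereal (ln (real (card (I k))) / real k)) = ereal C1"
    and sub: "\<And>k. J k \<subseteq> I k"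
    and C2: "C2 > 0"
    and C2a: "(\<lambda>k. measure_pmf.prob (random_tree F k) (\<Union>(J k))) \<longlonglongrightarrow> 1"
    and C2b: "\<exists>g \<in> o(\<lambda>k. real k). \<forall>k. \<forall>C\<in>J k.
      measure_pmf.prob (random_tree F k) C \<le> exp (- C2 * real k + g k)"
begin

section \<open>Consequences of (C1) and (C2)\<close>

lemma kappa_pos: "kappa F > 0"
  using attachment_bounds(1)[OF vs] by (simp add: kappa_def)

lemma card_classes_ge_1:
  assumes "k \<ge> 1"
  shows "card (I k) \<ge> 1"
proof -
  have "I k \<noteq> {}" using trees_nonempty[OF vs assms] partition_onD1[OF part[of k]] by auto
  then show ?thesis using finite_classes[OF part, of k] by (simp add: Suc_le_eq card_gt_0_iff)
qed

lemma log_card_eventually_less: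
  assumes "\<delta> > 0"
  shows "\<forall>\<^sub>F k in sequentially. ln (real (card (I k))) / real k < C1 + \<delta>"
proof -
  have "limsup (\<lambda>k. ereal (ln (real (card (I k))) / real k)) < ereal (C1 + \<delta>)"
    unfolding C1 using assms by simp
  from Limsup_lessD[OF this] show ?thesis by simp
qed

text \<open>(C1) speaks about large k only; the finitely many other sizes are absorbed into M, since
  the sum over small classes starts at size 1.\<close>

lemma card_classes_bound:
  assumes "\<delta> > 0"
  obtains M where "M > 0" "\<And>k. k \<ge> 1 \<Longrightarrow> real (card (I k)) \<le> M * exp ((C1 + \<delta>) * real k)"
proof -
  obtain K where K: "\<And>k. k \<ge> K \<Longrightarrow> ln (real (card (I k))) / real k < C1 + \<delta>"
    using log_card_eventually_less[OF assms] by (auto simp: eventually_sequentially)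
  define M where "M = 1 + (\<Sum>k<K. real (card (I k)) / exp ((C1 + \<delta>) * real k))"
  have M: "M \<ge> 1" by (simp add: M_def sum_nonneg)
  show thesis
  proof
    show "M > 0" using M by simp
    fix k :: nat assume k: "k \<ge> 1"
    show "real (card (I k)) \<le> M * exp ((C1 + \<delta>) * real k)"
    proof (cases "k < K")
      case True
      have "real (card (I k)) / exp ((C1 + \<delta>) * real k) \<le> (\<Sum>k<K. real (card (I k)) / exp ((C1 + \<delta>) * real k))"
        using True by (intro member_le_sum) auto
      also have "\<dots> \<le> M" by (simp add: M_def)
      finally show ?thesis by (simp add: field_simps)
    next
      case False
      then have "ln (real (card (I k))) < (C1 + \<delta>) * real k" using K[of k] k by (simp add: field_simps)
      then have "real (card (I k)) \<le> exp ((C1 + \<delta>) * real k)"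
        using card_classes_ge_1[OF k] by (metis exp_le_cancel_iff exp_ln less_imp_le of_nat_0_less_iff zero_less_one less_le_trans)
      also have "\<dots> \<le> M * exp ((C1 + \<delta>) * real k)" using M by simp
      finally show ?thesis .
    qed
  qed
qed

lemma prob_class_eventually_le:
  assumes "\<delta> > 0"
  shows "\<forall>\<^sub>F k in sequentially. \<forall>C\<in>J k. measure_pmf.prob (random_tree F k) C \<le> exp (- (C2 - \<delta>) * real k)"
proof -
  obtain g where g: "g \<in> o(\<lambda>k. real k)"
    "\<And>k C. C \<in> J k \<Longrightarrow> measure_pmf.prob (random_tree F k) C \<le> exp (- C2 * real k + g k)"
    using C2b by blast
  have "\<forall>\<^sub>F k in sequentially. norm (g k) \<le> \<delta> * norm (real k)"
    using landau_o.smallD[OF g(1) assms] .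
  then show ?thesis
  proof eventually_elim
    case (elim k)
    show ?case
    proof
      fix C assume "C \<in> J k"
      then have "measure_pmf.prob (random_tree F k) C \<le> exp (- C2 * real k + g k)" by (rule g(2))
      also have "\<dots> \<le> exp (- (C2 - \<delta>) * real k)" using elim by (simp add: algebra_simps)
      finally show "measure_pmf.prob (random_tree F k) C \<le> exp (- (C2 - \<delta>) * real k)" .
    qed
  qed
qed

text \<open>If C1 \<le> 0, there are eventually fewer than exp (C2 k / 4) classes, while each class
  in J has probability at most exp (- C2 k / 2). Together they could not reach probability
  1/2.\<close>

lemma C1_pos: "C1 > 0"
proof (rule ccontr)
  assume "\<not> C1 > 0"
  have "\<forall>\<^sub>F k in sequentially. ln (real (card (I k))) / real k < C1 + C2 / 4"
    using C2 by (intro log_card_eventually_less) simp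
  then have "\<forall>\<^sub>F k in sequentially. ln (real (card (I k))) / real k < C2 / 4"
    by (rule eventually_mono) (use \<open>\<not> C1 > 0\<close> in linarith)
  moreover have "\<forall>\<^sub>F k in sequentially. 1 / 2 < measure_pmf.prob (random_tree F k) (\<Union>(J k))"
    using C2a by (rule order_tendstoD) simp
  moreover have "\<forall>\<^sub>F k in sequentially. \<forall>C\<in>J k. measure_pmf.prob (random_tree F k) C \<le> exp (- (C2 - C2 / 2) * real k)"
    using C2 by (intro prob_class_eventually_le) simp
  moreover have "\<forall>\<^sub>F k in sequentially. C2 / 4 * real k + ln 2 \<le> C2 / 2 * real k" using C2 by real_asymp
  moreover have "\<forall>\<^sub>F k in sequentially. (1::nat) \<le> k" by (rule eventually_ge_at_top)
  ultimately have "\<forall>\<^sub>F k::nat in sequentially. False"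
  proof eventually_elim
    case (elim k)
    have fin: "finite (J k)" using finite_subset[OF sub finite_classes[OF part]] .
    have "1 / 2 < measure_pmf.prob (random_tree F k) (\<Union>C\<in>J k. C)" using elim by simp
    also have "\<dots> \<le> (\<Sum>C\<in>J k. measure_pmf.prob (random_tree F k) C)"
      using fin by (intro measure_pmf.finite_measure_subadditive_finite) auto
    also have "\<dots> \<le> (\<Sum>C\<in>J k. exp (- (C2 / 2) * real k))" using elim by (intro sum_mono) auto
    also have "\<dots> \<le> real (card (I k)) * exp (- (C2 / 2) * real k)"
      using card_mono[OF finite_classes[OF part] sub, of k] by (simp add: mult_right_mono)
    finally have "exp (C2 / 2 * real k) < 2 * real (card (I k))" by (simp add: exp_minus field_simps)
    moreover have "2 * real (card (I k)) > 0" using card_classes_ge_1[of k] elim by simp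
    ultimately have "C2 / 2 * real k < ln (2 * real (card (I k)))"
      by (metis exp_less_cancel_iff exp_ln)
    also have "\<dots> = ln 2 + ln (real (card (I k)))" using card_classes_ge_1[of k] elim by (simp add: ln_mult)
    also have "\<dots> < ln 2 + C2 / 4 * real k" using elim by (simp add: field_simps)
    finally show False using elim by simp
  qed
  then show False by simp
qed

section \<open>The upper bound\<close>

abbreviation scale :: "nat \<Rightarrow> real" where
  "scale n \<equiv> real n / ln (real n)"

lemma small_classes_negligible:
  assumes "\<gamma> > 0" "C1 * \<gamma> < 1" "\<eta> > 0"
  shows "\<forall>\<^sub>F n in sequentially. (\<Sum>k\<in>{1..<lower_size \<gamma> n}. real (card (I k))) \<le> \<eta> * scale n"
proof -
  \<comment> \<open>The midpoint choice makes \<theta> = (1 + C1 \<gamma>) / 2 < 1. The sum is then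
    of order at most \<open>n^\<theta>\<close> log n.\<close>
  define \<delta> where "\<delta> = (1 / \<gamma> - C1) / 2"
  define \<theta> where "\<theta> = (C1 + \<delta>) * \<gamma>"
  have \<delta>: "\<delta> > 0" using assms by (simp add: \<delta>_def field_simps)
  have \<theta>: "\<theta> < 1" using assms by (simp add: \<theta>_def \<delta>_def field_simps)
  obtain M where M: "M > 0" "\<And>k. k \<ge> 1 \<Longrightarrow> real (card (I k)) \<le> M * exp ((C1 + \<delta>) * real k)"
    using card_classes_bound[OF \<delta>] by blast
  define D where "D = M * exp (C1 + \<delta>)"
  have "(\<lambda>n. (\<gamma> * ln (real n) + 1) * (D * real n powr \<theta>) / (real n / ln (real n))) \<longlonglongrightarrow> 0"
    using \<theta> by real_asymp
  then have "\<forall>\<^sub>F n in sequentially. (\<gamma> * ln (real n) + 1) * (D * real n powr \<theta>) / scale n < \<eta>"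
    using assms(3) by (rule order_tendstoD)
  then show ?thesis using eventually_ge_at_top[of 2]
  proof eventually_elim
    case (elim n)
    let ?l = "lower_size \<gamma> n"
    note lb = lower_size_bounds[OF assms(1) elim(2)]
    have "(\<Sum>k\<in>{1..<?l}. real (card (I k))) \<le> (\<Sum>k\<in>{1..<?l}. D * real n powr \<theta>)"
    proof (rule sum_mono)
      fix k assume k: "k \<in> {1..<?l}"
      then have "real k \<le> \<gamma> * ln (real n) + 1" using lb(2) by simp
      then have "(C1 + \<delta>) * real k \<le> (C1 + \<delta>) * (\<gamma> * ln (real n) + 1)"
        using C1_pos \<delta> by (intro mult_left_mono) auto
      also have "\<dots> = (C1 + \<delta>) + \<theta> * ln (real n)" by (simp add: \<theta>_def algebra_simps)
      finally have "M * exp ((C1 + \<delta>) * real k) \<le> M * exp ((C1 + \<delta>) + \<theta> * ln (real n))"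
        using M(1) by simp
      also have "\<dots> = D * real n powr \<theta>" using elim by (simp add: D_def powr_def exp_add)
      finally show "real (card (I k)) \<le> D * real n powr \<theta>" using M(2)[of k] k by simp
    qed
    also have "\<dots> \<le> real ?l * (D * real n powr \<theta>)" using M(1) by (simp add: D_def mult_right_mono)
    also have "\<dots> \<le> (\<gamma> * ln (real n) + 1) * (D * real n powr \<theta>)"
      using lb(2) M(1) by (intro mult_right_mono) (auto simp: D_def)
    also have "\<dots> \<le> \<eta> * scale n"
    proof -
      have "scale n > 0" using elim by simp
      from elim(1)[unfolded pos_divide_less_eq[OF this]] show ?thesis by (rule less_imp_le)
    qed
    finally show ?case .
  qed
qed

lemma avg_small_count_bounds:
  assumes "\<gamma> > 0" "\<eta> > 0"
  shows "\<forall>\<^sub>F n in sequentially. \<bar>avg F n (small_count \<gamma> n) - kappa F / \<gamma> * scale n\<bar> \<le> \<eta> * scale n"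
proof -
  have "\<forall>\<^sub>F n in sequentially. dist (avg F n (small_count \<gamma> n) / scale n) (kappa F / \<gamma>) < \<eta>"
    using avg_small_count_limit[OF vs assms(1)] assms(2) by (rule tendstoD)
  then show ?thesis using eventually_ge_at_top[of 2]
  proof eventually_elim
    case (elim n)
    have N: "scale n > 0" using elim by simp
    have "\<bar>a - c * M\<bar> = \<bar>a / M - c\<bar> * M" if "M > 0" for a c M :: real
    proof -
      have "a - c * M = (a / M - c) * M" using that by (simp add: left_diff_distrib)
      then show ?thesis using that by (simp only: abs_mult abs_of_pos)
    qed
    from this[OF N] have "\<bar>avg F n (small_count \<gamma> n) - kappa F / \<gamma> * scale n\<bar> =
        \<bar>avg F n (small_count \<gamma> n) / scale n - kappa F / \<gamma>\<bar> * scale n" .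
    also have "\<dots> \<le> \<eta> * scale n"
      using elim N by (intro mult_right_mono) (auto simp: dist_real_def)
    finally show ?case .
  qed
qed

lemma num_fringe_classes_split:
  assumes "t \<in> trees_on F {1..n}" "lower_size \<gamma> n \<le> upper_size n"
  shows "real (num_fringe_classes I t) \<le>
    (\<Sum>k\<in>{1..<lower_size \<gamma> n}. real (card (I k))) + small_count \<gamma> n t + large_count n t"
proof -
  have "size_count {lower_size \<gamma> n..} t = small_count \<gamma> n t + large_count n t"
    unfolding small_count_def large_count_def size_count_def sum.distrib[symmetric] using assms(2)
    by (intro sum.cong) (auto simp: of_bool_def)
  then show ?thesis using num_fringe_classes_le[OF part assms(1), of "lower_size \<gamma> n"] by simp
qed

lemma upper_bound:
  assumes "\<epsilon> > 0"
  shows "\<forall>\<^sub>F n in sequentially. avg F n (\<lambda>t. real (num_fringe_classes I t)) \<le> kappa F * C1 * scale n * (1 + \<epsilon>)"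
    and "\<forall>\<^sub>F n in sequentially.
      avg F n (\<lambda>t. of_bool (kappa F * C1 * scale n * (1 + \<epsilon>) < real (num_fringe_classes I t))) \<le> \<epsilon>"
proof -
  \<comment> \<open>Now \<kappa> / \<gamma> = \<kappa> C1 (1 + \<epsilon> / 2). The remaining slack
    \<kappa> C1 \<epsilon> / 2 equals 8 \<eta>, of which 4 \<eta> are used.\<close>
  define \<gamma> where "\<gamma> = 1 / ((1 + \<epsilon> / 2) * C1)"
  define \<eta> where "\<eta> = kappa F * C1 * \<epsilon> / 16"
  have \<gamma>: "\<gamma> > 0" using assms C1_pos by (simp add: \<gamma>_def)
  have "C1 * \<gamma> = 1 / (1 + \<epsilon> / 2)" using C1_pos by (simp add: \<gamma>_def)
  then have C\<gamma>: "C1 * \<gamma> < 1" using assms by simp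
  have \<eta>: "\<eta> > 0" using assms C1_pos kappa_pos by (simp add: \<eta>_def)
  have "kappa F / \<gamma> + 4 * \<eta> \<le> kappa F * C1 * (1 + \<epsilon>)"
    using mult_pos_pos[OF mult_pos_pos[OF kappa_pos C1_pos] assms] by (simp add: \<gamma>_def \<eta>_def field_simps)
  then have key: "kappa F / \<gamma> * scale n + 4 * (\<eta> * scale n) \<le> kappa F * C1 * scale n * (1 + \<epsilon>)" if "n \<ge> 2" for n
  proof -
    have "scale n \<ge> 0" using that by simp
    have "kappa F / \<gamma> * M + 4 * (\<eta> * M) \<le> kappa F * C1 * M * (1 + \<epsilon>)" if "M \<ge> 0" for M
      using mult_right_mono[OF \<open>kappa F / \<gamma> + 4 * \<eta> \<le> kappa F * C1 * (1 + \<epsilon>)\<close> that]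
      by (simp add: algebra_simps)
    from this[OF \<open>scale n \<ge> 0\<close>] show ?thesis .
  qed
  note ev = small_classes_negligible[OF \<gamma> C\<gamma> \<eta>] avg_small_count_bounds[OF \<gamma> \<eta>] size_range_eventually[OF \<gamma>]
  show "\<forall>\<^sub>F n in sequentially. avg F n (\<lambda>t. real (num_fringe_classes I t)) \<le> kappa F * C1 * scale n * (1 + \<epsilon>)"
    using ev avg_large_count_limit[OF vs \<eta>]
  proof eventually_elim
    case (elim n)
    then have n: "n \<ge> 1" "n \<ge> 2" by auto
    define s where "s = (\<Sum>k\<in>{1..<lower_size \<gamma> n}. real (card (I k)))"
    have "avg F n (\<lambda>t. real (num_fringe_classes I t)) \<le> avg F n (\<lambda>t. s + small_count \<gamma> n t + large_count n t)"
      unfolding s_def using elim by (intro avg_mono[OF vs n(1)] num_fringe_classes_split) auto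
    also have "\<dots> = s + avg F n (small_count \<gamma> n) + avg F n (large_count n)"
      unfolding avg_add avg_const[OF vs n(1)] ..
    also have "\<dots> \<le> kappa F / \<gamma> * scale n + 4 * (\<eta> * scale n)"
    proof -
      have "\<eta> * scale n \<ge> 0" using \<eta> n by simp
      moreover have "s \<le> \<eta> * scale n" using elim(1) by (simp only: s_def)
      moreover have "avg F n (small_count \<gamma> n) \<le> kappa F / \<gamma> * scale n + \<eta> * scale n"
        using elim(2) by (simp only: abs_le_iff) linarith
      ultimately show ?thesis using elim(4) by linarith
    qed
    also have "\<dots> \<le> kappa F * C1 * scale n * (1 + \<epsilon>)" by (rule key[OF n(2)])
    finally show ?case .
  qed
  have \<epsilon>2: "\<epsilon> / 2 > 0" using assms by simp
  show "\<forall>\<^sub>F n in sequentially.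
      avg F n (\<lambda>t. of_bool (kappa F * C1 * scale n * (1 + \<epsilon>) < real (num_fringe_classes I t))) \<le> \<epsilon>"
    using ev small_count_tail[OF vs \<gamma> \<eta> \<epsilon>2] large_count_tail[OF vs \<eta> \<epsilon>2]
  proof eventually_elim
    case (elim n)
    then have n: "n \<ge> 1" "n \<ge> 2" by auto
    let ?\<mu> = "avg F n (small_count \<gamma> n)"
    have "avg F n (\<lambda>t. of_bool (kappa F * C1 * scale n * (1 + \<epsilon>) < real (num_fringe_classes I t))) \<le>
      avg F n (\<lambda>t. of_bool (\<eta> * scale n \<le> \<bar>small_count \<gamma> n t - ?\<mu>\<bar>)) +
      avg F n (\<lambda>t. of_bool (\<eta> * scale n \<le> large_count n t))"
    proof (rule avg_of_bool_union[OF vs n(1)])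
      \<comment> \<open>One \<eta> pays for the small classes and one for the error of the mean; the
        two left force one of the two deviations.\<close>
      fix t assume t: "t \<in> trees_on F {1..n}" and gt: "kappa F * C1 * scale n * (1 + \<epsilon>) < real (num_fringe_classes I t)"
      have "real (num_fringe_classes I t) \<le> \<eta> * scale n + small_count \<gamma> n t + large_count n t"
        using num_fringe_classes_split[OF t, of \<gamma>] elim(1,3) by linarith
      moreover have "?\<mu> \<le> kappa F / \<gamma> * scale n + \<eta> * scale n" using elim(2) by (simp only: abs_le_iff) linarith
      ultimately show "\<eta> * scale n \<le> \<bar>small_count \<gamma> n t - ?\<mu>\<bar> \<or> \<eta> * scale n \<le> large_count n t"
        using gt key[OF n(2)] mult_nonneg_nonneg[OF less_imp_le[OF \<eta>], of "scale n"] n by linarith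
    qed
    then show ?case using elim(4,5) by linarith
  qed
qed

section \<open>The lower bound\<close>

definition typical_classes :: "real \<Rightarrow> nat \<Rightarrow> nat labelled_tree \<Rightarrow> real" where
  "typical_classes \<gamma> n t = (\<Sum>k\<in>{lower_size \<gamma> n..<upper_size n}. real (card (classes_of_size (J k) k t)))"

lemma typical_classes_bounds:
  assumes "t \<in> trees_on F {1..n}"
  shows "typical_classes \<gamma> n t \<le> real (num_fringe_classes I t)" "typical_classes \<gamma> n t \<le> small_count \<gamma> n t"
proof -
  have "real (\<Sum>k\<in>{lower_size \<gamma> n..<upper_size n}. card (classes_of_size (J k) k t)) \<le> real (num_fringe_classes I t)"
    unfolding of_nat_le_iff by (rule sum_card_classes_of_size_le[OF part assms sub]) simp
  then show "typical_classes \<gamma> n t \<le> real (num_fringe_classes I t)" by (simp add: typical_classes_def)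
  have "typical_classes \<gamma> n t \<le> (\<Sum>k\<in>{lower_size \<gamma> n..<upper_size n}. size_count {k} t)"
    unfolding typical_classes_def by (intro sum_mono card_classes_of_size_le[OF part assms sub])
  also have "\<dots> = small_count \<gamma> n t"
    by (simp add: small_count_def size_count_eq_sum)
  finally show "typical_classes \<gamma> n t \<le> small_count \<gamma> n t" .
qed

text \<open>The deficit has two sources: subtrees outside typical classes, a fraction \<beta> of the
  mean, and repetitions. The latter cost at most \<open>n^(2 - \<theta>)\<close> for each of at most
  (log n)^2 sizes, which is negligible because \<theta> > 1.\<close>

lemma typical_classes_deficit:
  assumes "\<gamma> > 0" "C2 * \<gamma> > 1" "\<eta> > 0"
  shows "\<forall>\<^sub>F n in sequentially. avg F n (\<lambda>t. small_count \<gamma> n t - typical_classes \<gamma> n t) \<le> \<eta> * scale n"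
proof -
  \<comment> \<open>The midpoint again: \<theta> = (1 + C2 \<gamma>) / 2 > 1.\<close>
  define \<delta> where "\<delta> = (C2 - 1 / \<gamma>) / 2"
  define \<theta> where "\<theta> = (C2 - \<delta>) * \<gamma>"
  have \<delta>: "\<delta> > 0" using assms by (simp add: \<delta>_def field_simps)
  have \<theta>: "\<theta> > 1" using assms by (simp add: \<theta>_def \<delta>_def field_simps)
  have C\<delta>: "C2 - \<delta> \<ge> 0" using \<theta> assms(1) unfolding \<theta>_def by (smt (verit) mult_neg_pos)
  \<comment> \<open>The mean is eventually at most (\<kappa> / \<gamma> + 1) n / log n, so the
    atypical part uses half of \<eta>.\<close>
  define \<beta> where "\<beta> = \<eta> / (2 * (kappa F / \<gamma> + 1))"
  have \<kappa>\<gamma>: "kappa F / \<gamma> > 0" using kappa_pos assms by simp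
  have \<beta>: "\<beta> > 0" "\<beta> * (kappa F / \<gamma> + 1) = \<eta> / 2"
  proof -
    define c where "c = kappa F / \<gamma> + 1"
    have "c > 0" using \<kappa>\<gamma> by (simp add: c_def)
    then show "\<beta> > 0" "\<beta> * (kappa F / \<gamma> + 1) = \<eta> / 2"
      using assms(3) unfolding \<beta>_def c_def[symmetric] by simp_all
  qed
  have "\<forall>\<^sub>F k in sequentially. 1 - \<beta> < measure_pmf.prob (random_tree F k) (\<Union>(J k))"
    using C2a \<beta> by (intro order_tendstoD) auto
  with prob_class_eventually_le[OF \<delta>]
  have "\<forall>\<^sub>F k in sequentially. (\<forall>C\<in>J k. measure_pmf.prob (random_tree F k) C \<le> exp (- (C2 - \<delta>) * real k)) \<and>
      1 - \<beta> < measure_pmf.prob (random_tree F k) (\<Union>(J k))"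
    by (rule eventually_conj)
  then obtain K where K: "\<And>k C. k \<ge> K \<Longrightarrow> C \<in> J k \<Longrightarrow> measure_pmf.prob (random_tree F k) C \<le> exp (- (C2 - \<delta>) * real k)"
    "\<And>k. k \<ge> K \<Longrightarrow> 1 - \<beta> < measure_pmf.prob (random_tree F k) (\<Union>(J k))"
    unfolding eventually_sequentially by blast
  have "(\<lambda>n. (ln (real n))\<^sup>2 * ((real n)\<^sup>2 * real n powr (- \<theta>)) / (real n / ln (real n))) \<longlonglongrightarrow> 0"
    using \<theta> by real_asymp
  then have "\<forall>\<^sub>F n in sequentially. (ln (real n))\<^sup>2 * ((real n)\<^sup>2 * real n powr (- \<theta>)) / scale n < \<eta> / 2"
    using assms(3) by (intro order_tendstoD) auto
  moreover have "\<forall>\<^sub>F n in sequentially. real K \<le> \<gamma> * ln (real n)" using assms(1) by real_asymp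
  ultimately show ?thesis using size_range_eventually[OF assms(1)] avg_small_count_bounds[OF assms(1) zero_less_one]
  proof eventually_elim
    case (elim n)
    then have n: "n \<ge> 1" "n \<ge> 2" by auto
    have N: "scale n > 0" using n by simp
    let ?R = "{lower_size \<gamma> n..<upper_size n}" and ?\<mu> = "avg F n (small_count \<gamma> n)"
    have single: "avg F n (\<lambda>t. real (card (classes_of_size (J k) k t))) \<ge>
        mean_size F n k * (1 - \<beta>) - (real n)\<^sup>2 * real n powr (- \<theta>)" if k: "k \<in> ?R" for k
    proof -
      have kl: "\<gamma> * ln (real n) \<le> real k"
      proof -
        have "real (lower_size \<gamma> n) \<le> real k" using k by simp
        then show ?thesis using lower_size_bounds(1)[OF assms(1) n(2)] by linarith
      qed
      then have kK: "k \<ge> K" using elim(2) by linarith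
      have "exp (- (C2 - \<delta>) * real k) \<le> exp (- (C2 - \<delta>) * (\<gamma> * ln (real n)))"
        unfolding exp_le_cancel_iff mult_minus_left neg_le_iff_le by (rule mult_left_mono[OF kl C\<delta>])
      also have "\<dots> = real n powr (- \<theta>)" using n by (simp add: powr_def \<theta>_def algebra_simps)
      finally have le: "exp (- (C2 - \<delta>) * real k) \<le> real n powr (- \<theta>)" .
      have "measure_pmf.prob (random_tree F k) C \<le> real n powr (- \<theta>)" if "C \<in> J k" for C
        using K(1)[OF kK that] le by (rule order_trans)
      moreover have "finite (J k)" using finite_subset[OF sub finite_classes[OF part]] .
      moreover have "disjoint (J k)" using part[of k] sub[of k] by (auto simp: partition_on_def intro: pairwise_subset)
      moreover have "k \<ge> 1" using elim k by auto
      ultimately have "mean_size F n k * measure_pmf.prob (random_tree F k) (\<Union>(J k)) - (real n)\<^sup>2 * real n powr (- \<theta>) \<le>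
          avg F n (\<lambda>t. real (card (classes_of_size (J k) k t)))"
        by (intro avg_classes_of_size[OF vs n(1)]) auto
      moreover have "mean_size F n k * (1 - \<beta>) \<le> mean_size F n k * measure_pmf.prob (random_tree F k) (\<Union>(J k))"
      proof (rule mult_left_mono)
        have "avg F n (\<lambda>_. 0) \<le> mean_size F n k"
          unfolding mean_size_def by (intro avg_mono[OF vs n(1)] sum_nonneg) auto
        then show "0 \<le> mean_size F n k" by (simp add: avg_const[OF vs n(1)])
      qed (use K(2)[OF kK] in simp)
      ultimately show ?thesis by linarith
    qed
    have \<mu>: "?\<mu> = (\<Sum>k\<in>?R. mean_size F n k)" by (simp add: small_count_def avg_size_count)
    have "avg F n (typical_classes \<gamma> n) = (\<Sum>k\<in>?R. avg F n (\<lambda>t. real (card (classes_of_size (J k) k t))))"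
      unfolding avg_sum[symmetric] by (intro avg_cong) (simp add: typical_classes_def)
    also have "\<dots> \<ge> (\<Sum>k\<in>?R. mean_size F n k * (1 - \<beta>) - (real n)\<^sup>2 * real n powr (- \<theta>))"
      by (intro sum_mono single)
    also have "(\<Sum>k\<in>?R. mean_size F n k * (1 - \<beta>) - (real n)\<^sup>2 * real n powr (- \<theta>)) =
        ?\<mu> * (1 - \<beta>) - real (card ?R) * ((real n)\<^sup>2 * real n powr (- \<theta>))"
      by (simp only: \<mu> sum_subtractf sum_distrib_right sum_constant)
    finally have "?\<mu> - avg F n (typical_classes \<gamma> n) \<le> \<beta> * ?\<mu> + real (card ?R) * ((real n)\<^sup>2 * real n powr (- \<theta>))"
      by (simp add: algebra_simps)
    also have "real (card ?R) * ((real n)\<^sup>2 * real n powr (- \<theta>)) \<le> (ln (real n))\<^sup>2 * ((real n)\<^sup>2 * real n powr (- \<theta>))"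
      using upper_size_bounds(2)[of n] by (intro mult_right_mono) auto
    also have "\<dots> \<le> \<eta> / 2 * scale n"
      using elim(1)[unfolded pos_divide_less_eq[OF N]] by (rule less_imp_le)
    also have "\<beta> * ?\<mu> \<le> \<beta> * ((kappa F / \<gamma> + 1) * scale n)"
    proof (rule mult_left_mono)
      show "?\<mu> \<le> (kappa F / \<gamma> + 1) * scale n" using elim(4) by (simp only: abs_le_iff distrib_right) linarith
    qed (use \<beta>(1) in simp)
    also have "\<beta> * ((kappa F / \<gamma> + 1) * scale n) = \<eta> / 2 * scale n"
      unfolding mult.assoc[symmetric] \<beta>(2) ..
    finally show ?case unfolding avg_diff by simp
  qed
qed

text \<open>No second moment of the number of typical classes is required. It never exceeds the
  concentrated count of subtrees, so the nonnegative difference is controlled by its mean.\<close>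

lemma lower_bound:
  assumes "\<epsilon> > 0" "\<epsilon> < 1"
  shows "\<forall>\<^sub>F n in sequentially.
    avg F n (\<lambda>t. of_bool (real (num_fringe_classes I t) < kappa F * C2 * scale n * (1 - \<epsilon>))) \<le> \<epsilon>"
proof -
  \<comment> \<open>Now \<kappa> / \<gamma> = \<kappa> C2 (1 - \<epsilon> / 2), again with slack 8
    \<eta>.\<close>
  define \<gamma> where "\<gamma> = 1 / ((1 - \<epsilon> / 2) * C2)"
  define \<eta> where "\<eta> = kappa F * C2 * \<epsilon> / 16"
  have \<gamma>: "\<gamma> > 0" using assms C2 by (simp add: \<gamma>_def)
  have C\<gamma>: "C2 * \<gamma> > 1" using assms C2 by (simp add: \<gamma>_def field_simps)
  have \<eta>: "\<eta> > 0" using assms C2 kappa_pos by (simp add: \<eta>_def)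
  have ineq: "kappa F * C2 * (1 - \<epsilon>) \<le> kappa F / \<gamma> - 4 * \<eta>"
    using mult_pos_pos[OF mult_pos_pos[OF kappa_pos C2] assms(1)] by (simp add: \<gamma>_def \<eta>_def field_simps)
  have key: "kappa F * C2 * scale n * (1 - \<epsilon>) \<le> kappa F / \<gamma> * scale n - 4 * (\<eta> * scale n)" if "n \<ge> 2" for n
  proof -
    have "scale n \<ge> 0" using that by simp
    have "kappa F * C2 * M * (1 - \<epsilon>) \<le> kappa F / \<gamma> * M - 4 * (\<eta> * M)" if "M \<ge> 0" for M
      using mult_right_mono[OF ineq that] by (simp add: algebra_simps)
    from this[OF \<open>scale n \<ge> 0\<close>] show ?thesis .
  qed
  have \<epsilon>2: "\<epsilon> / 2 > 0" using assms by simp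
  show ?thesis
    \<comment> \<open>The deficit is asked to be at most (\<epsilon> / 2) \<eta> n / log n, so
      Markov's inequality at level \<eta> n / log n gives \<epsilon> / 2.\<close>
    using typical_classes_deficit[OF \<gamma> C\<gamma> mult_pos_pos[OF \<epsilon>2 \<eta>]] avg_small_count_bounds[OF \<gamma> \<eta>]
      small_count_tail[OF vs \<gamma> \<eta> \<epsilon>2] eventually_ge_at_top[of 2]
  proof eventually_elim
    case (elim n)
    then have n: "n \<ge> 1" "n \<ge> 2" by auto
    have N: "\<eta> * scale n > 0" using n \<eta> by simp
    let ?\<mu> = "avg F n (small_count \<gamma> n)"
    have "avg F n (\<lambda>t. of_bool (real (num_fringe_classes I t) < kappa F * C2 * scale n * (1 - \<epsilon>))) \<le>
      avg F n (\<lambda>t. of_bool (\<eta> * scale n \<le> \<bar>small_count \<gamma> n t - ?\<mu>\<bar>)) +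
      avg F n (\<lambda>t. of_bool (\<eta> * scale n \<le> small_count \<gamma> n t - typical_classes \<gamma> n t))"
    proof (rule avg_of_bool_union[OF vs n(1)])
      fix t assume t: "t \<in> trees_on F {1..n}" and lt: "real (num_fringe_classes I t) < kappa F * C2 * scale n * (1 - \<epsilon>)"
      have "kappa F / \<gamma> * scale n - \<eta> * scale n \<le> ?\<mu>" using elim(2) by (simp only: abs_le_iff) linarith
      then show "\<eta> * scale n \<le> \<bar>small_count \<gamma> n t - ?\<mu>\<bar> \<or>
          \<eta> * scale n \<le> small_count \<gamma> n t - typical_classes \<gamma> n t"
        using lt typical_classes_bounds(1)[OF t, of \<gamma>] key[OF n(2)] N by linarith
    qed
    also have "avg F n (\<lambda>t. of_bool (\<eta> * scale n \<le> small_count \<gamma> n t - typical_classes \<gamma> n t)) \<le>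
        avg F n (\<lambda>t. small_count \<gamma> n t - typical_classes \<gamma> n t) / (\<eta> * scale n)"
      using typical_classes_bounds(2) by (intro avg_markov[OF vs n(1) N]) simp
    also have "\<dots> \<le> \<epsilon> / 2"
      unfolding pos_divide_le_eq[OF N] using elim(1) by (simp only: mult.assoc)
    finally show ?case using elim(3) by linarith
  qed
qed

text \<open>The number of classes is nonnegative, so the bound in probability with \<epsilon> / 2
  yields the factor (1 - \<epsilon> / 2)^2 \<ge> 1 - \<epsilon> for the mean.\<close>

lemma avg_lower_bound:
  assumes "\<epsilon> > 0" "\<epsilon> < 1"
  shows "\<forall>\<^sub>F n in sequentially. kappa F * C2 * scale n * (1 - \<epsilon>) \<le> avg F n (\<lambda>t. real (num_fringe_classes I t))"
proof -
  have "\<epsilon> / 2 > 0" "\<epsilon> / 2 < 1" using assms by auto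
  from lower_bound[OF this] eventually_ge_at_top[of 2] show ?thesis
  proof eventually_elim
    case (elim n)
    then have n: "n \<ge> 1" by auto
    define x where "x = kappa F * C2 * scale n"
    have x: "x \<ge> 0" using elim kappa_pos C2 by (simp add: x_def)
    have "x * (1 - \<epsilon>) \<le> x * (1 - \<epsilon> / 2) * (1 - \<epsilon> / 2)"
      using mult_left_mono[of "1 - \<epsilon>" "(1 - \<epsilon> / 2) * (1 - \<epsilon> / 2)" x] x by (simp add: algebra_simps)
    also have "\<dots> \<le> x * (1 - \<epsilon> / 2) *
        (1 - avg F n (\<lambda>t. of_bool (real (num_fringe_classes I t) < x * (1 - \<epsilon> / 2))))"
      using elim(1) x assms unfolding x_def[symmetric] by (intro mult_left_mono) auto
    also have "\<dots> = avg F n (\<lambda>t. x * (1 - \<epsilon> / 2) * (1 - of_bool (real (num_fringe_classes I t) < x * (1 - \<epsilon> / 2))))"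
      unfolding avg_cmult avg_diff avg_const[OF vs n] ..
    also have "\<dots> \<le> avg F n (\<lambda>t. real (num_fringe_classes I t))"
      by (intro avg_mono[OF vs n]) (auto simp: of_bool_def)
    finally show ?case unfolding x_def .
  qed
qed

end

theorem theorem2:
  fixes F :: family
    and I J :: "nat \<Rightarrow> nat labelled_tree set set"
    and C1 C2 :: real
  assumes "very_simple F"
    and "\<And>k. partition_on (trees_of_size F k) (I k)"
    and C1: "limsup (\<lambda>k. ereal (ln (real (card (I k))) / real k)) = ereal C1"
    and "\<And>k. J k \<subseteq> I k"
    and "C2 > 0"
    and C2a: "(\<lambda>k. measure_pmf.prob (random_tree F k) (\<Union>(J k))) \<longlonglongrightarrow> 1"
    and C2b: "\<exists>g \<in> o(\<lambda>k. real k). \<forall>k. \<forall>C\<in>J k.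
      measure_pmf.prob (random_tree F k) C \<le> exp (- C2 * real k + g k)"
  shows "(\<exists>e1 e2 :: nat \<Rightarrow> real. e1 \<longlonglongrightarrow> 0 \<and> e2 \<longlonglongrightarrow> 0 \<and>
      (\<forall>\<^sub>F n in sequentially.
        kappa F * C2 * real n / ln (real n) * (1 + e1 n)
          \<le> measure_pmf.expectation (random_tree F n) (\<lambda>t. real (num_fringe_classes I t)) \<and>
        measure_pmf.expectation (random_tree F n) (\<lambda>t. real (num_fringe_classes I t))
          \<le> kappa F * C1 * real n / ln (real n) * (1 + e2 n)))
    \<and> (\<exists>e1 e2 :: nat \<Rightarrow> real. e1 \<longlonglongrightarrow> 0 \<and> e2 \<longlonglongrightarrow> 0 \<and>
      (\<lambda>n. measure_pmf.prob (random_tree F n)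
        {t. kappa F * C2 * real n / ln (real n) * (1 + e1 n) \<le> real (num_fringe_classes I t) \<and>
            real (num_fringe_classes I t) \<le> kappa F * C1 * real n / ln (real n) * (1 + e2 n)})
        \<longlonglongrightarrow> 1)"
proof -
  interpret fringe_classes F I J C1 C2
    by (intro fringe_classes.intro assms)
  define A where "A = (\<lambda>t. real (num_fringe_classes I t))"
  \<comment> \<open>The summand 2 keeps every value strictly below 1, as the lower bounds
    require.\<close>
  define \<epsilon> where "\<epsilon> j = 1 / (real j + 2)" for j :: nat
  have \<epsilon>: "\<epsilon> j > 0" "\<epsilon> j < 1" for j by (simp_all add: \<epsilon>_def)
  define lo where "lo n x = kappa F * C2 * real n / ln (real n) * (1 + - x)" for n :: nat and x
  define up where "up n x = kappa F * C1 * real n / ln (real n) * (1 + x)" for n :: nat and x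
  have "\<forall>\<^sub>F n in sequentially. n \<ge> 1 \<and> lo n (\<epsilon> j) \<le> avg F n A \<and> avg F n A \<le> up n (\<epsilon> j) \<and>
      avg F n (\<lambda>t. of_bool (A t < lo n (\<epsilon> j))) \<le> \<epsilon> j \<and> avg F n (\<lambda>t. of_bool (up n (\<epsilon> j) < A t)) \<le> \<epsilon> j" for j
    using eventually_ge_at_top[of 1] avg_lower_bound[OF \<epsilon>[of j]] upper_bound(1)[OF \<epsilon>(1)[of j]]
      lower_bound[OF \<epsilon>[of j]] upper_bound(2)[OF \<epsilon>(1)[of j]]
    by eventually_elim (simp add: A_def lo_def up_def)
  \<comment> \<open>One accuracy sequence serves the mean and the tail bounds at once, so both parts
    of the theorem use the same error terms.\<close>
  then obtain m where m: "filterlim m at_top sequentially"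
    and good: "\<forall>\<^sub>F n in sequentially. n \<ge> 1 \<and> lo n (\<epsilon> (m n)) \<le> avg F n A \<and> avg F n A \<le> up n (\<epsilon> (m n)) \<and>
      avg F n (\<lambda>t. of_bool (A t < lo n (\<epsilon> (m n)))) \<le> \<epsilon> (m n) \<and>
      avg F n (\<lambda>t. of_bool (up n (\<epsilon> (m n)) < A t)) \<le> \<epsilon> (m n)"
    by (rule eventually_diagonal[where P = "\<lambda>n j. n \<ge> 1 \<and> lo n (\<epsilon> j) \<le> avg F n A \<and> avg F n A \<le> up n (\<epsilon> j) \<and>
      avg F n (\<lambda>t. of_bool (A t < lo n (\<epsilon> j))) \<le> \<epsilon> j \<and> avg F n (\<lambda>t. of_bool (up n (\<epsilon> j) < A t)) \<le> \<epsilon> j"])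
  have "\<epsilon> \<longlonglongrightarrow> 0" unfolding \<epsilon>_def by real_asymp
  then have lim: "(\<lambda>n. \<epsilon> (m n)) \<longlonglongrightarrow> 0" using m by (rule filterlim_compose)
  then have lim': "(\<lambda>n. - \<epsilon> (m n)) \<longlonglongrightarrow> 0" using tendsto_minus by fastforce
  have exp: "\<forall>\<^sub>F n in sequentially. lo n (\<epsilon> (m n)) \<le> measure_pmf.expectation (random_tree F n) A \<and>
      measure_pmf.expectation (random_tree F n) A \<le> up n (\<epsilon> (m n))"
    using good by eventually_elim (simp add: expectation_random_tree[OF vs])
  have prob: "(\<lambda>n. measure_pmf.prob (random_tree F n) {t. lo n (\<epsilon> (m n)) \<le> A t \<and> A t \<le> up n (\<epsilon> (m n))}) \<longlonglongrightarrow> 1"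
  proof (rule tendsto_sandwich)
    show "\<forall>\<^sub>F n in sequentially. 1 - 2 * \<epsilon> (m n) \<le>
        measure_pmf.prob (random_tree F n) {t. lo n (\<epsilon> (m n)) \<le> A t \<and> A t \<le> up n (\<epsilon> (m n))}"
      using good
    proof eventually_elim
      case (elim n)
      then have n: "n \<ge> 1" by simp
      let ?E = "{t. lo n (\<epsilon> (m n)) \<le> A t \<and> A t \<le> up n (\<epsilon> (m n))}"
      have "1 - 2 * \<epsilon> (m n) \<le> 1 - (avg F n (\<lambda>t. of_bool (A t < lo n (\<epsilon> (m n)))) +
          avg F n (\<lambda>t. of_bool (up n (\<epsilon> (m n)) < A t)))"
        using elim by linarith
      also have "\<dots> \<le> 1 - avg F n (\<lambda>t. of_bool (t \<notin> ?E))"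
        by (intro diff_left_mono avg_of_bool_union[OF vs n]) auto
      also have "\<dots> = avg F n (\<lambda>t. 1 - of_bool (t \<notin> ?E))"
        unfolding avg_diff avg_const[OF vs n] ..
      also have "\<dots> = avg F n (indicator ?E)"
        by (intro avg_cong) (simp add: indicator_def of_bool_def)
      finally show ?case unfolding prob_random_tree[OF vs n] .
    qed
    show "\<forall>\<^sub>F n in sequentially.
        measure_pmf.prob (random_tree F n) {t. lo n (\<epsilon> (m n)) \<le> A t \<and> A t \<le> up n (\<epsilon> (m n))} \<le> 1"
      by simp
    show "(\<lambda>n. 1 - 2 * \<epsilon> (m n)) \<longlonglongrightarrow> 1"
      using tendsto_diff[OF tendsto_const[of 1] tendsto_mult[OF tendsto_const[of 2] lim]] by simp
  qed simp
  show ?thesis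
  proof (rule conjI, goal_cases)
    case 1
    show ?case
      by (rule exI[of _ "\<lambda>n. - \<epsilon> (m n)"], rule exI[of _ "\<lambda>n. \<epsilon> (m n)"])
        (intro conjI lim lim' exp[unfolded lo_def up_def A_def])
  next
    case 2
    show ?case
      by (rule exI[of _ "\<lambda>n. - \<epsilon> (m n)"], rule exI[of _ "\<lambda>n. \<epsilon> (m n)"])
        (intro conjI lim lim' prob[unfolded lo_def up_def A_def])
  qed
qed

end
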